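(* There is an algorithm that, given an assembly $\alpha$ and a temperature $\tau \in \mathbb{Z}^+$, decides in time $O(|\alpha| \log^2 |\alpha|)$ whether $\alpha$ is producible at temperature $\tau$ in the hierarchical abstract Tile Assembly Model (i.e., whether $\alpha$ is producible by the hierarchical tile assembly system $(T,\tau)$, where $T$ is the set of tile types appearing in $\alpha$).
   Context: A tile type is a unit square with, on each of its four sides (north, south, east, west), a glue label and a nonnegative integer strength. An assembly is a partial function $\alpha:\mathbb{Z}^2 \dashrightarrow T$ with finite nonempty domain whose full grid graph is connected; $|\alpha| = |\mathrm{dom}\,\alpha|$. Two tiles at adjacent positions interact if the glue labels on their abutting sides are equal and have positive strength. The binding graph of $\alpha$ has vertex set $\mathrm{dom}\,\alpha$ and an edge between adjacent interacting positions, weighted by the glue strength. $\alpha$ is $\tau$-stable if every cut of its binding graph has total weight at least $\tau$. A hierarchical tile assembly system is a pair $(T,\tau)$ with $T$ a finite set of tile types and $\tau \in \mathbb{Z}^+$. An assembly is producible if either it consists of a single tile of a type in $T$, or it equals $\alpha \cup \beta$ for two producible assemblies $\alpha,\beta$ with disjoint domains such that $\alpha \cup \beta$ is $\tau$-stable. (Adding tile types to $T$ that do not appear in $\alpha$ does not affect whether $\alpha$ is producible.) *)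

theory Defs
  imports Complex_Main "HOL-Library.Landau_Symbols"
begin

section \<open>Assemblies\<close>

text \<open>Glue labels matter only up to equality, so they are taken from the countable alphabet \<open>nat\<close>.\<close>

datatype glue = Glue (label: nat) (strength: nat)

datatype tile_type = Tile (north: glue) (south: glue) (east: glue) (west: glue)

datatype direction = North | South | East | West

type_synonym position = "int \<times> int"

type_synonym assembly = "position \<rightharpoonup> tile_type"

fun opposite :: "direction \<Rightarrow> direction" where
  "opposite North = South"
| "opposite South = North"
| "opposite East = West"
| "opposite West = East"

fun neighbour :: "position \<Rightarrow> direction \<Rightarrow> position" where
  "neighbour (x, y) North = (x, y + 1)"
| "neighbour (x, y) South = (x, y - 1)"
| "neighbour (x, y) East = (x + 1, y)"
| "neighbour (x, y) West = (x - 1, y)"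

fun glue_on :: "tile_type \<Rightarrow> direction \<Rightarrow> glue" where
  "glue_on t North = north t"
| "glue_on t South = south t"
| "glue_on t East = east t"
| "glue_on t West = west t"

definition grid_edges :: "position set \<Rightarrow> (position \<times> position) set" where
  "grid_edges D = {(p, q). p \<in> D \<and> q \<in> D \<and> (\<exists>d. q = neighbour p d)}"

definition is_assembly :: "assembly \<Rightarrow> bool" where
  "is_assembly \<alpha> \<longleftrightarrow>
     finite (dom \<alpha>) \<and> dom \<alpha> \<noteq> {} \<and>
     (\<forall>p \<in> dom \<alpha>. \<forall>q \<in> dom \<alpha>. (p, q) \<in> (grid_edges (dom \<alpha>))\<^sup>*)"

text \<open>
  \<open>interacts \<alpha> p d\<close>: the tile at \<open>p\<close> interacts with the tile next to it in direction \<open>d\<close>.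
  The strength belongs to the glue, so equal labels with different strengths are different glues
  and do not interact. If the label determines the strength, as is usually assumed, then this is
  just equality of labels together with positive strength.
\<close>

definition interacts :: "assembly \<Rightarrow> position \<Rightarrow> direction \<Rightarrow> bool" where
  "interacts \<alpha> p d \<longleftrightarrow>
     (\<exists>s t. \<alpha> p = Some s \<and> \<alpha> (neighbour p d) = Some t \<and>
            glue_on s d = glue_on t (opposite d) \<and> strength (glue_on s d) > 0)"

text \<open>
  The edges of the binding graph that leave \<open>S\<close>. Such an edge has exactly one endpoint in \<open>S\<close>; it is
  represented once, by that endpoint and the direction towards the other one.
\<close>

definition cut_edges :: "assembly \<Rightarrow> position set \<Rightarrow> (position \<times> direction) set" where
  "cut_edges \<alpha> S = {(p, d). p \<in> S \<and> neighbour p d \<notin> S \<and> interacts \<alpha> p d}"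

definition cut_weight :: "assembly \<Rightarrow> position set \<Rightarrow> nat" where
  "cut_weight \<alpha> S = (\<Sum>(p, d) \<in> cut_edges \<alpha> S. strength (glue_on (the (\<alpha> p)) d))"

definition stable :: "nat \<Rightarrow> assembly \<Rightarrow> bool" where
  "stable \<tau> \<alpha> \<longleftrightarrow> (\<forall>S. S \<noteq> {} \<and> S \<subset> dom \<alpha> \<longrightarrow> cut_weight \<alpha> S \<ge> \<tau>)"

inductive producible :: "tile_type set \<Rightarrow> nat \<Rightarrow> assembly \<Rightarrow> bool" for T \<tau> where
  single: "t \<in> T \<Longrightarrow> producible T \<tau> [p \<mapsto> t]"
| union: "producible T \<tau> \<alpha> \<Longrightarrow> producible T \<tau> \<beta> \<Longrightarrow> dom \<alpha> \<inter> dom \<beta> = {} \<Longrightarrow>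
          is_assembly (\<alpha> ++ \<beta>) \<Longrightarrow> stable \<tau> (\<alpha> ++ \<beta>) \<Longrightarrow> producible T \<tau> (\<alpha> ++ \<beta>)"

section \<open>Unit-cost random access machines\<close>

text \<open>
  Registers and memory cells hold integers. Registers are addressed only by constants in the
  program, so a program uses finitely many of them; the memory is addressed indirectly through
  registers. The only arithmetic operations are addition and subtraction.
\<close>

datatype instr =
    Const nat int
  | Move nat nat
  | Add nat nat nat
  | Sub nat nat nat
  | Load nat nat
  | Store nat nat
  | Jump nat
  | JumpZero nat nat
  | JumpPos nat nat

type_synonym program = "instr list"

text \<open>Program counter, registers, memory.\<close>
type_synonym config = "nat \<times> (nat \<Rightarrow> int) \<times> (nat \<Rightarrow> int)"

text \<open>A negative address is read as address \<open>0\<close>.\<close>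

fun exec :: "instr \<Rightarrow> config \<Rightarrow> config" where
  "exec (Const i c) (pc, r, m) = (pc + 1, r(i := c), m)"
| "exec (Move i j) (pc, r, m) = (pc + 1, r(i := r j), m)"
| "exec (Add i j k) (pc, r, m) = (pc + 1, r(i := r j + r k), m)"
| "exec (Sub i j k) (pc, r, m) = (pc + 1, r(i := r j - r k), m)"
| "exec (Load i j) (pc, r, m) = (pc + 1, r(i := m (nat (r j))), m)"
| "exec (Store i j) (pc, r, m) = (pc + 1, r, m(nat (r i) := r j))"
| "exec (Jump l) (pc, r, m) = (l, r, m)"
| "exec (JumpZero i l) (pc, r, m) = (if r i = 0 then l else pc + 1, r, m)"
| "exec (JumpPos i l) (pc, r, m) = (if r i > 0 then l else pc + 1, r, m)"

definition halted :: "program \<Rightarrow> config \<Rightarrow> bool" where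
  "halted P c \<longleftrightarrow> fst c \<ge> length P"

definition step :: "program \<Rightarrow> config \<Rightarrow> config" where
  "step P c = (if halted P c then c else exec (P ! fst c) c)"

text \<open>The input is stored from address \<open>0\<close> on; all other cells and all registers start at \<open>0\<close>.\<close>

definition initial :: "int list \<Rightarrow> config" where
  "initial inp = (0, (\<lambda>_. 0), (\<lambda>a. if a < length inp then inp ! a else 0))"

text \<open>The output is the content of register \<open>0\<close> after halting; the time is the number of steps.\<close>

definition outputs_within :: "program \<Rightarrow> int list \<Rightarrow> nat \<Rightarrow> int \<Rightarrow> bool" where
  "outputs_within P inp t out \<longleftrightarrow>
     (\<exists>k \<le> t. let c = (step P ^^ k) (initial inp) in halted P c \<and> fst (snd c) 0 = out)"

section \<open>Input format\<close>

definition lists_assembly :: "(position \<times> tile_type) list \<Rightarrow> assembly \<Rightarrow> bool" where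
  "lists_assembly xs \<alpha> \<longleftrightarrow> distinct (map fst xs) \<and> map_of xs = \<alpha>"

definition encode_glue :: "glue \<Rightarrow> int list" where
  "encode_glue g = [int (label g), int (strength g)]"

fun encode_tile :: "position \<times> tile_type \<Rightarrow> int list" where
  "encode_tile ((x, y), t) =
     [x, y] @ encode_glue (north t) @ encode_glue (south t) @
     encode_glue (east t) @ encode_glue (west t)"

definition encode :: "nat \<Rightarrow> (position \<times> tile_type) list \<Rightarrow> int list" where
  "encode \<tau> xs = [int (length xs), int \<tau>] @ concat (map encode_tile xs)"

end

theory Submission
  imports Defs
begin

text \<open>
  If \<open>\<alpha>\<close> is producible and the positions of \<open>\<alpha>\<close> are partitioned into at least two classes, then
  two classes are joined by total strength at least \<open>\<tau>\<close>: they contain the two children of a minimal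
  node of the assembly tree of \<open>\<alpha>\<close> that does not lie in one class. Conversely, the union of two
  disjoint producible subassemblies joined by strength at least \<open>\<tau>\<close> is stable, hence producible. So
  \<open>\<alpha>\<close> is producible iff merging classes joined by strength at least \<open>\<tau>\<close>, starting from single
  tiles and in any order, ends with one class.

  The machine keeps a label for every tile, the list of members of every class, the matrix of the
  strengths between classes, and a stack of pairs of tiles. When an entry of the matrix grows and is
  at least \<open>\<tau>\<close>, a pair of tiles from the two classes is pushed. A popped pair is checked again, so
  outdated entries of the stack do no harm. To merge two classes, the tiles of the smaller one are
  moved one by one, each with its at most four bonds. The sum over all tiles of \<open>log 2\<close> of the size
  of the class then grows by at least \<open>1\<close> per move, so all merges together
  make at most \<open>n * log 2 n\<close> moves.
  Memory is sparse and initially zero, so matrices and the lookup of positions cost constant time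
  per access; the program runs in time \<open>O(n * log 2 n)\<close>.
\<close>

section \<open>Producibility by greedy merging\<close>

text \<open>The machine has no multiplication, no procedures and no registers addressed at run time,
  so the algorithm is written in a small language with loops and two-dimensional arrays whose
  semantics carries a clock. Compilation preserves the clock exactly, so a bound on the clock in a
  loop invariant is a bound on machine steps. The price is a fixed row length \<open>C\<close> that
  column indices, the input and the height of the stack must respect. Hence the number of pushes,
  and with it the number of moves, must be bounded for memory safety already and not only for time;
  estimating n log n by n^2 is enough there, and \<open>12 * n * n + 12\<close> leaves room for it
  and takes about n additions to compute. Time is amortised: each stack entry carries 60 ticks for
  its own pop, and each unit of potential provides 600, enough for one move and the at most four
  entries that it pushes.\<close>

lemma UNIV_direction: "UNIV = {North, South, East, West}"
  using direction.exhaust by blast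

instance direction :: finite
  by standard (simp add: UNIV_direction)

lemma opposite_opposite [simp]: "opposite (opposite d) = d"
  by (cases d) auto

lemma neighbour_opposite [simp]: "neighbour (neighbour p d) (opposite d) = p"
  by (cases p; cases d) auto

text \<open>At most one direction leads from \<open>p\<close> to \<open>q\<close>, so at most one
  term is nonzero; as a sum it needs no adjacency hypothesis and can be exchanged with sums over
  positions.\<close>

definition edge_weight :: "assembly \<Rightarrow> position \<Rightarrow> position \<Rightarrow> nat" where
  "edge_weight \<alpha> p q =
     (\<Sum>d\<in>UNIV. if neighbour p d = q \<and> interacts \<alpha> p d then strength (glue_on (the (\<alpha> p)) d) else 0)"

definition cross_weight :: "assembly \<Rightarrow> position set \<Rightarrow> position set \<Rightarrow> nat" where
  "cross_weight \<alpha> A B = (\<Sum>p\<in>A. \<Sum>q\<in>B. edge_weight \<alpha> p q)"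

lemma interacts_opposite: "interacts \<alpha> (neighbour p d) (opposite d) \<longleftrightarrow> interacts \<alpha> p d"
  unfolding interacts_def by (auto; metis)

lemma edge_weight_commute: "edge_weight \<alpha> p q = edge_weight \<alpha> q p"
  unfolding edge_weight_def
proof (rule sum.reindex_bij_witness[of _ opposite opposite])
  fix d
  have 1: "neighbour q (opposite d) = p \<longleftrightarrow> neighbour p d = q"
    by (metis neighbour_opposite opposite_opposite)
  have "strength (glue_on (the (\<alpha> q)) (opposite d)) = strength (glue_on (the (\<alpha> p)) d)"
    if "neighbour p d = q" "interacts \<alpha> p d"
    using that unfolding interacts_def by auto
  moreover have "interacts \<alpha> q (opposite d) = interacts \<alpha> p d" if "neighbour p d = q"
    using that interacts_opposite by blast
  ultimately show "(if neighbour q (opposite d) = p \<and> interacts \<alpha> q (opposite d)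
       then strength (glue_on (the (\<alpha> q)) (opposite d)) else 0) =
     (if neighbour p d = q \<and> interacts \<alpha> p d then strength (glue_on (the (\<alpha> p)) d) else 0)"
    unfolding 1 by auto
qed auto

lemma cross_weight_commute: "cross_weight \<alpha> A B = cross_weight \<alpha> B A"
  unfolding cross_weight_def by (subst sum.swap) (simp add: edge_weight_commute)

section \<open>Weights in subassemblies, and cuts as double sums\<close>

lemma edge_weight_restrict:
  assumes "p \<in> A" "q \<in> A"
  shows "edge_weight (\<alpha> |` A) p q = edge_weight \<alpha> p q"
  using assms unfolding edge_weight_def interacts_def by (intro sum.cong) auto

text \<open>Nodes of an assembly tree are known only as submaps of \<open>\<alpha>\<close>; such a
  submap is a restriction to its own domain.\<close>

lemma edge_weight_map_le:
  assumes "\<gamma> \<subseteq>\<^sub>m \<alpha>" "p \<in> dom \<gamma>" "q \<in> dom \<gamma>"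
  shows "edge_weight \<gamma> p q = edge_weight \<alpha> p q"
proof -
  have "\<gamma> = \<alpha> |` dom \<gamma>"
    using assms(1) by (force simp: map_le_def restrict_map_def fun_eq_iff domIff)
  with assms(2,3) edge_weight_restrict show ?thesis by metis
qed

lemma cross_weight_restrict:
  "A \<subseteq> D \<Longrightarrow> B \<subseteq> D \<Longrightarrow> cross_weight (\<alpha> |` D) A B = cross_weight \<alpha> A B"
  unfolding cross_weight_def by (intro sum.cong refl edge_weight_restrict) auto

text \<open>The double sum is symmetric and monotone in both sides, the form in which cuts of parts
  and of unions can be compared.\<close>

lemma cut_weight_eq:
  assumes fin: "finite (dom \<alpha>)" and S: "S \<subseteq> dom \<alpha>"
  shows "cut_weight \<alpha> S = cross_weight \<alpha> S (dom \<alpha> - S)"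
proof -
  let ?g = "\<lambda>p d. strength (glue_on (the (\<alpha> p)) d)"
  have finS: "finite S" using fin S finite_subset by blast
  have ce: "cut_edges \<alpha> S = {(p, d) \<in> S \<times> UNIV. neighbour p d \<notin> S \<and> interacts \<alpha> p d}"
    unfolding cut_edges_def by auto
  have "cut_weight \<alpha> S = (\<Sum>(p, d)\<in>S \<times> UNIV. if neighbour p d \<notin> S \<and> interacts \<alpha> p d then ?g p d else 0)"
    unfolding cut_weight_def ce
    by (rule sum.mono_neutral_cong_left) (use finS in \<open>auto split: if_splits\<close>)
  also have "\<dots> = (\<Sum>p\<in>S. \<Sum>d\<in>UNIV. if neighbour p d \<notin> S \<and> interacts \<alpha> p d then ?g p d else 0)"
    by (rule sum.cartesian_product[symmetric])
  also have "\<dots> = (\<Sum>p\<in>S. \<Sum>q\<in>dom \<alpha> - S. edge_weight \<alpha> p q)"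
  proof (rule sum.cong[OF refl])
    fix p assume "p \<in> S"
    have "(\<Sum>q\<in>dom \<alpha> - S. edge_weight \<alpha> p q) =
        (\<Sum>d\<in>UNIV. \<Sum>q\<in>dom \<alpha> - S. if neighbour p d = q then (if interacts \<alpha> p d then ?g p d else 0) else 0)"
      unfolding edge_weight_def by (subst sum.swap) (auto intro!: sum.cong)
    \<comment> \<open>An interacting neighbour lies in \<open>dom \<alpha>\<close>, so the inner sum
      keeps its single term exactly when that neighbour is outside \<open>S\<close>.\<close>
    also have "\<dots> = (\<Sum>d\<in>UNIV. if neighbour p d \<notin> S \<and> interacts \<alpha> p d then ?g p d else 0)"
      using fin by (intro sum.cong) (auto simp: interacts_def)
    finally show "(\<Sum>d\<in>UNIV. if neighbour p d \<notin> S \<and> interacts \<alpha> p d then ?g p d else 0) =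
        (\<Sum>q\<in>dom \<alpha> - S. edge_weight \<alpha> p q)" by simp
  qed
  finally show ?thesis by (simp add: cross_weight_def)
qed

lemma producible_assembly_stable:
  "producible T \<tau> \<alpha> \<Longrightarrow> is_assembly \<alpha> \<and> stable \<tau> \<alpha>"
proof (induction rule: producible.induct)
  case (single t p)
  have "dom [p \<mapsto> t] = {p}" by simp
  then show ?case unfolding is_assembly_def stable_def by (simp only: subset_singleton_iff psubset_eq) auto
qed auto

lemma cross_weight_mono:
  assumes "finite A'" "finite B'" "A \<subseteq> A'" "B \<subseteq> B'"
  shows "cross_weight \<alpha> A B \<le> cross_weight \<alpha> A' B'"
proof -
  have "cross_weight \<alpha> A B \<le> (\<Sum>p\<in>A. \<Sum>q\<in>B'. edge_weight \<alpha> p q)"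
    unfolding cross_weight_def using assms by (intro sum_mono sum_mono2) auto
  also have "\<dots> \<le> cross_weight \<alpha> A' B'"
    unfolding cross_weight_def using assms by (intro sum_mono2) auto
  finally show ?thesis .
qed

text \<open>A cut that splits \<open>A\<close> or \<open>B\<close> is at least as heavy as the cut
  that it induces there; a cut that splits neither separates \<open>A\<close> from \<open>B\<close>
  and has weight \<open>cross_weight \<alpha> A B\<close>.\<close>

lemma stable_Un:
  assumes fin: "finite A" "finite B" and AB: "A \<union> B \<subseteq> dom \<alpha>" "A \<inter> B = {}"
    and A: "stable \<tau> (\<alpha> |` A)" and B: "stable \<tau> (\<alpha> |` B)"
    and cross: "cross_weight \<alpha> A B \<ge> \<tau>"
  shows "stable \<tau> (\<alpha> |` (A \<union> B))"
  unfolding stable_def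
proof (intro allI impI)
  have dom: "dom (\<alpha> |` D) = D" if "D \<subseteq> A \<union> B" for D using that AB(1) by auto
  fix S assume "S \<noteq> {} \<and> S \<subset> dom (\<alpha> |` (A \<union> B))"
  with dom[of "A \<union> B"] have S: "S \<noteq> {}" "S \<subset> A \<union> B" by auto
  have cut: "cut_weight (\<alpha> |` D) S = cross_weight \<alpha> S (D - S)" if "D \<subseteq> A \<union> B" "S \<subseteq> D" for D S
  proof -
    have "finite D" using that(1) fin by (simp add: finite_subset)
    with cut_weight_eq[of "\<alpha> |` D" S] that(2) show ?thesis
      unfolding dom[OF that(1)] by (simp add: cross_weight_restrict)
  qed
  have part: "\<tau> \<le> cross_weight \<alpha> S (A \<union> B - S)"
    if D: "stable \<tau> (\<alpha> |` D)" "D \<subseteq> A \<union> B" "S \<inter> D \<noteq> {}" "S \<inter> D \<subset> D" for D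
  proof -
    have "\<tau> \<le> cut_weight (\<alpha> |` D) (S \<inter> D)"
      using D dom[OF D(2)] unfolding stable_def by simp
    also have "\<dots> = cross_weight \<alpha> (S \<inter> D) (D - S \<inter> D)"
      using D by (intro cut) auto
    also have "\<dots> \<le> cross_weight \<alpha> S (A \<union> B - S)"
      using fin S D(2) by (intro cross_weight_mono) (auto intro: finite_subset)
    finally show ?thesis .
  qed
  have "\<tau> \<le> cross_weight \<alpha> S (A \<union> B - S)"
  proof (cases "S = A \<or> S = B")
    case True
    then have "A \<union> B - S = B \<and> S = A \<or> A \<union> B - S = A \<and> S = B" using AB(2) by auto
    with cross cross_weight_commute[of \<alpha> B A] show ?thesis by auto
  next
    case False
    then have "S \<inter> A \<noteq> {} \<and> S \<inter> A \<subset> A \<or> S \<inter> B \<noteq> {} \<and> S \<inter> B \<subset> B"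
      using S AB(2) by blast
    with part[OF A] part[OF B] show ?thesis by blast
  qed
  then show "\<tau> \<le> cut_weight (\<alpha> |` (A \<union> B)) S"
    using cut[of "A \<union> B" S] S by auto
qed

lemma is_assembly_Un:
  assumes A: "is_assembly (\<alpha> |` A)" and B: "is_assembly (\<alpha> |` B)" and AB: "A \<union> B \<subseteq> dom \<alpha>"
    and pq: "p \<in> A" "neighbour p d \<in> B"
  shows "is_assembly (\<alpha> |` (A \<union> B))"
proof -
  let ?E = "(grid_edges (A \<union> B))\<^sup>*"
  have dom: "dom (\<alpha> |` D) = D" if "D \<subseteq> A \<union> B" for D using that AB by auto
  have mono: "(grid_edges A)\<^sup>* \<subseteq> ?E" "(grid_edges B)\<^sup>* \<subseteq> ?E"
    by (intro rtrancl_mono; auto simp: grid_edges_def)+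
  have a: "(x, y) \<in> ?E" if "x \<in> A" "y \<in> A" for x y
    using A that mono(1) dom[of A] unfolding is_assembly_def by auto
  have b: "(x, y) \<in> ?E" if "x \<in> B" "y \<in> B" for x y
    using B that mono(2) dom[of B] unfolding is_assembly_def by auto
  have "(p, neighbour p d) \<in> grid_edges (A \<union> B)"
    using pq unfolding grid_edges_def by auto
  then have e1: "(p, neighbour p d) \<in> ?E" by blast
  have "p = neighbour (neighbour p d) (opposite d)" by simp
  then have "(neighbour p d, p) \<in> grid_edges (A \<union> B)"
    using pq unfolding grid_edges_def by blast
  then have e2: "(neighbour p d, p) \<in> ?E" by blast
  have ab: "(x, y) \<in> ?E" if "x \<in> A" "y \<in> B" for x y
    using a[OF that(1) pq(1)] e1 b[OF pq(2) that(2)] by (meson rtrancl_trans)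
  have ba: "(x, y) \<in> ?E" if "x \<in> B" "y \<in> A" for x y
    using b[OF that(1) pq(2)] e2 a[OF pq(1) that(2)] by (meson rtrancl_trans)
  from a b ab ba have "\<forall>x\<in>A \<union> B. \<forall>y\<in>A \<union> B. (x, y) \<in> ?E" by blast
  then show ?thesis
    using A B dom[of A] dom[of B] dom[of "A \<union> B"] unfolding is_assembly_def by auto
qed

text \<open>Since \<open>\<tau>\<close> is positive, the cross weight has a nonzero term; this
  yields an adjacent pair between \<open>A\<close> and \<open>B\<close> and thereby connectivity of
  the union.\<close>

lemma producible_Un:
  assumes A: "producible T \<tau> (\<alpha> |` A)" and B: "producible T \<tau> (\<alpha> |` B)"
    and AB: "A \<union> B \<subseteq> dom \<alpha>" "A \<inter> B = {}"
    and \<tau>: "\<tau> > 0" and cross: "cross_weight \<alpha> A B \<ge> \<tau>"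
  shows "producible T \<tau> (\<alpha> |` (A \<union> B))"
proof -
  have dom: "dom (\<alpha> |` D) = D" if "D \<subseteq> A \<union> B" for D using that AB by auto
  have fin: "finite A" "finite B"
    using producible_assembly_stable[OF A] producible_assembly_stable[OF B] dom[of A] dom[of B]
    unfolding is_assembly_def by auto
  have "cross_weight \<alpha> A B \<noteq> 0" using cross \<tau> by simp
  then obtain p where p: "p \<in> A" and "(\<Sum>q\<in>B. edge_weight \<alpha> p q) \<noteq> 0"
    unfolding cross_weight_def by (rule sum.not_neutral_contains_not_neutral)
  from this(2) obtain q where q: "q \<in> B" and "edge_weight \<alpha> p q \<noteq> 0"
    by (rule sum.not_neutral_contains_not_neutral)
  from this(2) obtain d where "(if neighbour p d = q \<and> interacts \<alpha> p d
      then strength (glue_on (the (\<alpha> p)) d) else 0) \<noteq> 0"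
    unfolding edge_weight_def by (rule sum.not_neutral_contains_not_neutral)
  then have d: "neighbour p d \<in> B" using q by (auto split: if_splits)
  have "is_assembly (\<alpha> |` (A \<union> B))"
    using is_assembly_Un[OF _ _ AB(1) p d] producible_assembly_stable[OF A]
      producible_assembly_stable[OF B] by blast
  moreover have "stable \<tau> (\<alpha> |` (A \<union> B))"
    using stable_Un[OF fin AB _ _ cross] producible_assembly_stable[OF A]
      producible_assembly_stable[OF B] by blast
  moreover have eq: "\<alpha> |` (A \<union> B) = (\<alpha> |` A) ++ (\<alpha> |` B)"
    using AB by (auto simp: fun_eq_iff map_add_def restrict_map_def split: option.splits)
  ultimately show ?thesis
    using producible.union[OF A B] dom[of A] dom[of B] AB(2) by simp
qed

text \<open>
  Take a minimal node of the assembly tree on which the labelling is not constant: its two children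
  have different labels, and they bind with strength at least \<open>\<tau>\<close>. This is why merging greedily never
  gets stuck on a producible assembly, in whatever order the merges happen.
\<close>

lemma producible_labelling:
  assumes "producible T \<tau> \<gamma>" and "\<gamma> \<subseteq>\<^sub>m \<alpha>" and fin: "finite (dom \<alpha>)"
  shows "(\<exists>x. \<forall>p\<in>dom \<gamma>. f p = x) \<or>
    (\<exists>x y. x \<noteq> y \<and> \<tau> \<le> cross_weight \<alpha> {p \<in> dom \<alpha>. f p = x} {p \<in> dom \<alpha>. f p = y})"
    (is "_ \<or> ?R")
  using assms(1,2)
proof (induction rule: producible.induct)
  case (union \<beta> \<gamma>)
  have le: "\<beta> \<subseteq>\<^sub>m \<alpha>" "\<gamma> \<subseteq>\<^sub>m \<alpha>"
    using union.prems map_add_comm[OF union.hyps(3)] map_le_trans[OF map_le_map_add] by metis+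
  have sub: "dom \<beta> \<subseteq> dom \<alpha>" "dom \<gamma> \<subseteq> dom \<alpha>" using le map_le_implies_dom_le by blast+
  show ?case
  proof (cases ?R)
    case False
    from union.IH(1)[OF le(1)] False obtain x where x: "\<forall>p\<in>dom \<beta>. f p = x" by (elim disjE exE) auto
    from union.IH(2)[OF le(2)] False obtain y where y: "\<forall>p\<in>dom \<gamma>. f p = y" by (elim disjE exE) auto
    have ne: "dom \<beta> \<noteq> {}" "dom \<gamma> \<noteq> {}"
      using union.hyps(1,2) producible_assembly_stable unfolding is_assembly_def by blast+
    have "x = y"
    proof (rule ccontr)
      assume "x \<noteq> y"
      have fin': "finite (dom (\<beta> ++ \<gamma>))" using fin sub by (auto intro: finite_subset)
      \<comment> \<open>The cut between the two children: stability of the node makes it at least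
        \<open>\<tau>\<close>, and it can only grow when the children are enlarged to their
        classes.\<close>
      have "dom \<beta> \<noteq> {} \<and> dom \<beta> \<subset> dom (\<beta> ++ \<gamma>)" using ne union.hyps(3) unfolding dom_map_add by blast
      then have "\<tau> \<le> cut_weight (\<beta> ++ \<gamma>) (dom \<beta>)"
        by (rule union.hyps(5)[unfolded stable_def, rule_format])
      also have "\<dots> = cross_weight (\<beta> ++ \<gamma>) (dom \<beta>) (dom (\<beta> ++ \<gamma>) - dom \<beta>)"
        using fin' by (intro cut_weight_eq) auto
      also have "dom (\<beta> ++ \<gamma>) - dom \<beta> = dom \<gamma>" using union.hyps(3) by auto
      also have "cross_weight (\<beta> ++ \<gamma>) (dom \<beta>) (dom \<gamma>) = cross_weight \<alpha> (dom \<beta>) (dom \<gamma>)"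
        unfolding cross_weight_def
        by (intro sum.cong[OF refl] edge_weight_map_le[OF union.prems]) auto
      also have "\<dots> \<le> cross_weight \<alpha> {p \<in> dom \<alpha>. f p = x} {p \<in> dom \<alpha>. f p = y}"
        using fin sub x y by (intro cross_weight_mono) auto
      finally show False using False \<open>x \<noteq> y\<close> by blast
    qed
    with x y have "\<forall>p\<in>dom (\<beta> ++ \<gamma>). f p = y" unfolding dom_map_add by blast
    then show ?thesis by blast
  qed blast
qed auto

section \<open>A structured language for the machine\<close>

datatype com =
    Cst nat int
  | Mov nat nat
  | Ad nat nat nat
  | Sb nat nat nat
  | Rd nat nat nat nat
  | Wr nat nat nat nat
  | Skip
  | Seq com com (infixr ";;" 60)
  | IfP nat com com
  | IfZ nat com com
  | WhileP nat com

type_synonym arrays = "nat \<Rightarrow> int \<Rightarrow> int \<Rightarrow> int"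
type_synonym state = "int \<times> (nat \<Rightarrow> int) \<times> arrays"

text \<open>Each row has sixteen slices of length \<open>C\<close>. The last one belongs to no
  array, because in row 0 it holds the table of row offsets.\<close>

definition in_bounds :: "int \<Rightarrow> int \<Rightarrow> nat \<Rightarrow> int \<Rightarrow> int \<Rightarrow> bool" where
  "in_bounds C R k i j \<longleftrightarrow> k < 15 \<and> 0 \<le> i \<and> i \<le> R \<and> 0 \<le> j \<and> j < C"

text \<open>The ticks are those of the compiled code. It places the else branch first, followed by a
  jump over the other branch, hence the additional tick of \<open>IfP0\<close> and
  \<open>IfZ0\<close>.\<close>

inductive big :: "int \<Rightarrow> int \<Rightarrow> com \<Rightarrow> state \<Rightarrow> state \<Rightarrow> bool" for C R where
  Cst: "big C R (Cst x c) (t, v, a) (t + 1, v(x := c), a)"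
| Mov: "big C R (Mov x y) (t, v, a) (t + 1, v(x := v y), a)"
| Ad: "big C R (Ad x y z) (t, v, a) (t + 1, v(x := v y + v z), a)"
| Sb: "big C R (Sb x y z) (t, v, a) (t + 1, v(x := v y - v z), a)"
| Rd: "in_bounds C R k (v i) (v j) \<Longrightarrow>
       big C R (Rd x k i j) (t, v, a) (t + 5, v(x := a k (v i) (v j)), a)"
| Wr: "in_bounds C R k (v i) (v j) \<Longrightarrow>
       big C R (Wr k i j x) (t, v, a) (t + 5, v, a(k := (a k)(v i := (a k (v i))(v j := v x))))"
| Skip: "big C R Skip s s"
| Seq: "big C R c s s' \<Longrightarrow> big C R d s' s'' \<Longrightarrow> big C R (c ;; d) s s''"
| IfP1: "v x > 0 \<Longrightarrow> big C R c (t + 1, v, a) s \<Longrightarrow> big C R (IfP x c d) (t, v, a) s"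
| IfP0: "\<not> v x > 0 \<Longrightarrow> big C R d (t + 1, v, a) (t', v', a') \<Longrightarrow>
         big C R (IfP x c d) (t, v, a) (t' + 1, v', a')"
| IfZ1: "v x = 0 \<Longrightarrow> big C R c (t + 1, v, a) s \<Longrightarrow> big C R (IfZ x c d) (t, v, a) s"
| IfZ0: "v x \<noteq> 0 \<Longrightarrow> big C R d (t + 1, v, a) (t', v', a') \<Longrightarrow>
         big C R (IfZ x c d) (t, v, a) (t' + 1, v', a')"
| While1: "v x > 0 \<Longrightarrow> big C R c (t + 1, v, a) (t', v', a') \<Longrightarrow>
           big C R (WhileP x c) (t' + 1, v', a') s \<Longrightarrow> big C R (WhileP x c) (t, v, a) s"
| While0: "\<not> v x > 0 \<Longrightarrow> big C R (WhileP x c) (t, v, a) (t + 2, v, a)"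

lemma big_clock_mono: "big C R c s s' \<Longrightarrow> fst s \<le> fst s'"
  by (induction rule: big.induct) auto

text \<open>Total correctness: a terminating run is asserted, so a clock bound in \<open>Q\<close>
  bounds the running time.\<close>

definition wp :: "int \<Rightarrow> int \<Rightarrow> com \<Rightarrow> (state \<Rightarrow> bool) \<Rightarrow> state \<Rightarrow> bool" where
  "wp C R c Q s \<longleftrightarrow> (\<exists>s'. big C R c s s' \<and> Q s')"

inductive_cases big_elims:
  "big C R (Cst x c) s s'" "big C R (Mov x y) s s'" "big C R (Ad x y z) s s'"
  "big C R (Sb x y z) s s'" "big C R (Rd x k i j) s s'" "big C R (Wr k i j x) s s'"
  "big C R Skip s s'" "big C R (c ;; d) s s'" "big C R (IfP x c d) s s'" "big C R (IfZ x c d) s s'"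

text \<open>With these rules the simplifier executes loop-free code symbolically.\<close>

lemma wp_simps [simp]:
  "wp C R (Cst x n) Q (t, v, a) = Q (t + 1, v(x := n), a)"
  "wp C R (Mov x y) Q (t, v, a) = Q (t + 1, v(x := v y), a)"
  "wp C R (Ad x y z) Q (t, v, a) = Q (t + 1, v(x := v y + v z), a)"
  "wp C R (Sb x y z) Q (t, v, a) = Q (t + 1, v(x := v y - v z), a)"
  "wp C R (Rd x k i j) Q (t, v, a) =
     (in_bounds C R k (v i) (v j) \<and> Q (t + 5, v(x := a k (v i) (v j)), a))"
  "wp C R (Wr k i j x) Q (t, v, a) =
     (in_bounds C R k (v i) (v j) \<and>
      Q (t + 5, v, a(k := (a k)(v i := (a k (v i))(v j := v x)))))"
  "wp C R Skip Q s = Q s"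
  "wp C R (c ;; d) Q s = wp C R c (wp C R d Q) s"
  "wp C R (IfP x c d) Q (t, v, a) =
     (if v x > 0 then wp C R c Q (t + 1, v, a) else wp C R d (\<lambda>(t, v, a). Q (t + 1, v, a)) (t + 1, v, a))"
  "wp C R (IfZ x c d) Q (t, v, a) =
     (if v x = 0 then wp C R c Q (t + 1, v, a) else wp C R d (\<lambda>(t, v, a). Q (t + 1, v, a)) (t + 1, v, a))"
  unfolding wp_def
            apply (blast intro: big.intros elim: big_elims)
           apply (blast intro: big.intros elim: big_elims)
          apply (blast intro: big.intros elim: big_elims)
         apply (blast intro: big.intros elim: big_elims)
        apply (fastforce intro: big.intros elim: big_elims)
       apply (fastforce intro: big.intros elim: big_elims)
      apply (blast intro: big.intros elim: big_elims)
     apply (blast intro: big.intros elim: big_elims)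
    apply (cases "v x > 0"; simp split: prod.splits; blast intro: big.IfP1 big.IfP0 elim: big_elims)
  apply (cases "v x = 0"; simp split: prod.splits; blast intro: big.IfZ1 big.IfZ0 elim: big_elims)
  done

text \<open>The test ticks the clock, so an invariant that bounds the clock already gives termination.\<close>

lemma wp_While:
  assumes init: "I s"
    and bound: "\<And>t v a. I (t, v, a) \<Longrightarrow> t \<le> bd"
    and body: "\<And>t v a. I (t, v, a) \<Longrightarrow> v x > 0 \<Longrightarrow> wp C R c (\<lambda>(t, v, a). I (t + 1, v, a)) (t + 1, v, a)"
    and exit: "\<And>t v a. I (t, v, a) \<Longrightarrow> v x \<le> 0 \<Longrightarrow> Q (t + 2, v, a)"
  shows "wp C R (WhileP x c) Q s"
  using init
proof (induction "nat (bd - fst s)" arbitrary: s rule: less_induct)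
  case less
  obtain t v a where s: "s = (t, v, a)" by (metis prod_cases3)
  show ?case
  proof (cases "v x > 0")
    case True
    from body[OF less.prems[unfolded s] True]
    obtain t' v' a' where b: "big C R c (t + 1, v, a) (t', v', a')" and i: "I (t' + 1, v', a')"
      unfolding wp_def by auto
    have "t + 1 \<le> t'" using big_clock_mono[OF b] by simp
    with bound[OF i] have "nat (bd - fst (t' + 1, v', a')) < nat (bd - fst s)"
      by (simp add: s)
    from less.hyps[OF this i] show ?thesis
      unfolding wp_def s using big.While1[OF True b] by blast
  next
    case False
    then show ?thesis unfolding wp_def s
      using big.While0 exit less.prems s by (metis not_less)
  qed
qed

text \<open>Jump targets depend on the length of code yet to be generated, so the length must be
  available without compiling.\<close>

fun len :: "com \<Rightarrow> nat" where
  "len (Rd x k i j) = 5"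
| "len (Wr k i j x) = 5"
| "len Skip = 0"
| "len (c ;; d) = len c + len d"
| "len (IfP x c d) = len c + len d + 2"
| "len (IfZ x c d) = len c + len d + 2"
| "len (WhileP x c) = len c + 3"
| "len _ = 1"

text \<open>
  Variable \<open>x\<close> lives in register \<open>32 + x\<close>, register \<open>16 + k\<close> holds \<open>C * k\<close>, and register \<open>1\<close> is
  scratch. Cell \<open>(i, j)\<close> of array \<open>k\<close> has address \<open>16 * C * i + C * k + j\<close>. The machine cannot
  multiply, so the row offsets \<open>16 * C * i\<close> are tabulated from address \<open>C * 15\<close> on.
\<close>

definition access :: "nat \<Rightarrow> nat \<Rightarrow> nat \<Rightarrow> instr list" where
  "access k i j = [Add 1 31 (32 + i), Load 1 1, Add 1 1 (16 + k), Add 1 1 (32 + j)]"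

fun compile :: "nat \<Rightarrow> com \<Rightarrow> instr list" where
  "compile p (Cst x c) = [Const (32 + x) c]"
| "compile p (Mov x y) = [Move (32 + x) (32 + y)]"
| "compile p (Ad x y z) = [Add (32 + x) (32 + y) (32 + z)]"
| "compile p (Sb x y z) = [Sub (32 + x) (32 + y) (32 + z)]"
| "compile p (Rd x k i j) = access k i j @ [Load (32 + x) 1]"
| "compile p (Wr k i j x) = access k i j @ [Store 1 (32 + x)]"
| "compile p Skip = []"
| "compile p (c ;; d) = compile p c @ compile (p + len c) d"
| "compile p (IfP x c d) = JumpPos (32 + x) (p + 2 + len d) # compile (p + 1) d @
     Jump (p + 2 + len d + len c) # compile (p + 2 + len d) c"
| "compile p (IfZ x c d) = JumpZero (32 + x) (p + 2 + len d) # compile (p + 1) d @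
     Jump (p + 2 + len d + len c) # compile (p + 2 + len d) c"
| "compile p (WhileP x c) = JumpPos (32 + x) (p + 2) # Jump (p + 3 + len c) #
     compile (p + 2) c @ [Jump p]"

lemma length_compile [simp]: "length (compile p c) = len c"
  by (induction c arbitrary: p) (auto simp: access_def)

section \<open>Execution of code segments inside a program\<close>

definition code_at :: "program \<Rightarrow> nat \<Rightarrow> instr list \<Rightarrow> bool" where
  "code_at P p is \<longleftrightarrow> p + length is \<le> length P \<and> (\<forall>i < length is. P ! (p + i) = is ! i)"

lemma code_at_append [simp]:
  "code_at P p (is @ js) \<longleftrightarrow> code_at P p is \<and> code_at P (p + length is) js"
proof -
  have "(\<forall>i < length is + length js. Q i) \<longleftrightarrow>
      (\<forall>i < length is. Q i) \<and> (\<forall>i < length js. Q (length is + i))" for Q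
  proof (intro iffI conjI allI impI; (elim conjE)?)
    fix i assume "\<forall>i < length is. Q i" and b: "\<forall>i < length js. Q (length is + i)"
      and "i < length is + length js"
    then show "Q i"
      using b[rule_format, of "i - length is"] by (cases "i < length is") auto
  qed simp_all
  then show ?thesis
    unfolding code_at_def by (auto simp: nth_append add.assoc)
qed

lemma code_at_Cons: "code_at P p (i # is) \<longleftrightarrow> p < length P \<and> P ! p = i \<and> code_at P (Suc p) is"
  unfolding code_at_def by (auto simp: All_less_Suc2)

definition runs :: "program \<Rightarrow> nat \<Rightarrow> config \<Rightarrow> config \<Rightarrow> bool" where
  "runs P k c c' \<longleftrightarrow> (step P ^^ k) c = c'"

lemma runs_refl: "runs P 0 c c"
  by (simp add: runs_def)

lemma runs_trans: "runs P k c c' \<Longrightarrow> runs P l c' c'' \<Longrightarrow> runs P (k + l) c c''"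
  using funpow_add[of l k "step P"] by (auto simp: runs_def add.commute)

lemma runs_step:
  assumes "p < length P" and "runs P k (exec (P ! p) (p, s)) c"
  shows "runs P (Suc k) (p, s) c"
  using assms by (simp add: runs_def step_def halted_def funpow_swap1)

definition straight :: "instr \<Rightarrow> bool" where
  "straight i \<longleftrightarrow> (case i of Jump _ \<Rightarrow> False | JumpZero _ _ \<Rightarrow> False | JumpPos _ _ \<Rightarrow> False | _ \<Rightarrow> True)"

lemma straight_simps [simp]:
  "straight (Const x c)" "straight (Move x y)" "straight (Add x y z)" "straight (Sub x y z)"
  "straight (Load x y)" "straight (Store x y)"
  by (simp_all add: straight_def)

lemma runs_straight:
  assumes "code_at P p is" and "list_all straight is"
  shows "runs P (length is) (p, s) (fold exec is (p, s))"
  using assms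
proof (induction "is" arbitrary: p s)
  case Nil
  then show ?case by (simp add: runs_refl)
next
  case (Cons i "is")
  obtain r m where s: "s = (r, m)" by fastforce
  have "\<exists>s'. exec i (p, s) = (Suc p, s')"
    using Cons.prems(2) by (cases i) (auto simp: s straight_def)
  then obtain s' where "exec i (p, s) = (Suc p, s')" by blast
  moreover obtain r' m' where "s' = (r', m')" by fastforce
  ultimately show ?case
    using Cons by (auto simp: code_at_Cons intro!: runs_step)
qed

text \<open>The address is \<open>(16 * i + k) * C + j\<close>, a number in mixed radix, so division
  by \<open>C\<close> and then by 16 recovers the coordinates.\<close>

lemma cell_inj:
  fixes i j k i' j' k' C :: int
  assumes "0 \<le> j" "j < C" "0 \<le> j'" "j' < C" "0 \<le> k" "k < 16" "0 \<le> k'" "k' < 16"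
    and eq: "16 * C * i + C * k + j = 16 * C * i' + C * k' + j'"
  shows "i = i' \<and> k = k' \<and> j = j'"
proof -
  have e: "(16 * i + k) * C + j = (16 * i' + k') * C + j'"
    using eq by (simp add: algebra_simps)
  have "((16 * i + k) * C + j) div C = 16 * i + k" "((16 * i' + k') * C + j') div C = 16 * i' + k'"
    using assms by simp_all
  with e have "16 * i + k = 16 * i' + k'" by metis
  moreover from this have "i = i'" using assms(5-8) by linarith
  ultimately show ?thesis using e by simp
qed

text \<open>The arrays are total functions, but only cells in bounds are tied to memory. Registers
  below 16 are left free for scratch use.\<close>

definition represents :: "int \<Rightarrow> int \<Rightarrow> (nat \<Rightarrow> int) \<Rightarrow> arrays \<Rightarrow> (nat \<Rightarrow> int) \<Rightarrow> (nat \<Rightarrow> int) \<Rightarrow> bool" where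
  "represents C R v a r m \<longleftrightarrow>
     (\<forall>x. r (32 + x) = v x) \<and> (\<forall>k < 16. r (16 + k) = C * int k) \<and>
     (\<forall>i. 0 \<le> i \<and> i \<le> R \<longrightarrow> m (nat (C * 15 + i)) = 16 * C * i) \<and>
     (\<forall>k i j. in_bounds C R k i j \<longrightarrow> m (nat (16 * C * i + C * int k + j)) = a k i j)"

lemma runs_straight_represents:
  assumes "code_at P p is" and "list_all straight is"
    and "fold exec is (p, r, m) = (p + length is, r', m')" and "represents C R v a r' m'"
  shows "\<exists>k r' m'. runs P k (p, r, m) (p + length is, r', m') \<and> represents C R v a r' m' \<and>
           t + int (length is) = t + int k"
  using runs_straight[OF assms(1,2), of "(r, m)"] assms(3,4) by auto

lemma represents_upd:
  assumes "represents C R v a r m"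
  shows "represents C R (v(x := y)) a (r(32 + x := y)) m"
  using assms unfolding represents_def by auto

lemma represents_scratch:
  assumes "represents C R v a r m"
  shows "represents C R v a (r(Suc 0 := y)) m"
  using assms unfolding represents_def by auto

lemma represents_store:
  assumes rep: "represents C R v a r m" and b: "in_bounds C R k i j" and RC: "0 \<le> R" "R < C"
  shows "represents C R v (a(k := (a k)(i := (a k i)(j := y)))) r
           (m(nat (16 * C * i + C * int k + j) := y))"
proof -
  have pos: "0 \<le> 16 * C * i + C * int k + j" if "in_bounds C R k i j" for k i j
    using that RC unfolding in_bounds_def by simp
  \<comment> \<open>A table entry has the address of a cell in row 0 of a fictitious array 15;
    \<open>R < C\<close> keeps it within that slice, so \<open>cell_inj\<close> applies.\<close>
  have table: "nat (C * 15 + i') \<noteq> nat (16 * C * i + C * int k + j)" if "0 \<le> i'" "i' \<le> R" for i'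
  proof
    assume "nat (C * 15 + i') = nat (16 * C * i + C * int k + j)"
    then have "16 * C * 0 + C * 15 + i' = 16 * C * i + C * int k + j"
      using pos[OF b] that RC by (simp add: nat_eq_iff2)
    then have "(15::int) = int k"
      using cell_inj[of i' C j 15 "int k" 0 i] b that RC unfolding in_bounds_def by auto
    then show False using b unfolding in_bounds_def by simp
  qed
  have cell: "k' = k \<and> i' = i \<and> j' = j"
    if "in_bounds C R k' i' j'" "nat (16 * C * i' + C * int k' + j') = nat (16 * C * i + C * int k + j)"
    for k' i' j'
  proof -
    have "16 * C * i' + C * int k' + j' = 16 * C * i + C * int k + j"
      using pos[OF b] pos[OF that(1)] that(2) by linarith
    then show ?thesis
      using cell_inj[of j' C j "int k'" "int k" i' i] b that(1) unfolding in_bounds_def by auto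
  qed
  from rep cell table show ?thesis
    unfolding represents_def by (auto simp: fun_upd_def)
qed

text \<open>Induction over the derivation of \<open>big\<close> already contains termination of the
  loops. The address \<open>p\<close> is universally quantified because jump targets are
  absolute.\<close>

lemma compile_correct:
  assumes "big C R c s s'" and "0 \<le> R" "R < C"
  shows "\<And>P p r m. code_at P p (compile p c) \<Longrightarrow> represents C R (fst (snd s)) (snd (snd s)) r m \<Longrightarrow>
    \<exists>k r' m'. runs P k (p, r, m) (p + len c, r', m') \<and>
      represents C R (fst (snd s')) (snd (snd s')) r' m' \<and> fst s' = fst s + int k"
  using assms(1)
proof (induction rule: big.induct)
  case (Cst x c t v a)
  have rep: "represents C R v a r m" using Cst by simp
  then have "fold exec (compile p (Cst x c)) (p, r, m) =
    (p + length (compile p (Cst x c)), r(32 + x := c), m)"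
    by (simp add: represents_def)
  from runs_straight_represents[OF Cst(1) _ this represents_upd[OF rep], of t]
  show ?case by (simp add: fun_upd_def)
next
  case (Mov x y t v a)
  have rep: "represents C R v a r m" using Mov by simp
  then have "fold exec (compile p (Mov x y)) (p, r, m) =
    (p + length (compile p (Mov x y)), r(32 + x := v y), m)"
    by (simp add: represents_def)
  from runs_straight_represents[OF Mov(1) _ this represents_upd[OF rep], of t]
  show ?case by (simp add: fun_upd_def)
next
  case (Ad x y z t v a)
  have rep: "represents C R v a r m" using Ad by simp
  then have "fold exec (compile p (Ad x y z)) (p, r, m) =
    (p + length (compile p (Ad x y z)), r(32 + x := v y + v z), m)"
    by (simp add: represents_def)
  from runs_straight_represents[OF Ad(1) _ this represents_upd[OF rep], of t]
  show ?case by (simp add: fun_upd_def)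
next
  case (Sb x y z t v a)
  have rep: "represents C R v a r m" using Sb by simp
  then have "fold exec (compile p (Sb x y z)) (p, r, m) =
    (p + length (compile p (Sb x y z)), r(32 + x := v y - v z), m)"
    by (simp add: represents_def)
  from runs_straight_represents[OF Sb(1) _ this represents_upd[OF rep], of t]
  show ?case by (simp add: fun_upd_def)
next
  case (Rd k v i j x t a)
  have rep: "represents C R v a r m" using Rd by simp
  then have "\<forall>k < 16. r (16 + k) = C * int k" by (simp add: represents_def)
  \<comment> \<open>Register 31 is \<open>16 + 15\<close>: it doubles as the base address of the
    table.\<close>
  from this[rule_format, of 15] have r31: "r 31 = C * 15" by simp
  have e: "fold exec (compile p (Rd x k i j)) (p, r, m) =
    (p + length (compile p (Rd x k i j)),
     r(Suc 0 := 16 * C * v i + C * int k + v j, 32 + x := a k (v i) (v j)), m)"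
    using rep Rd(1) r31 unfolding represents_def in_bounds_def
    by (auto simp: access_def)
  have s: "list_all straight (compile p (Rd x k i j))" by (simp add: access_def)
  from runs_straight_represents[OF Rd(2) s e represents_upd[OF represents_scratch[OF rep]], of t]
  show ?case by (simp add: access_def fun_upd_def eval_nat_numeral)
next
  case (Wr k v i j x t a)
  have rep: "represents C R v a r m" using Wr by simp
  then have "\<forall>k < 16. r (16 + k) = C * int k" by (simp add: represents_def)
  from this[rule_format, of 15] have r31: "r 31 = C * 15" by simp
  have e: "fold exec (compile p (Wr k i j x)) (p, r, m) =
    (p + length (compile p (Wr k i j x)),
     r(Suc 0 := 16 * C * v i + C * int k + v j), m(nat (16 * C * v i + C * int k + v j) := v x))"
    using rep Wr(1) r31 unfolding represents_def in_bounds_def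
    by (auto simp: access_def)
  have s: "list_all straight (compile p (Wr k i j x))" by (simp add: access_def)
  from runs_straight_represents[OF Wr(2) s e
    represents_store[OF represents_scratch[OF rep] Wr(1) assms(2,3)], of t]
  show ?case by (simp add: access_def fun_upd_def eval_nat_numeral)
next
  case (Skip s)
  then show ?case using runs_refl by fastforce
next
  case (Seq c s s' d s'')
  from Seq.prems have "code_at P p (compile p c)" "code_at P (p + len c) (compile (p + len c) d)"
    by auto
  with Seq.IH Seq.prems(2) obtain k r' m' l r'' m'' where
    "runs P k (p, r, m) (p + len c, r', m')"
    "runs P l (p + len c, r', m') (p + len c + len d, r'', m'')"
    "represents C R (fst (snd s'')) (snd (snd s'')) r'' m''"
    "fst s' = fst s + int k" "fst s'' = fst s' + int l"
    by meson
  with runs_trans show ?case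
    by (metis (no_types, opaque_lifting) add.assoc len.simps(4) of_nat_add)
next
  case (IfP1 v x c t a s d)
  have "code_at P (p + 2 + len d) (compile (p + 2 + len d) c)" and at: "p < length P"
    and i: "P ! p = JumpPos (32 + x) (p + 2 + len d)"
    using IfP1.prems by (auto simp: code_at_Cons add.commute add.left_commute)
  with IfP1.IH[of P "p + 2 + len d" r m] IfP1.prems obtain k r' m' where
    k: "runs P k (p + 2 + len d, r, m) (p + 2 + len d + len c, r', m')"
    "represents C R (fst (snd s)) (snd (snd s)) r' m'" "fst s = t + 1 + int k"
    by auto
  have "r (32 + x) > 0" using IfP1 by (simp add: represents_def)
  then have "runs P (Suc k) (p, r, m) (p + 2 + len d + len c, r', m')"
    using k(1) i by (intro runs_step[OF at]) simp
  then show ?case using k(2,3)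
    by (intro exI[of _ "Suc k"] exI) (auto simp: add_ac)
next
  case (IfP0 v x d t a t' v' a' c)
  have "code_at P (p + 1) (compile (p + 1) d)" and at: "p < length P" "p + 1 + len d < length P"
    and i: "P ! p = JumpPos (32 + x) (p + 2 + len d)" "P ! (p + 1 + len d) = Jump (p + 2 + len d + len c)"
    using IfP0.prems by (auto simp: code_at_Cons add.commute add.left_commute)
  with IfP0.IH[of P "p + 1" r m] IfP0.prems obtain k r' m' where
    k: "runs P k (p + 1, r, m) (p + 1 + len d, r', m')"
    "represents C R v' a' r' m'" "t' = t + 1 + int k"
    by auto
  have "\<not> r (32 + x) > 0" using IfP0 by (simp add: represents_def)
  then have "runs P (Suc k) (p, r, m) (p + 1 + len d, r', m')"
    using k(1) i by (intro runs_step[OF at(1)]) simp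
  moreover have "runs P 1 (p + 1 + len d, r', m') (p + 2 + len d + len c, r', m')"
    using runs_step[OF at(2) runs_refl, of "(r', m')"] i(2) by simp
  ultimately have "runs P (Suc k + 1) (p, r, m) (p + 2 + len d + len c, r', m')"
    by (rule runs_trans)
  then show ?case using k(2,3)
    by (intro exI[of _ "Suc k + 1"] exI) (auto simp: add_ac)
next
  case (IfZ1 v x c t a s d)
  have "code_at P (p + 2 + len d) (compile (p + 2 + len d) c)" and at: "p < length P"
    and i: "P ! p = JumpZero (32 + x) (p + 2 + len d)"
    using IfZ1.prems by (auto simp: code_at_Cons add.commute add.left_commute)
  with IfZ1.IH[of P "p + 2 + len d" r m] IfZ1.prems obtain k r' m' where
    k: "runs P k (p + 2 + len d, r, m) (p + 2 + len d + len c, r', m')"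
    "represents C R (fst (snd s)) (snd (snd s)) r' m'" "fst s = t + 1 + int k"
    by auto
  have "r (32 + x) = 0" using IfZ1 by (simp add: represents_def)
  then have "runs P (Suc k) (p, r, m) (p + 2 + len d + len c, r', m')"
    using k(1) i by (intro runs_step[OF at]) simp
  then show ?case using k(2,3)
    by (intro exI[of _ "Suc k"] exI) (auto simp: add_ac)
next
  case (IfZ0 v x d t a t' v' a' c)
  have "code_at P (p + 1) (compile (p + 1) d)" and at: "p < length P" "p + 1 + len d < length P"
    and i: "P ! p = JumpZero (32 + x) (p + 2 + len d)" "P ! (p + 1 + len d) = Jump (p + 2 + len d + len c)"
    using IfZ0.prems by (auto simp: code_at_Cons add.commute add.left_commute)
  with IfZ0.IH[of P "p + 1" r m] IfZ0.prems obtain k r' m' where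
    k: "runs P k (p + 1, r, m) (p + 1 + len d, r', m')"
    "represents C R v' a' r' m'" "t' = t + 1 + int k"
    by auto
  have "r (32 + x) \<noteq> 0" using IfZ0 by (simp add: represents_def)
  then have "runs P (Suc k) (p, r, m) (p + 1 + len d, r', m')"
    using k(1) i by (intro runs_step[OF at(1)]) simp
  moreover have "runs P 1 (p + 1 + len d, r', m') (p + 2 + len d + len c, r', m')"
    using runs_step[OF at(2) runs_refl, of "(r', m')"] i(2) by simp
  ultimately have "runs P (Suc k + 1) (p, r, m) (p + 2 + len d + len c, r', m')"
    by (rule runs_trans)
  then show ?case using k(2,3)
    by (intro exI[of _ "Suc k + 1"] exI) (auto simp: add_ac)
next
  case (While1 v x c t a t' v' a' s)
  have "code_at P (p + 2) (compile (p + 2) c)" and at: "p < length P" "p + 2 + len c < length P"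
    and i: "P ! p = JumpPos (32 + x) (p + 2)" "P ! (p + 2 + len c) = Jump p"
    using While1.prems by (auto simp: code_at_Cons add.commute add.left_commute)
  with While1.IH(1)[of P "p + 2" r m] While1.prems obtain k r' m' where
    k: "runs P k (p + 2, r, m) (p + 2 + len c, r', m')"
    "represents C R v' a' r' m'" "t' = t + 1 + int k"
    by auto
  from While1.IH(2)[OF While1.prems(1), of r' m'] k(2) obtain l r'' m'' where
    l: "runs P l (p, r', m') (p + len (WhileP x c), r'', m'')"
    "represents C R (fst (snd s)) (snd (snd s)) r'' m''" "fst s = t' + 1 + int l"
    by auto
  have "r (32 + x) > 0" using While1 by (simp add: represents_def)
  then have "runs P (Suc k) (p, r, m) (p + 2 + len c, r', m')"
    using k(1) i by (intro runs_step[OF at(1)]) simp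
  moreover have "runs P (Suc l) (p + 2 + len c, r', m') (p + len (WhileP x c), r'', m'')"
    using runs_step[OF at(2), of l "(r', m')"] l(1) i(2) by simp
  ultimately have "runs P (Suc k + Suc l) (p, r, m) (p + len (WhileP x c), r'', m'')"
    by (rule runs_trans)
  then show ?case using k(3) l(2,3)
    by (intro exI[of _ "Suc k + Suc l"] exI) auto
next
  case (While0 v x c t a)
  have at: "p < length P" "p + 1 < length P"
    and i: "P ! p = JumpPos (32 + x) (p + 2)" "P ! (p + 1) = Jump (p + 3 + len c)"
    using While0.prems by (auto simp: code_at_Cons)
  have "runs P 1 (p + 1, r, m) (p + 3 + len c, r, m)"
    using runs_step[OF at(2) runs_refl, of "(r, m)"] i(2) by simp
  moreover have "\<not> r (32 + x) > 0" using While0 by (simp add: represents_def)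
  ultimately have "runs P 2 (p, r, m) (p + 3 + len c, r, m)"
    using runs_step[OF at(1), of 1 "(r, m)"] i(1) by (simp add: numeral_2_eq_2)
  then show ?case using While0.prems
    by (intro exI[of _ 2] exI) (auto simp: add_ac)
qed

section \<open>Initialisation of the memory layout\<close>

text \<open>
  With \<open>n\<close> in memory cell \<open>0\<close>, this sets \<open>C = 12 * n * n + 12\<close>, the multiples of \<open>C\<close> in the
  registers \<open>16, \<dots>, 31\<close>, and the table of the rows \<open>0, \<dots>, 2 * n\<close>.
\<close>

definition prologue :: program where
  "prologue =
    [Load 3 2, Add 4 3 3, Add 5 4 4, Add 6 5 5, Add 5 5 6, Const 7 1, Const 17 12, Move 8 3] @
    [Add 17 17 5, Sub 8 8 7, JumpPos 8 8] @
    [Add 18 17 17, Add 19 18 17, Add 20 19 17, Add 21 20 17, Add 22 21 17, Add 23 22 17,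
     Add 24 23 17, Add 25 24 17, Add 26 25 17, Add 27 26 17, Add 28 27 17, Add 29 28 17,
     Add 30 29 17, Add 31 30 17, Add 9 31 17, Move 10 31, Add 8 4 7] @
    [Store 10 11, Add 11 11 9, Add 10 10 7, Sub 8 8 7, JumpPos 8 28]"

lemma length_prologue [simp]: "length prologue = 33"
  by (simp add: prologue_def)

text \<open>Multiplication by repeated addition. The test follows the body, hence the count
  \<open>Suc k\<close>.\<close>

lemma runs_accumulate_loop:
  assumes "code_at P p [Add 17 17 5, Sub 8 8 7, JumpPos 8 p]"
    and "r 8 = int (Suc k)" "r 7 = 1"
  shows "runs P (3 * Suc k) (p, r, m) (p + 3, r(17 := r 17 + int (Suc k) * r 5, 8 := 0), m)"
  using assms(2,3)
proof (induction k arbitrary: r)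
  case 0
  have "runs P 3 (p, r, m) (p + 3, r(17 := r 17 + r 5, 8 := 0), m)"
    using assms(1) 0
    by (auto simp: code_at_Cons numeral_3_eq_3 fun_upd_twist
        intro!: runs_step runs_refl)
  then show ?case by (simp add: fun_upd_def)
next
  case (Suc k)
  let ?r = "r(17 := r 17 + r 5, 8 := int (Suc k))"
  have "runs P 3 (p, r, m) (p, ?r, m)"
    using assms(1) Suc.prems
    by (auto simp: code_at_Cons numeral_3_eq_3 intro!: runs_step)
      (auto simp: runs_def fun_upd_twist)
  moreover have "runs P (3 * Suc k) (p, ?r, m) (p + 3, ?r(17 := ?r 17 + int (Suc k) * ?r 5, 8 := 0), m)"
    using Suc.prems by (intro Suc.IH) auto
  ultimately have "runs P (3 + 3 * Suc k) (p, r, m)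
      (p + 3, ?r(17 := ?r 17 + int (Suc k) * ?r 5, 8 := 0), m)"
    by (rule runs_trans)
  moreover have "?r(17 := ?r 17 + int (Suc k) * ?r 5, 8 := 0) =
      r(17 := r 17 + int (Suc (Suc k)) * r 5, 8 := 0)"
    by (auto simp: fun_eq_iff algebra_simps)
  ultimately show ?case by (simp add: fun_upd_def)
qed

lemma runs_table_loop:
  assumes "code_at P p [Store 10 11, Add 11 11 9, Add 10 10 7, Sub 8 8 7, JumpPos 8 p]"
    and "r 8 = int (Suc k)" "r 7 = 1" "r 10 \<ge> 0"
  shows "runs P (5 * Suc k) (p, r, m)
     (p + 5, r(11 := r 11 + int (Suc k) * r 9, 10 := r 10 + int (Suc k), 8 := 0),
      \<lambda>x. if r 10 \<le> int x \<and> int x < r 10 + int (Suc k) then r 11 + (int x - r 10) * r 9 else m x)"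
  using assms(2-)
proof (induction k arbitrary: r m)
  case 0
  have "runs P 5 (p, r, m) (p + 5, r(11 := r 11 + r 9, 10 := r 10 + 1, 8 := 0), m(nat (r 10) := r 11))"
    using assms(1) 0
    by (auto simp: code_at_Cons eval_nat_numeral fun_upd_twist intro!: runs_step runs_refl)
  moreover have "m(nat (r 10) := r 11) =
      (\<lambda>x. if r 10 \<le> int x \<and> int x < r 10 + 1 then r 11 + (int x - r 10) * r 9 else m x)"
    using 0(3) by (auto simp: fun_eq_iff)
  ultimately show ?case by (simp add: fun_upd_def)
next
  case (Suc k)
  let ?r = "r(11 := r 11 + r 9, 10 := r 10 + 1, 8 := int (Suc k))"
  let ?m = "m(nat (r 10) := r 11)"
  let ?m' = "\<lambda>r (m :: nat \<Rightarrow> int) k x.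
    if r 10 \<le> int x \<and> int x < r 10 + int (Suc k) then r 11 + (int x - r 10) * r (9::nat) else m x"
  have "runs P 5 (p, r, m) (p, ?r, ?m)"
    using assms(1) Suc.prems
    by (auto simp: code_at_Cons eval_nat_numeral intro!: runs_step)
      (auto simp: runs_def fun_upd_twist eval_nat_numeral)
  moreover have "runs P (5 * Suc k) (p, ?r, ?m)
      (p + 5, ?r(11 := ?r 11 + int (Suc k) * ?r 9, 10 := ?r 10 + int (Suc k), 8 := 0), ?m' ?r ?m k)"
    using Suc.prems by (intro Suc.IH) auto
  ultimately have "runs P (5 + 5 * Suc k) (p, r, m)
      (p + 5, ?r(11 := ?r 11 + int (Suc k) * ?r 9, 10 := ?r 10 + int (Suc k), 8 := 0), ?m' ?r ?m k)"
    by (rule runs_trans)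
  moreover have "?r(11 := ?r 11 + int (Suc k) * ?r 9, 10 := ?r 10 + int (Suc k), 8 := 0) =
      r(11 := r 11 + int (Suc (Suc k)) * r 9, 10 := r 10 + int (Suc (Suc k)), 8 := 0)"
    by (auto simp: fun_eq_iff algebra_simps)
  moreover have "?m' ?r ?m k = ?m' r m (Suc k)"
    using Suc.prems(3) by (auto simp: fun_eq_iff algebra_simps)
  ultimately have "runs P (5 + 5 * Suc k) (p, r, m)
      (p + 5, r(11 := r 11 + int (Suc (Suc k)) * r 9, 10 := r 10 + int (Suc (Suc k)), 8 := 0),
       ?m' r m (Suc k))"
    by (simp only:)
  then show ?case by (simp add: fun_upd_def)
qed

lemma runs_straightI:
  assumes "code_at P p is" "list_all straight is" "length is = k" "fold exec is (p, s) = c"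
  shows "runs P k (p, s) c"
  using runs_straight[OF assms(1,2), of s] assms(3,4) by simp

text \<open>The input stays in place and becomes row 0 of array 0. Memory from \<open>C\<close> on
  is still zero, so every other array starts with zeros.\<close>

lemma runs_prologue:
  fixes n :: nat
  defines "C \<equiv> 12 * int n * int n + 12"
  assumes at: "code_at P 0 prologue" and n: "n > 0" and m0: "m 0 = int n"
    and m: "\<And>x. int x \<ge> C \<Longrightarrow> m x = 0"
  shows "\<exists>r m'. runs P (13 * n + 30) (0, \<lambda>_. 0, m) (33, r, m') \<and>
    represents C (2 * int n) (\<lambda>_. 0) (\<lambda>k i j. if k = 0 \<and> i = 0 then m (nat j) else 0) r m'"
proof -
  let ?r1 = "(\<lambda>_. 0)(3 := int n, 4 := 2 * int n, 6 := 8 * int n, 5 := 12 * int n, 7 := 1, 17 := 12, 8 := int n)"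
  let ?r2 = "?r1(17 := C, 8 := 0)"
  let ?r3 = "?r2(18 := C*2, 19 := C*3, 20 := C*4, 21 := C*5, 22 := C*6, 23 := C*7, 24 := C*8, 25 := C*9,
    26 := C*10, 27 := C*11, 28 := C*12, 29 := C*13, 30 := C*14, 31 := C*15,
    9 := C*16, 10 := C*15, 8 := 2 * int n + 1)"
  define r3 :: "nat \<Rightarrow> int" where "r3 = ?r3"
  have r3: "r3 8 = int (Suc (2 * n))" "r3 7 = 1" "r3 9 = C*16" "r3 10 = C*15" "r3 11 = 0"
    by (simp_all add: r3_def)
  let ?m4 = "\<lambda>x. if C*15 \<le> int x \<and> int x < C*15 + int (Suc (2 * n)) then (int x - C*15) * (C*16) else m x"
  let ?r4 = "r3(11 := int (Suc (2 * n)) * (C*16), 10 := C*15 + int (Suc (2 * n)), 8 := 0)"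
  have C0: "0 \<le> C" by (simp add: C_def)
  let ?init = "[Load 3 2, Add 4 3 3, Add 5 4 4, Add 6 5 5, Add 5 5 6, Const 7 1, Const 17 12, Move 8 3]"
  let ?accumulate = "[Add 17 17 5, Sub 8 8 7, JumpPos 8 8]"
  let ?multiples = "[Add 18 17 17, Add 19 18 17, Add 20 19 17, Add 21 20 17, Add 22 21 17, Add 23 22 17,
     Add 24 23 17, Add 25 24 17, Add 26 25 17, Add 27 26 17, Add 28 27 17, Add 29 28 17,
     Add 30 29 17, Add 31 30 17, Add 9 31 17, Move 10 31, Add 8 4 7]"
  let ?table = "[Store 10 11, Add 11 11 9, Add 10 10 7, Sub 8 8 7, JumpPos 8 28]"
  have "0 + length ?init = 8" "8 + length ?accumulate = 11" "11 + length ?multiples = 28"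
    by simp_all
  with at have at1: "code_at P 0 ?init" and at2: "code_at P 8 ?accumulate"
    and at3: "code_at P 11 ?multiples" and at4: "code_at P 28 ?table"
    unfolding prologue_def code_at_append by (metis (no_types))+
  from runs_table_loop[where r = r3 and k = "2 * n" and m = m, OF at4 r3(1,2)]
  have table: "runs P (5 * Suc (2 * n)) (28, r3, m) (33, ?r4, ?m4)"
    using C0 by (simp add: r3 cong: if_cong)
  have "runs P 8 (0, \<lambda>_. 0, m) (8, ?r1, m)"
    using m0 by (intro runs_straightI[OF at1]) (simp_all add: fun_upd_twist)
  moreover have "runs P (3 * n) (8, ?r1, m) (11, ?r2, m)"
    using runs_accumulate_loop[OF at2, of ?r1 "n - 1" m] n
    by (simp add: C_def ac_simps fun_upd_twist)
  moreover have "runs P 17 (11, ?r2, m) (28, r3, m)"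
    unfolding r3_def by (intro runs_straightI[OF at3]) (simp_all add: fun_upd_twist mult.commute)
  \<comment> \<open>Straight code of lengths 8 and 17, three steps for each of the \<open>n\<close>
    additions, five for each of the \<open>2 * n + 1\<close> table rows.\<close>
  ultimately have "runs P (8 + (3 * n + (17 + 5 * Suc (2 * n)))) (0, \<lambda>_. 0, m) (33, ?r4, ?m4)"
    using table by (intro runs_trans)
  then have "runs P (13 * n + 30) (0, \<lambda>_. 0, m) (33, ?r4, ?m4)"
    by (simp add: algebra_simps)
  moreover have "represents C (2 * int n) (\<lambda>_. 0) (\<lambda>k i j. if k = 0 \<and> i = 0 then m (nat j) else 0) ?r4 ?m4"
    unfolding represents_def
  proof (intro conjI allI impI)
    show "?r4 (32 + x) = 0" for x by (simp add: r3_def)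
    have "\<forall>k \<in> {..<16}. ?r4 (16 + k) = C * int k"
      by (simp add: lessThan_nat_numeral r3_def)
    then show "?r4 (16 + k) = C * int k" if "k < 16" for k using that by simp
    have nn: "int n * 1 \<le> int n * int n" using n by (intro mult_left_mono) auto
    then have nC: "2 * int n + 1 \<le> C" by (simp add: C_def)
    show "?m4 (nat (C * 15 + i)) = 16 * C * i" if "0 \<le> i \<and> i \<le> 2 * int n" for i
      using that nC by simp
    fix k i j assume b: "in_bounds C (2 * int n) k i j"
    define x where "x = 16 * C * i + C * int k + j"
    have C: "C \<ge> 0" by (simp add: C_def)
    have x: "0 \<le> x" using b C unfolding x_def in_bounds_def by simp
    \<comment> \<open>No array cell was overwritten by the table, again by \<open>cell_inj\<close>
      with the fictitious array 15.\<close>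
    have "\<not> (C*15 \<le> x \<and> x < C*15 + (2 * int n + 1))"
    proof
      assume "C*15 \<le> x \<and> x < C*15 + (2 * int n + 1)"
      then have "int k = 15"
        using cell_inj[of j C "x - C*15" "int k" 15 i 0] b nC unfolding in_bounds_def x_def by auto
      with b show False unfolding in_bounds_def by simp
    qed
    then have m4: "?m4 (nat x) = m (nat x)" using x by auto
    show "?m4 (nat (16 * C * i + C * int k + j)) = (if k = 0 \<and> i = 0 then m (nat j) else 0)"
    proof (cases "k = 0 \<and> i = 0")
      case True
      then have "x = j" by (simp add: x_def)
      with True m4 show ?thesis unfolding x_def[symmetric] by simp
    next
      case False
      \<comment> \<open>A cell outside row 0 of array 0 lies at least one slice further, beyond the
        input.\<close>
      then have "1 \<le> 16 * i + int k" using b unfolding in_bounds_def by linarith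
      then have "C * 1 \<le> C * (16 * i + int k)" using C by (intro mult_left_mono)
      then have "C \<le> x" using b unfolding x_def in_bounds_def by (simp add: algebra_simps)
      then have "m (nat x) = 0" using m x by simp
      with False m4 show ?thesis unfolding x_def[symmetric] by auto
    qed
  qed
  ultimately show ?thesis by blast
qed

definition program_of :: "com \<Rightarrow> nat \<Rightarrow> program" where
  "program_of c x = prologue @ compile 33 c @ [Move 0 (32 + x)]"

text \<open>The surplus \<open>13 * n + 31\<close> is the prologue and the final \<open>Move\<close>
  into the output register.\<close>

theorem program_of_correct:
  fixes n :: nat and inp :: "int list"
  defines "C \<equiv> 12 * int n * int n + 12"
  assumes n: "n > 0" and inp: "inp \<noteq> []" "inp ! 0 = int n" "int (length inp) \<le> C"
    and c: "wp C (2 * int n) c (\<lambda>(t, v, a). t \<le> int T \<and> v x = out)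
      (0, \<lambda>_. 0, \<lambda>k i j. if k = 0 \<and> i = 0 then (if nat j < length inp then inp ! nat j else 0) else 0)"
  shows "outputs_within (program_of c x) inp (T + 13 * n + 31) out"
proof -
  let ?P = "program_of c x"
  let ?m = "\<lambda>j. if j < length inp then inp ! j else 0"
  have P: "code_at ?P 0 ?P" by (simp add: code_at_def)
  then have at: "code_at ?P 0 prologue" "code_at ?P 33 (compile 33 c)"
    "code_at ?P (33 + len c) [Move 0 (32 + x)]"
    unfolding program_of_def code_at_append by simp_all
  obtain r m where r: "runs ?P (13 * n + 30) (0, \<lambda>_. 0, ?m) (33, r, m)"
    and rep: "represents C (2 * int n) (\<lambda>_. 0) (\<lambda>k i j. if k = 0 \<and> i = 0 then ?m (nat j) else 0) r m"
    using runs_prologue[OF at(1) n, of ?m] inp unfolding C_def by auto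
  from c obtain t v a where b: "big C (2 * int n) c
      (0, \<lambda>_. 0, \<lambda>k i j. if k = 0 \<and> i = 0 then ?m (nat j) else 0) (t, v, a)"
    and t: "t \<le> int T" "v x = out"
    unfolding wp_def by auto
  have "2 * int n < C"
  proof -
    have "int n * 1 \<le> int n * int n" using n by (intro mult_left_mono) auto
    then show ?thesis by (simp add: C_def)
  qed
  from compile_correct[OF b _ this at(2), of r m] rep obtain k r' m' where
    k: "runs ?P k (33, r, m) (33 + len c, r', m')" "represents C (2 * int n) v a r' m'" "t = int k"
    by auto
  have "runs ?P 1 (33 + len c, r', m') (34 + len c, r'(0 := out), m')"
    using runs_straight[OF at(3), of "(r', m')"] k(2) t(2) by (simp add: represents_def)
  from runs_trans[OF r runs_trans[OF k(1) this]]
  have fin: "(step ?P ^^ (13 * n + 30 + (k + 1))) (initial inp) = (34 + len c, r'(0 := out), m')"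
    unfolding runs_def initial_def .
  have "length ?P = 34 + len c" by (simp add: program_of_def)
  then have "halted ?P (34 + len c, r'(0 := out), m')" by (simp add: halted_def)
  moreover have "13 * n + 30 + (k + 1) \<le> T + 13 * n + 31" using t(1) k(3) by simp
  ultimately show ?thesis
    unfolding outputs_within_def Let_def
    by (intro exI[of _ "13 * n + 30 + (k + 1)"] conjI) (simp_all only: fin snd_conv fst_conv fun_upd_same)
qed

section \<open>Moving a vertex to another cluster\<close>

text \<open>
  Vertices and labels are numbered from \<open>1\<close>; \<open>0\<close> means none. Variables \<open>0\<close> and \<open>1\<close> hold these
  constants, \<open>2\<close> the number of vertices, \<open>3\<close> the temperature, \<open>4\<close> the height of the stack, \<open>5\<close> the
  vertex that is moved and \<open>6\<close> its new label. Arrays \<open>3\<close> and \<open>4\<close> hold the neighbour of a vertex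
  and the strength of the bond in each of the slots \<open>1, \<dots>, 4\<close>, \<open>6\<close> the strengths between clusters
  and \<open>7\<close> the members of the clusters. In row \<open>0\<close>, array \<open>5\<close> holds the labels, \<open>8\<close> the sizes of
  the clusters, and \<open>9\<close> and \<open>10\<close> the two components of the stack.
\<close>

definition slot_step :: com where
  "slot_step =
     Rd 9 3 5 8 ;; Rd 10 4 5 8 ;; Rd 11 5 0 9 ;;
     Rd 12 6 6 11 ;; Ad 12 12 10 ;; Wr 6 6 11 12 ;;
     Rd 13 6 11 6 ;; Ad 13 13 10 ;; Wr 6 11 6 13 ;;
     Sb 14 12 3 ;; Ad 14 14 1 ;;
     IfP 14 (Wr 9 0 4 5 ;; Wr 10 0 4 9 ;; Ad 4 4 1) Skip ;;
     Sb 8 8 1"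

definition move :: com where
  "move = Wr 5 0 5 6 ;; Rd 7 8 0 6 ;; Wr 7 6 7 5 ;; Ad 7 7 1 ;; Wr 8 0 6 7 ;; Cst 8 4 ;; WhileP 8 slot_step"

definition arc_weight :: "(int \<Rightarrow> int \<Rightarrow> int) \<Rightarrow> (int \<Rightarrow> int \<Rightarrow> int) \<Rightarrow> int \<Rightarrow> int \<Rightarrow> int" where
  "arc_weight nb wt v u = (\<Sum>s\<in>{1..4}. if nb v s = u then wt v s else 0)"

definition cluster :: "int \<Rightarrow> (int \<Rightarrow> int) \<Rightarrow> int \<Rightarrow> int set" where
  "cluster n L x = {v \<in> {1..n}. L v = x}"

definition label_weight :: "int \<Rightarrow> (int \<Rightarrow> int \<Rightarrow> int) \<Rightarrow> (int \<Rightarrow> int) \<Rightarrow> int \<Rightarrow> int \<Rightarrow> int" where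
  "label_weight n w L x y = (\<Sum>v\<in>cluster n L x. \<Sum>u\<in>cluster n L y. w v u)"

text \<open>
  In the following, \<open>D\<close> contains the labels that are not or no longer in use, or whose cluster is
  being dissolved. The data stored for them is junk, and so is the diagonal of the matrix \<open>W\<close>.
\<close>

definition members_ok :: "int \<Rightarrow> int set \<Rightarrow> (int \<Rightarrow> int) \<Rightarrow> (int \<Rightarrow> int \<Rightarrow> int) \<Rightarrow> (int \<Rightarrow> int) \<Rightarrow> bool" where
  "members_ok n D L M Z \<longleftrightarrow> (\<forall>x. x \<notin> D \<longrightarrow> Z x = int (card (cluster n L x)) \<and>
     inj_on (M x) {0..<Z x} \<and> M x ` {0..<Z x} = cluster n L x)"

text \<open>Entries are vertices, and their labels are looked up afresh: a popped entry always names
  clusters that are in use, even after many merges. Only coverage of heavy pairs is demanded, so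
  stale entries are allowed.\<close>

definition stack_ok :: "int \<Rightarrow> int \<Rightarrow> int set \<Rightarrow> (int \<Rightarrow> int) \<Rightarrow> (int \<Rightarrow> int \<Rightarrow> int) \<Rightarrow>
    (int \<Rightarrow> int) \<Rightarrow> (int \<Rightarrow> int) \<Rightarrow> int \<Rightarrow> bool" where
  "stack_ok n tau D L W SA SB sp \<longleftrightarrow>
     0 \<le> sp \<and> (\<forall>i\<in>{0..<sp}. SA i \<in> {1..n} \<and> SB i \<in> {1..n}) \<and>
     (\<forall>x y. x \<notin> D \<longrightarrow> y \<notin> D \<longrightarrow> x \<noteq> y \<longrightarrow> tau \<le> W x y \<longrightarrow>
       (\<exists>i\<in>{0..<sp}. L (SA i) = x \<and> L (SB i) = y \<or> L (SA i) = y \<and> L (SB i) = x))"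

text \<open>The diagonal is exempt because for \<open>b = c\<close> the two writes of
  \<open>slot_step\<close> hit the same cell and add \<open>w\<close> twice.\<close>

definition adds :: "(int \<Rightarrow> int \<Rightarrow> int) \<Rightarrow> (int \<Rightarrow> int \<Rightarrow> int) \<Rightarrow> int \<Rightarrow> int \<Rightarrow> int \<Rightarrow> bool" where
  "adds W W' b c w \<longleftrightarrow>
     (\<forall>x y. x \<noteq> y \<longrightarrow> W' x y = W x y + (if x = b \<and> y = c \<or> x = c \<and> y = b then w else 0))"

section \<open>Preservation of the stack and of the member lists\<close>

lemma cluster_finite [simp]: "finite (cluster n L x)"
  by (rule finite_subset[of _ "{1..n}"]) (auto simp: cluster_def)

lemma cluster_subset: "cluster n L x \<subseteq> {1..n}"
  by (auto simp: cluster_def)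

lemma card_cluster_le: "0 \<le> n \<Longrightarrow> int (card (cluster n L x)) \<le> n"
  using card_mono[OF _ cluster_subset[of n L x]] by simp

lemma stack_ok_push:
  assumes ok: "stack_ok n tau D L W SA SB sp" and ad: "adds W W' b c w"
    and v: "v \<in> {1..n}" "L v = b" and u: "u \<in> {1..n}" "L u = c"
  shows "stack_ok n tau D L W' (SA(sp := v)) (SB(sp := u)) (sp + 1)"
proof -
  have sp: "0 \<le> sp" using ok by (simp add: stack_ok_def)
  have "\<exists>i\<in>{0..<sp + 1}. L ((SA(sp := v)) i) = x \<and> L ((SB(sp := u)) i) = y \<or>
        L ((SA(sp := v)) i) = y \<and> L ((SB(sp := u)) i) = x"
    if h: "x \<notin> D" "y \<notin> D" "x \<noteq> y" "tau \<le> W' x y" for x y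
  proof (cases "x = b \<and> y = c \<or> x = c \<and> y = b")
    case True
    then show ?thesis using v u sp by (intro bexI[of _ sp]) auto
  next
    case False
    then have "W' x y = W x y" using ad h(3) unfolding adds_def by auto
    then obtain i where "i \<in> {0..<sp}" "L (SA i) = x \<and> L (SB i) = y \<or> L (SA i) = y \<and> L (SB i) = x"
      using ok h unfolding stack_ok_def by metis
    then show ?thesis by (intro bexI[of _ i]) auto
  qed
  then show ?thesis using ok v u unfolding stack_ok_def by auto
qed

text \<open>The only off-diagonal entries that change stay below \<open>tau\<close>, so no new pair
  has to be covered.\<close>

lemma stack_ok_skip:
  assumes ok: "stack_ok n tau D L W SA SB sp" and ad: "adds W W' b c w"
    and sym: "\<forall>x y. x \<noteq> y \<longrightarrow> W x y = W y x" and low: "b \<noteq> c \<Longrightarrow> W b c + w < tau"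
  shows "stack_ok n tau D L W' SA SB sp"
proof -
  have "tau \<le> W x y" if "x \<noteq> y" "tau \<le> W' x y" for x y
  proof -
    have "\<not> (x = b \<and> y = c \<or> x = c \<and> y = b)"
    proof
      assume d: "x = b \<and> y = c \<or> x = c \<and> y = b"
      then have "b \<noteq> c" using that(1) by auto
      moreover from this have "W x y = W b c" using sym d by auto
      moreover have "W' x y = W x y + w" using ad d that(1) unfolding adds_def by simp
      ultimately show False using low that(2) by linarith
    qed
    then show ?thesis using ad that unfolding adds_def by auto
  qed
  then show ?thesis using ok unfolding stack_ok_def by blast
qed

lemma stack_ok_antimono: "stack_ok n tau D L W SA SB sp \<Longrightarrow> D \<subseteq> D' \<Longrightarrow> stack_ok n tau D' L W SA SB sp"
  unfolding stack_ok_def by (meson subsetD)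

lemma members_ok_antimono: "members_ok n D L M Z \<Longrightarrow> D \<subseteq> D' \<Longrightarrow> members_ok n D' L M Z"
  unfolding members_ok_def by blast

lemma cluster_upd:
  assumes "v \<in> {1..n}" "L v \<in> D" "b \<notin> D" "x \<notin> D"
  shows "cluster n (L(v := b)) x = (if x = b then insert v (cluster n L x) else cluster n L x)"
    and "v \<notin> cluster n L x"
  using assms unfolding cluster_def by auto

text \<open>Appending suffices: the vertex is not removed from the list of its old label, since that
  label is in \<open>D\<close>.\<close>

lemma members_ok_move:
  assumes ok: "members_ok n D L M Z" and v: "v \<in> {1..n}" "L v \<in> D" and b: "b \<notin> D"
  shows "members_ok n D (L(v := b)) (M(b := (M b)(Z b := v))) (Z(b := Z b + 1))"
  unfolding members_ok_def
proof (intro allI impI)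
  fix x assume x: "x \<notin> D"
  note cl = cluster_upd[of v n L D b x, OF v b x]
  have okx: "Z x = int (card (cluster n L x))" "inj_on (M x) {0..<Z x}" "M x ` {0..<Z x} = cluster n L x"
    using ok x unfolding members_ok_def by blast+
  show "(Z(b := Z b + 1)) x = int (card (cluster n (L(v := b)) x)) \<and>
      inj_on ((M(b := (M b)(Z b := v))) x) {0..<(Z(b := Z b + 1)) x} \<and>
      (M(b := (M b)(Z b := v))) x ` {0..<(Z(b := Z b + 1)) x} = cluster n (L(v := b)) x"
  proof (cases "x = b")
    case True
    have "{0..<Z b + 1} = insert (Z b) {0..<Z b}" using okx(1) True by auto
    moreover have "(M b)(Z b := v) ` {0..<Z b} = M b ` {0..<Z b}" by (intro image_cong) auto
    moreover have "inj_on ((M b)(Z b := v)) {0..<Z b} = inj_on (M b) {0..<Z b}"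
      by (intro inj_on_cong) auto
    moreover have "{0..<Z b} \<inter> {i. i \<noteq> Z b} = {0..<Z b}" by auto
    ultimately show ?thesis using okx cl True by simp
  next
    case False
    then show ?thesis using okx cl by simp
  qed
qed

locale weighted_graph =
  fixes n tau C :: int and nb wt :: "int \<Rightarrow> int \<Rightarrow> int"
  assumes n: "1 \<le> n" and tau: "0 < tau" and C: "12 * n * n + 12 \<le> C"
    and nb: "v \<in> {1..n} \<Longrightarrow> s \<in> {1..4} \<Longrightarrow> nb v s \<in> {1..n}"
    and arc_weight_commute:
      "v \<in> {1..n} \<Longrightarrow> u \<in> {1..n} \<Longrightarrow> arc_weight nb wt v u = arc_weight nb wt u v"
begin

abbreviation "weight \<equiv> label_weight n (arc_weight nb wt)"

lemma n_square: "n \<le> n * n"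
  using mult_left_mono[of 1 n n] n by simp

text \<open>The last bound is for the stack: \<open>4 * n\<close> entries from initialisation,
  \<open>4 * n * n\<close> as an estimate for the merges, and \<open>4 * n + 4\<close> in reserve
  for a merge in progress.\<close>

lemma C_bounds: "4 < C" "2 * n < C" "8 * n + 4 * n * n + 4 < C"
  using C n_square n unfolding mult.assoc by linarith+

lemma weight_commute: "weight L x y = weight L y x"
  unfolding label_weight_def
  by (subst sum.swap) (auto intro!: sum.cong arc_weight_commute simp: cluster_def)

text \<open>The slots are treated downwards from 4, so the slots above \<open>s\<close> are those
  already done: this is the weight added to the matrix so far.\<close>

definition pending :: "(int \<Rightarrow> int) \<Rightarrow> int \<Rightarrow> int \<Rightarrow> int \<Rightarrow> int" where
  "pending L v y s = (\<Sum>s'\<in>{s<..4}. if L (nb v s') = y then wt v s' else 0)"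

lemma pending_step:
  assumes "0 < s" "s \<le> 4"
  shows "pending L v y (s - 1) = pending L v y s + (if L (nb v s) = y then wt v s else 0)"
proof -
  have "{s - 1<..4} = insert s {s<..4}" using assms by auto
  then show ?thesis by (simp add: pending_def)
qed

lemma pending_0:
  assumes v: "v \<in> {1..n}"
  shows "pending L v y 0 = (\<Sum>u\<in>cluster n L y. arc_weight nb wt v u)"
proof -
  have "(\<Sum>u\<in>cluster n L y. arc_weight nb wt v u) =
      (\<Sum>s\<in>{1..4}. \<Sum>u\<in>cluster n L y. if nb v s = u then wt v s else 0)"
    unfolding arc_weight_def by (rule sum.swap)
  also have "\<dots> = (\<Sum>s\<in>{1..4}. if L (nb v s) = y then wt v s else 0)"
  proof (rule sum.cong[OF refl])
    fix s :: int assume "s \<in> {1..4}"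
    then have "nb v s \<in> cluster n L y \<longleftrightarrow> L (nb v s) = y"
      using nb[OF v] by (simp add: cluster_def)
    then show "(\<Sum>u\<in>cluster n L y. if nb v s = u then wt v s else 0) =
        (if L (nb v s) = y then wt v s else 0)"
      by simp
  qed
  also have "{1..4::int} = {0<..4}" by auto
  finally show ?thesis by (simp add: pending_def)
qed

text \<open>The loss at the old label needs no bookkeeping because that label is in
  \<open>D\<close>; among the other labels only the row and the column of \<open>b\<close> change,
  by the bonds of the moved vertex.\<close>

lemma weight_move:
  assumes v: "v \<in> {1..n}" "L v \<in> D" and b: "b \<notin> D" and xy: "x \<notin> D" "y \<notin> D" "x \<noteq> y"
  shows "weight (L(v := b)) x y = weight L x y +
    (if x = b then pending (L(v := b)) v y 0 else 0) + (if y = b then pending (L(v := b)) v x 0 else 0)"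
proof -
  note cl = cluster_upd[of v n L D b, OF v b]
  have 1: "weight (L(v := b)) b y = weight L b y + pending (L(v := b)) v y 0"
    if "y \<notin> D" "y \<noteq> b" for y
    using cl[OF b] cl[OF that(1)] that(2) by (simp add: label_weight_def pending_0[OF v(1)])
  have 2: "weight (L(v := b)) x y = weight L x y" if "x \<noteq> b" "y \<noteq> b"
    using cl[OF xy(1)] cl[OF xy(2)] that by (simp add: label_weight_def)
  show ?thesis
    using 1[of y] 1[of x] 2 xy weight_commute[of _ _ b] by auto
qed

definition frame :: "(nat \<Rightarrow> int) \<Rightarrow> arrays \<Rightarrow> bool" where
  "frame v a \<longleftrightarrow> v 0 = 0 \<and> v 1 = 1 \<and> v 2 = n \<and> v 3 = tau \<and> a 3 = nb \<and> a 4 = wt"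

text \<open>\<open>G\<close> is the matrix of cluster weights before the move, \<open>T\<close> a
  deadline with 60 ticks reserved per remaining slot, and \<open>f\<close> the variables before the
  loop. Each slot pushes at most one entry.\<close>

definition slot_inv where
  "slot_inv v\<^sub>0 b D L G M Z sp\<^sub>0 T f = (\<lambda>(t, v, a).
     frame v a \<and> v 5 = v\<^sub>0 \<and> v 6 = b \<and> 0 \<le> v 8 \<and> v 8 \<le> 4 \<and> a 5 0 = L \<and> a 7 = M \<and> a 8 = Z \<and>
     (\<forall>x y. x \<noteq> y \<longrightarrow> a 6 x y = a 6 y x) \<and>
     (\<forall>x y. x \<notin> D \<longrightarrow> y \<notin> D \<longrightarrow> x \<noteq> y \<longrightarrow> a 6 x y = G x y +
        (if x = b then pending L v\<^sub>0 y (v 8) else 0) + (if y = b then pending L v\<^sub>0 x (v 8) else 0)) \<and>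
     stack_ok n tau D L (a 6) (a 9 0) (a 10 0) (v 4) \<and> sp\<^sub>0 \<le> v 4 \<and> v 4 \<le> sp\<^sub>0 + (4 - v 8) \<and>
     t + 60 * v 8 \<le> T \<and> (\<forall>x. x \<notin> {4, 7, 8, 9, 10, 11, 12, 13, 14} \<longrightarrow> v x = f x))"

lemma slot_step_correct:
  assumes inv: "slot_inv v\<^sub>0 b D L G M Z sp\<^sub>0 T f (t, v, a)" and s: "v 8 > 0"
    and v0: "v\<^sub>0 \<in> {1..n}" "L v\<^sub>0 = b" and b: "b \<in> {0..n}"
    and L: "\<forall>u\<in>{1..n}. L u \<in> {0..n}" and sp: "sp\<^sub>0 + 4 \<le> C"
  shows "wp C (2 * n) slot_step (\<lambda>(t, v, a). slot_inv v\<^sub>0 b D L G M Z sp\<^sub>0 T f (t + 1, v, a)) (t + 1, v, a)"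
proof -
  define s where "s = v 8"
  define u where "u = nb v\<^sub>0 s"
  define w where "w = wt v\<^sub>0 s"
  define c where "c = L u"
  define W where "W = a 6"
  define W1 where "W1 = W(b := (W b)(c := W b c + w))"
  define W' where "W' = W1(c := (W1 c)(b := W1 c b + w))"
  have s14: "s \<in> {1..4}" using inv s unfolding s_def slot_inv_def by auto
  have u: "u \<in> {1..n}" using nb v0 s14 unfolding u_def by blast
  have c: "c \<in> {0..n}" using L u unfolding c_def by blast
  note inv' = inv[unfolded slot_inv_def frame_def prod.case, folded W_def, folded s_def]
  have ad: "adds W W' b c w" unfolding adds_def W'_def W1_def by auto
  have sym: "\<forall>x y. x \<noteq> y \<longrightarrow> W x y = W y x" using inv' by blast
  have sym': "\<forall>x y. x \<noteq> y \<longrightarrow> W' x y = W' y x"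
    using ad sym unfolding adds_def by simp
  have wts: "\<forall>x y. x \<notin> D \<longrightarrow> y \<notin> D \<longrightarrow> x \<noteq> y \<longrightarrow> W' x y = G x y +
        (if x = b then pending L v\<^sub>0 y (s - 1) else 0) + (if y = b then pending L v\<^sub>0 x (s - 1) else 0)"
  proof (intro allI impI)
    fix x y assume xy: "x \<notin> D" "y \<notin> D" "x \<noteq> y"
    have pend: "pending L v\<^sub>0 y (s - 1) = pending L v\<^sub>0 y s + (if c = y then w else 0)" for y
      using s14 pending_step[of s L v\<^sub>0 y] by (simp add: u_def w_def c_def)
    have W: "W x y = G x y + (if x = b then pending L v\<^sub>0 y s else 0) + (if y = b then pending L v\<^sub>0 x s else 0)"
      using inv' xy unfolding W_def by blast
    have "W' x y = W x y + (if x = b \<and> y = c \<or> x = c \<and> y = b then w else 0)"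
      using ad xy(3) unfolding adds_def by blast
    then show "W' x y = G x y +
        (if x = b then pending L v\<^sub>0 y (s - 1) else 0) + (if y = b then pending L v\<^sub>0 x (s - 1) else 0)"
      unfolding W pend using xy(3) by (simp split: if_split)
  qed
  have ok: "stack_ok n tau D L W (a 9 0) (a 10 0) (v 4)" using inv' by blast
  note push = stack_ok_push[OF ok ad v0 u c_def[symmetric]]
  note skip = stack_ok_skip[OF ok ad sym]
  have sp': "0 \<le> v 4" "v 4 < C" using ok inv' s14 sp unfolding stack_ok_def by auto
  have vals: "v 0 = 0" "v (Suc 0) = 1" "v 3 = tau" "v 5 = v\<^sub>0" "v 6 = b" "v 8 = s" "a 3 = nb" "a 4 = wt" "a 5 0 = L"
    "nb v\<^sub>0 s = u" "wt v\<^sub>0 s = w" "L u = c" "a 6 = W"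
    using inv' unfolding u_def w_def c_def W_def s_def by simp_all
  have bds: "0 \<le> v\<^sub>0" "v\<^sub>0 \<le> 2 * n" "0 \<le> s" "s < C" "0 \<le> u" "u < C" "0 \<le> b" "b \<le> 2 * n" "0 \<le> c" "c \<le> 2 * n"
    "b < C" "c < C" "0 \<le> n"
    using v0 u b c s14 C_bounds n by auto
  \<comment> \<open>Variable 14 is positive exactly if the increased entry is at least
    \<open>tau\<close>; the two facts are the two outcomes. A pair with \<open>c = b\<close> may be
    pushed as well and is discarded when popped.\<close>
  have push': "slot_inv v\<^sub>0 b D L G M Z sp\<^sub>0 T f
      (54 + t, v(9 := u, 10 := w, 11 := c, 12 := W b c + w, 13 := W1 c b + w,
         14 := W b c + w - tau + 1, 4 := v 4 + 1, 8 := s - 1),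
       a(6 := W', 9 := (a 9)(0 := (a 9 0)(v 4 := v\<^sub>0)), 10 := (a 10)(0 := (a 10 0)(v 4 := u))))"
    using inv' sym' wts push s14 unfolding slot_inv_def frame_def prod.case by simp
  have skip': "slot_inv v\<^sub>0 b D L G M Z sp\<^sub>0 T f
      (44 + t, v(9 := u, 10 := w, 11 := c, 12 := W b c + w, 13 := W1 c b + w,
         14 := W b c + w - tau + 1, 8 := s - 1), a(6 := W'))" if "\<not> tau \<le> W b c + w"
    using inv' sym' wts skip that s14 unfolding slot_inv_def frame_def prod.case by simp
  show ?thesis
    unfolding slot_step_def using sp' bds push' skip'
    by (simp add: vals in_bounds_def W1_def[symmetric] W'_def[symmetric])
qed

definition consistent :: "int set \<Rightarrow> int \<Rightarrow> arrays \<Rightarrow> bool" where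
  "consistent D sp a \<longleftrightarrow> (\<forall>u\<in>{1..n}. a 5 0 u \<in> {0..n}) \<and> (\<forall>x y. x \<noteq> y \<longrightarrow> a 6 x y = a 6 y x) \<and>
     (\<forall>x y. x \<notin> D \<longrightarrow> y \<notin> D \<longrightarrow> x \<noteq> y \<longrightarrow> a 6 x y = weight (a 5 0) x y) \<and>
     members_ok n D (a 5 0) (a 7) (a 8 0) \<and>
     stack_ok n tau D (a 5 0) (a 6) (a 9 0) (a 10 0) sp"

text \<open>A vertex whose label is in \<open>D\<close> witnesses none of the pairs that must be
  covered.\<close>

lemma stack_ok_relabel:
  assumes "stack_ok n tau D L W SA SB sp" "L v \<in> D"
  shows "stack_ok n tau D (L(v := b)) W SA SB sp"
  using assms unfolding stack_ok_def by (metis fun_upd_other)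

lemma move_correct:
  assumes fr: "frame v a" and con: "consistent D (v 4) a"
    and v0: "v 5 \<in> {1..n}" "a 5 0 (v 5) \<in> D" and b: "v 6 \<in> {1..n}" "v 6 \<notin> D" and sp: "v 4 + 4 \<le> C"
    and Q: "\<And>t' v' a'. frame v' a' \<Longrightarrow> consistent D (v' 4) a' \<Longrightarrow> a' 5 0 = (a 5 0)(v 5 := v 6) \<Longrightarrow>
      (\<And>x. x \<noteq> v 6 \<Longrightarrow> a' 7 x = a 7 x \<and> a' 8 0 x = a 8 0 x) \<Longrightarrow> v 4 \<le> v' 4 \<Longrightarrow> v' 4 \<le> v 4 + 4 \<Longrightarrow>
      (\<And>x. x \<notin> {4, 7, 8, 9, 10, 11, 12, 13, 14} \<Longrightarrow> v' x = v x) \<Longrightarrow> t' \<le> t + 270 \<Longrightarrow> Q (t', v', a')"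
  shows "wp C (2 * n) move Q (t, v, a)"
proof -
  define L where "L = (a 5 0)(v 5 := v 6)"
  define Z where "Z = (a 8)(0 := (a 8 0)(v 6 := a 8 0 (v 6) + 1))"
  define M where "M = (a 7)(v 6 := (a 7 (v 6))(a 8 0 (v 6) := v 5))"
  note con' = con[unfolded consistent_def]
  have mem: "members_ok n D L M (Z 0)"
    using members_ok_move[of n D "a 5 0" "a 7" "a 8 0" "v 5" "v 6"] con' v0 b
    unfolding L_def M_def Z_def by simp
  have st: "stack_ok n tau D L (a 6) (a 9 0) (a 10 0) (v 4)"
    using stack_ok_relabel con' v0 unfolding L_def by blast
  have L: "\<forall>u\<in>{1..n}. L u \<in> {0..n}" using con' b unfolding L_def by auto
  have Z: "0 \<le> a 8 0 (v 6)" "a 8 0 (v 6) \<le> n"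
    using con' b(2) card_cluster_le[of n "a 5 0" "v 6"] n unfolding members_ok_def by auto
  \<comment> \<open>22 ticks before the loop and 60 for each of four slots give the deadline 262;
    leaving the loop costs 2 more, which 270 rounds up.\<close>
  have loop: "wp C (2 * n) (WhileP 8 slot_step) Q
    (22 + t, v(7 := a 8 0 (v 6) + 1, 8 := 4), a(5 := (a 5)(0 := L), 7 := M, 8 := Z))"
  proof (rule wp_While[where I = "slot_inv (v 5) (v 6) D L (weight (a 5 0)) M Z (v 4) (t + 262) v"
        and bd = "t + 262"])
    show "slot_inv (v 5) (v 6) D L (weight (a 5 0)) M Z (v 4) (t + 262) v
      (22 + t, v(7 := a 8 0 (v 6) + 1, 8 := 4), a(5 := (a 5)(0 := L), 7 := M, 8 := Z))"
      using fr con' st unfolding slot_inv_def frame_def prod.case by (simp add: pending_def)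
  next
    fix t' v' a'
    assume "slot_inv (v 5) (v 6) D L (weight (a 5 0)) M Z (v 4) (t + 262) v (t', v', a')"
    then show "t' \<le> t + 262" unfolding slot_inv_def by auto
  next
    fix t' v' a'
    assume inv: "slot_inv (v 5) (v 6) D L (weight (a 5 0)) M Z (v 4) (t + 262) v (t', v', a')"
      and "0 < v' 8"
    then show "wp C (2 * n) slot_step (\<lambda>(t', v', a').
        slot_inv (v 5) (v 6) D L (weight (a 5 0)) M Z (v 4) (t + 262) v (t' + 1, v', a')) (t' + 1, v', a')"
      using v0 b L sp by (intro slot_step_correct) (auto simp: L_def)
  next
    fix t' v' a'
    assume inv: "slot_inv (v 5) (v 6) D L (weight (a 5 0)) M Z (v 4) (t + 262) v (t', v', a')"
      and "v' 8 \<le> 0"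
    note inv' = inv[unfolded slot_inv_def prod.case]
    have s: "v' 8 = 0" using inv' \<open>v' 8 \<le> 0\<close> by linarith
    have "a' 6 x y = weight L x y" if xy: "x \<notin> D" "y \<notin> D" "x \<noteq> y" for x y
      using inv' s weight_move[of "v 5" "a 5 0" D "v 6" x y] v0 b xy unfolding L_def by simp
    then have "consistent D (v' 4) a'"
      using inv' L mem unfolding consistent_def by simp
    then show "Q (t' + 2, v', a')"
      using inv' s by (intro Q) (auto simp: L_def M_def Z_def)
  qed
  have v: "v 0 = 0" "v (Suc 0) = 1" using fr by (auto simp: frame_def)
  show ?thesis
    unfolding move_def
    using loop v0 b Z C_bounds n v
    by (simp add: in_bounds_def L_def[symmetric] M_def[symmetric] Z_def[symmetric])
qed

end

section \<open>Merging clusters\<close>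

text \<open>All vertices start with the unused label \<open>0\<close>, so that the initial matrix results from moves as well.\<close>

definition init_clusters :: com where
  "init_clusters = Cst 5 0 ;; Mov 15 2 ;; WhileP 15 (Ad 5 5 1 ;; Mov 6 5 ;; move ;; Sb 15 15 1)"

definition move_all :: com where
  "move_all = Mov 15 12 ;; Cst 17 0 ;; WhileP 15 (Rd 5 7 16 17 ;; move ;; Ad 17 17 1 ;; Sb 15 15 1)"

definition merge :: com where
  "merge = Rd 12 8 0 16 ;; Rd 13 8 0 6 ;; Sb 14 12 13 ;;
     IfP 14 (Mov 14 16 ;; Mov 16 6 ;; Mov 6 14 ;; Mov 12 13) Skip ;; move_all"

definition pop_step :: com where
  "pop_step = Sb 4 4 1 ;; Rd 16 9 0 4 ;; Rd 9 10 0 4 ;; Rd 16 5 0 16 ;; Rd 6 5 0 9 ;; Sb 14 16 6 ;;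
     IfZ 14 Skip (Rd 12 6 16 6 ;; Sb 14 12 3 ;; Ad 14 14 1 ;; IfP 14 merge Skip)"

definition report :: com where
  "report = Cst 18 1 ;; Rd 9 5 0 18 ;; Rd 12 8 0 9 ;; Sb 14 2 12 ;; IfZ 14 (Cst 19 1) (Cst 19 0)"

definition merge_clusters :: com where
  "merge_clusters = Cst 4 0 ;; init_clusters ;; WhileP 4 pop_step ;; report"

section \<open>The potential of a labelling\<close>

definition potential :: "int \<Rightarrow> (int \<Rightarrow> int) \<Rightarrow> real" where
  "potential n L = (\<Sum>v\<in>{1..n}. log 2 (real (card (cluster n L (L v)))))"

text \<open>Values outside \<open>{1..n}\<close> are kept, as \<open>move_all\<close> touches listed
  members only; its effect is thus an equation between functions.\<close>

definition relabel :: "int \<Rightarrow> int \<Rightarrow> int \<Rightarrow> (int \<Rightarrow> int) \<Rightarrow> int \<Rightarrow> int" where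
  "relabel n a b L = (\<lambda>u. if u \<in> cluster n L a then b else L u)"

lemma cluster_relabel:
  assumes "a \<noteq> b"
  shows "cluster n (relabel n a b L) x =
    (if x = b then cluster n L a \<union> cluster n L b else if x = a then {} else cluster n L x)"
  using assms by (auto simp: cluster_def relabel_def)

lemma card_cluster_pos: "v \<in> {1..n} \<Longrightarrow> 0 < card (cluster n L (L v))"
proof -
  assume "v \<in> {1..n}"
  then have "v \<in> cluster n L (L v)" by (simp add: cluster_def)
  then show ?thesis by (auto simp: card_gt_0_iff)
qed

lemma potential_le:
  assumes "1 \<le> n"
  shows "potential n L \<le> n * log 2 n"
proof -
  have "log 2 (real (card (cluster n L (L v)))) \<le> log 2 n" if "v \<in> {1..n}" for v
  proof -
    have "0 < real (card (cluster n L (L v)))" using card_cluster_pos[OF that] by simp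
    moreover have "real (card (cluster n L (L v))) \<le> n"
      using card_cluster_le[of n L "L v"] assms by (metis of_int_le_iff of_int_of_nat_eq order_trans zero_le_one)
    ultimately show ?thesis by (simp add: log_le_cancel_iff)
  qed
  then have "potential n L \<le> (\<Sum>v\<in>{1..n}. log 2 n)"
    unfolding potential_def by (rule sum_mono)
  then show ?thesis using assms by simp
qed

text \<open>Every vertex that changes its label has its cluster at least doubled in size.\<close>

lemma potential_relabel:
  assumes ab: "a \<noteq> b" and le: "card (cluster n L a) \<le> card (cluster n L b)"
  shows "potential n L + card (cluster n L a) \<le> potential n (relabel n a b L)"
proof -
  let ?L = "relabel n a b L"
  let ?c = "\<lambda>L v. log 2 (real (card (cluster n L (L v))))"
  have disj: "cluster n L a \<inter> cluster n L b = {}" using ab by (auto simp: cluster_def)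
  have card: "card (cluster n L a \<union> cluster n L b) = card (cluster n L a) + card (cluster n L b)"
    by (rule card_Un_disjoint) (use disj in auto)
  have "?c L v + (if v \<in> cluster n L a then 1 else 0) \<le> ?c ?L v" if v: "v \<in> {1..n}" for v
  proof -
    have pos: "0 < card (cluster n L (L v))" using card_cluster_pos[OF v] .
    consider "L v = a" | "L v = b" | "L v \<noteq> a" "L v \<noteq> b" by blast
    then show ?thesis
    proof cases
      case 1
      then have "v \<in> cluster n L a" using v by (simp add: cluster_def)
      then have "?L v = b" by (simp add: relabel_def)
      \<comment> \<open>The new cluster has the size of \<open>a\<close> and \<open>b\<close>
        together, at least twice that of \<open>a\<close>; doubling adds 1 to the logarithm.\<close>
      have "?c L v + 1 = log 2 (2 * real (card (cluster n L a)))"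
        using pos 1 by (auto simp: log_mult)
      also have "\<dots> \<le> ?c ?L v"
        using pos 1 le \<open>?L v = b\<close> by (simp add: cluster_relabel[OF ab] card)
      finally show ?thesis using \<open>v \<in> cluster n L a\<close> by simp
    next
      case 2
      then have "v \<notin> cluster n L a" using ab by (auto simp: cluster_def)
      then have "?L v = b" using 2 by (simp add: relabel_def)
      then show ?thesis using 2 pos \<open>v \<notin> cluster n L a\<close> by (simp add: cluster_relabel[OF ab] card)
    next
      case 3
      then have "v \<notin> cluster n L a" by (auto simp: cluster_def)
      then have "?L v = L v" by (simp add: relabel_def)
      then show ?thesis using 3 \<open>v \<notin> cluster n L a\<close> by (simp add: cluster_relabel[OF ab])
    qed
  qed
  then have "(\<Sum>v\<in>{1..n}. ?c L v + (if v \<in> cluster n L a then 1 else 0)) \<le> potential n ?L"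
    unfolding potential_def by (rule sum_mono)
  moreover have "(\<Sum>v\<in>{1..n}. if v \<in> cluster n L a then 1 else 0) = real (card (cluster n L a))"
    using cluster_subset[of n L a] by (simp add: sum.If_cases Int_absorb1)
  ultimately show ?thesis unfolding potential_def by (simp add: sum.distrib)
qed

section \<open>Loops that move many vertices\<close>

context weighted_graph
begin

definition init_inv :: "int \<Rightarrow> state \<Rightarrow> bool" where
  "init_inv T = (\<lambda>(t, v, a). frame v a \<and> consistent {0} (v 4) a \<and> v 5 = n - v 15 \<and> 0 \<le> v 15 \<and> v 15 \<le> n \<and>
     (\<forall>u\<in>{1..n}. a 5 0 u = (if u \<le> v 5 then u else 0)) \<and> v 4 \<le> 4 * v 5 \<and> t + 280 * v 15 \<le> T)"

lemma init_clusters_correct: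
  assumes fr: "frame v a" and con: "consistent {0} 0 a" and v4: "v 4 = 0"
    and a5: "\<forall>u\<in>{1..n}. a 5 0 u = 0"
    and Q: "\<And>t' v' a'. frame v' a' \<Longrightarrow> consistent {0} (v' 4) a' \<Longrightarrow> (\<forall>u\<in>{1..n}. a' 5 0 u = u) \<Longrightarrow>
      v' 4 \<le> 4 * n \<Longrightarrow> t' \<le> t + 280 * n + 4 \<Longrightarrow> Q (t', v', a')"
  shows "wp C (2 * n) init_clusters Q (t, v, a)"
proof -
  have "wp C (2 * n) (WhileP 15 (Ad 5 5 1 ;; Mov 6 5 ;; move ;; Sb 15 15 1)) Q
      (t + 2, v(5 := 0, 15 := n), a)"
  proof (rule wp_While[where I = "init_inv (t + 280 * n + 2)" and bd = "t + 280 * n + 2"])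
    show "init_inv (t + 280 * n + 2) (t + 2, v(5 := 0, 15 := n), a)"
      using fr con v4 a5 n by (simp add: init_inv_def frame_def)
  next
    fix t' v' a'
    assume "init_inv (t + 280 * n + 2) (t', v', a')"
    then show "t' \<le> t + 280 * n + 2" unfolding init_inv_def by auto
  next
    fix t' v' a'
    assume inv: "init_inv (t + 280 * n + 2) (t', v', a')" and pos: "0 < v' 15"
    note inv' = inv[unfolded init_inv_def prod.case]
    let ?v = "v'(5 := v' 5 + 1, 6 := v' 5 + 1)"
    have v1: "v' (Suc 0) = 1" using inv' by (simp add: frame_def)
    have "v' 4 \<le> 4 * n" using inv' pos by simp
    then have sp: "v' 4 + 4 \<le> C" using C_bounds n n_square by linarith
    let ?Q = "\<lambda>(t', v', a'). init_inv (t + 280 * n + 2) (t' + 1, v', a')"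
    have "wp C (2 * n) move (wp C (2 * n) (Sb 15 15 1) ?Q) (t' + 3, ?v, a')"
    proof (rule move_correct[where D = "{0}"])
      show "frame ?v a'" using inv' by (simp add: frame_def)
      show "consistent {0} (?v 4) a'" using inv' by simp
      show "?v 5 \<in> {1..n}" "?v 6 \<in> {1..n}" "?v 6 \<notin> {0}" using inv' pos by auto
      then show "a' 5 0 (?v 5) \<in> {0}" using inv' by auto
      show "?v 4 + 4 \<le> C" using sp by simp
      fix t2 v2 a2
      assume 2: "frame v2 a2" "consistent {0} (v2 4) a2" "a2 5 0 = (a' 5 0)(?v 5 := ?v 6)"
        "v2 4 \<le> ?v 4 + 4" "\<And>x. x \<notin> {4, 7, 8, 9, 10, 11, 12, 13, 14} \<Longrightarrow> v2 x = ?v x" "t2 \<le> t' + 3 + 270"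
      have v2: "v2 5 = v' 5 + 1" "v2 15 = v' 15" using 2(5) by simp_all
      have "\<forall>u\<in>{1..n}. a2 5 0 u = (if u \<le> v' 5 + 1 then u else 0)"
        using inv' unfolding 2(3) by auto
      then show "wp C (2 * n) (Sb 15 15 1) ?Q (t2, v2, a2)"
        using inv' 2(1,2,4,6) v2 pos unfolding init_inv_def prod.case by (simp add: frame_def)
    qed
    then show "wp C (2 * n) (Ad 5 5 1 ;; Mov 6 5 ;; move ;; Sb 15 15 1) ?Q (t' + 1, v', a')"
      using v1 by (simp add: fun_upd_twist ac_simps)
  next
    fix t' v' a'
    assume "init_inv (t + 280 * n + 2) (t', v', a')" "v' 15 \<le> 0"
    then show "Q (t' + 2, v', a')"
      unfolding init_inv_def by (intro Q) auto
  qed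
  moreover have "v 2 = n" using fr by (simp add: frame_def)
  ultimately show ?thesis unfolding init_clusters_def by (simp add: fun_upd_twist ac_simps)
qed

text \<open>The member list \<open>M\<close> of the dissolving label can be read while its vertices
  leave, because a move writes only to the list of the target.\<close>

definition move_all_inv :: "int set \<Rightarrow> int \<Rightarrow> int \<Rightarrow> (int \<Rightarrow> int) \<Rightarrow> (int \<Rightarrow> int) \<Rightarrow> int \<Rightarrow> int \<Rightarrow> int \<Rightarrow>
    state \<Rightarrow> bool" where
  "move_all_inv D a b L M Z sp T = (\<lambda>(t, v, ar). frame v ar \<and> consistent (insert a D) (v 4) ar \<and>
     v 16 = a \<and> v 6 = b \<and> v 17 = Z - v 15 \<and> 0 \<le> v 15 \<and> v 15 \<le> Z \<and> ar 7 a = M \<and>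
     ar 5 0 = (\<lambda>u. if u \<in> M ` {0..<v 17} then b else L u) \<and> v 4 \<le> sp + 4 * v 17 \<and> t + 280 * v 15 \<le> T)"

lemma move_all_correct:
  fixes t :: int and v :: "nat \<Rightarrow> int" and ar :: arrays
  assumes fr: "frame v ar" and con: "consistent (insert (v 16) D) (v 4) ar"
    and mem: "members_ok n D (ar 5 0) (ar 7) (ar 8 0)"
    and a: "v 16 \<notin> D" "v 16 \<in> {1..n}" and b: "v 6 \<notin> D" "v 6 \<in> {1..n}" and ab: "v 16 \<noteq> v 6"
    and v12: "v 12 = ar 8 0 (v 16)" and sp: "v 4 + 4 * n \<le> C"
    and Q: "\<And>t' v' a'. frame v' a' \<Longrightarrow> consistent (insert (v 16) D) (v' 4) a' \<Longrightarrow>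
      a' 5 0 = relabel n (v 16) (v 6) (ar 5 0) \<Longrightarrow> v' 4 \<le> v 4 + 4 * int (card (cluster n (ar 5 0) (v 16))) \<Longrightarrow>
      t' \<le> t + 280 * int (card (cluster n (ar 5 0) (v 16))) + 4 \<Longrightarrow> Q (t', v', a')"
  shows "wp C (2 * n) move_all Q (t, v, ar)"
proof -
  define a b where "a = v 16" and "b = v 6"
  define L M Z where "L = ar 5 0" and "M = ar 7 a" and "Z = ar 8 0 a"
  define A where "A = cluster n L a"
  have Z: "Z = int (card A)" and inj: "inj_on M {0..<Z}" and MA: "M ` {0..<Z} = A"
    using mem a(1) unfolding members_ok_def Z_def M_def L_def a_def A_def by blast+
  have Zn: "Z \<le> n" using card_cluster_le[of n L a] n unfolding Z A_def by simp
  let ?I = "move_all_inv D a b L M Z (v 4) (t + 280 * Z + 2)"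
  let ?body = "Rd 5 7 16 17 ;; move ;; Ad 17 17 1 ;; Sb 15 15 1"
  have "wp C (2 * n) (WhileP 15 ?body) Q (t + 2, v(15 := Z, 17 := 0), ar)"
  proof (rule wp_While[where I = ?I and bd = "t + 280 * Z + 2"])
    show "?I (t + 2, v(15 := Z, 17 := 0), ar)"
      using fr con Z unfolding move_all_inv_def prod.case
      by (auto simp: frame_def a_def b_def L_def M_def)
  next
    fix t' v' a'
    assume "?I (t', v', a')"
    then show "t' \<le> t + 280 * Z + 2" unfolding move_all_inv_def by auto
  next
    fix t' v' a'
    assume inv: "?I (t', v', a')" and pos: "0 < v' 15"
    note inv' = inv[unfolded move_all_inv_def prod.case]
    define k where "k = v' 17"
    have k: "0 \<le> k" "k < Z" using inv' pos unfolding k_def by auto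
    have MkA: "M k \<in> A" using MA k by auto
    then have Mk: "M k \<in> {1..n}" "L (M k) = a" unfolding A_def cluster_def by auto
    \<comment> \<open>The list has no repetitions, so its member number \<open>k\<close> has not
      been moved yet and still has the label \<open>a\<close>.\<close>
    have notin: "M k \<notin> M ` {0..<k}" using inj k unfolding inj_on_def by force
    have "v' 4 \<le> v 4 + 4 * (n - 1)" using inv' k Zn unfolding k_def by auto
    then have sp': "v' 4 + 4 \<le> C" using sp by simp
    have one: "v' (Suc 0) = 1" using inv' by (simp add: frame_def)
    let ?v = "v'(5 := M k)"
    have upto: "{0..<k + 1} = insert k {0..<k}" using k by auto
    let ?Q = "\<lambda>(t', v', a'). ?I (t' + 1, v', a')"
    have "wp C (2 * n) move (wp C (2 * n) (Ad 17 17 1 ;; Sb 15 15 1) ?Q) (t' + 6, ?v, a')"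
    proof (rule move_correct[where D = "insert a D"])
      show "frame ?v a'" using inv' by (simp add: frame_def)
      show "consistent (insert a D) (?v 4) a'" using inv' by simp
      show "?v 5 \<in> {1..n}" using Mk by simp
      show "?v 6 \<in> {1..n}" "?v 6 \<notin> insert a D" using inv' b ab unfolding a_def b_def by auto
      show "a' 5 0 (?v 5) \<in> insert a D" using inv' Mk notin unfolding k_def by simp
      show "?v 4 + 4 \<le> C" using sp' by simp
      fix t2 v2 a2
      assume 2: "frame v2 a2" "consistent (insert a D) (v2 4) a2" "a2 5 0 = (a' 5 0)(?v 5 := ?v 6)"
        "\<And>x. x \<noteq> ?v 6 \<Longrightarrow> a2 7 x = a' 7 x \<and> a2 8 0 x = a' 8 0 x"
        "v2 4 \<le> ?v 4 + 4" "\<And>x. x \<notin> {4, 7, 8, 9, 10, 11, 12, 13, 14} \<Longrightarrow> v2 x = ?v x" "t2 \<le> t' + 6 + 270"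
      have v2: "v2 6 = b" "v2 15 = v' 15" "v2 16 = a" "v2 17 = k" using 2(6) inv' by (simp_all add: k_def)
      have "a2 5 0 = (\<lambda>u. if u \<in> M ` {0..<k + 1} then b else L u)"
        using inv' unfolding 2(3) upto k_def[symmetric] by (auto simp: fun_eq_iff)
      moreover have "a2 7 a = M" using 2(4)[of a] inv' ab unfolding a_def b_def by simp
      ultimately show "wp C (2 * n) (Ad 17 17 1 ;; Sb 15 15 1) ?Q (t2, v2, a2)"
        using inv' 2(1,2,5,7) v2 pos k unfolding move_all_inv_def prod.case k_def[symmetric]
        by (simp add: frame_def)
    qed
    moreover have "in_bounds C (2 * n) 7 (v' 16) (v' 17)"
      using inv' a k Zn C_bounds n unfolding in_bounds_def a_def[symmetric] k_def by auto
    moreover have "a' 7 (v' 16) (v' 17) = M k" using inv' by (simp add: k_def)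
    ultimately show "wp C (2 * n) ?body ?Q (t' + 1, v', a')"
      by (simp add: ac_simps)
  next
    fix t' v' a'
    assume inv: "?I (t', v', a')" and "v' 15 \<le> 0"
    note inv' = inv[unfolded move_all_inv_def prod.case]
    have v': "v' 15 = 0" "v' 17 = Z" using inv' \<open>v' 15 \<le> 0\<close> by auto
    have "a' 5 0 = relabel n a b L"
      using inv' MA v' unfolding relabel_def A_def by simp
    then show "Q (t' + 2, v', a')"
      using inv' v' Z by (intro Q) (auto simp: a_def b_def L_def A_def)
  qed
  then show ?thesis unfolding move_all_def using v12 by (simp add: Z_def a_def ac_simps)
qed

end

section \<open>The stack of candidate pairs\<close>

text \<open>The top entry may go for two reasons: it fails the recheck, or one of its labels is
  exempted by \<open>D'\<close>. The second is the case of a pair that is about to be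
  merged.\<close>

lemma stack_ok_pop:
  assumes ok: "stack_ok n tau D L W SA SB sp" and D: "D \<subseteq> D'" and sp: "0 < sp"
    and sym: "\<forall>x y. x \<noteq> y \<longrightarrow> W x y = W y x"
    and top: "L (SA (sp - 1)) = L (SB (sp - 1)) \<or> W (L (SA (sp - 1))) (L (SB (sp - 1))) < tau \<or>
      L (SA (sp - 1)) \<in> D' \<or> L (SB (sp - 1)) \<in> D'"
  shows "stack_ok n tau D' L W SA SB (sp - 1)"
proof -
  have "\<exists>i\<in>{0..<sp - 1}. L (SA i) = x \<and> L (SB i) = y \<or> L (SA i) = y \<and> L (SB i) = x"
    if h: "x \<notin> D'" "y \<notin> D'" "x \<noteq> y" "tau \<le> W x y" for x y
  proof -
    obtain i where i: "i \<in> {0..<sp}" "L (SA i) = x \<and> L (SB i) = y \<or> L (SA i) = y \<and> L (SB i) = x"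
      using ok h D unfolding stack_ok_def by (meson subsetD)
    have "tau \<le> W y x" using sym h(3,4) by simp
    then have "i \<noteq> sp - 1" using top h i(2) by auto
    then show ?thesis using i by (intro bexI[of _ i]) auto
  qed
  then show ?thesis using ok sp unfolding stack_ok_def by auto
qed

lemma log_le_self: "1 \<le> n \<Longrightarrow> log 2 (real_of_int n) \<le> n"
proof -
  assume n: "1 \<le> n"
  have "real (nat n) < 2 ^ nat n" by (rule of_nat_less_two_power)
  then have "log 2 (real (nat n)) \<le> log 2 (2 ^ nat n)" using n by (intro log_mono) auto
  then show ?thesis using n by (simp add: log_nat_power)
qed

text \<open>\<open>good\<close> stands for producibility of the part of the assembly at a set of
  vertices; these two closure properties are all that the machine's correctness needs of it.\<close>

locale merging = weighted_graph +
  fixes good :: "int set \<Rightarrow> bool"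
  assumes good_single: "v \<in> {1..n} \<Longrightarrow> good {v}"
    and good_merge: "x \<noteq> y \<Longrightarrow> good (cluster n L x) \<Longrightarrow> good (cluster n L y) \<Longrightarrow> tau \<le> weight L x y \<Longrightarrow>
      good (cluster n L x \<union> cluster n L y)"
begin

text \<open>The height bound counts pushes, four per move: \<open>n\<close> moves for
  initialisation, and since then at most as many as the potential has grown.\<close>

definition state_ok :: "(nat \<Rightarrow> int) \<Rightarrow> arrays \<Rightarrow> bool" where
  "state_ok v a \<longleftrightarrow> frame v a \<and> consistent (- (a 5 0 ` {1..n})) (v 4) a \<and>
     (\<forall>u\<in>{1..n}. a 5 0 u \<in> {1..n}) \<and> (\<forall>x\<in>a 5 0 ` {1..n}. good (cluster n (a 5 0) x)) \<and>
     v 4 \<le> 4 * n + 4 * potential n (a 5 0)"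

text \<open>The crude estimate \<open>log 2 n \<le> n\<close> is enough because \<open>C\<close> is
  quadratic.\<close>

lemma stack_bound:
  assumes "real_of_int sp \<le> 4 * n + 4 * potential n L"
  shows "sp + 4 * n + 4 \<le> C"
proof -
  have "real_of_int n * log 2 n \<le> real_of_int n * n"
    using log_le_self[OF n] n by (intro mult_left_mono) auto
  with assms potential_le[OF n, of L] have "real_of_int sp \<le> 4 * real_of_int n + 4 * (real_of_int n * n)"
    by simp
  then have "real_of_int sp \<le> real_of_int (4 * n + 4 * (n * n))" by simp
  then have "sp \<le> 4 * n + 4 * (n * n)" by linarith
  then show ?thesis using C_bounds(3) unfolding mult.assoc by linarith
qed

text \<open>The number \<open>m\<close> of moved vertices is handed to \<open>Q\<close>: time and
  pushes are proportional to it, and the gain in potential pays for both.\<close>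

lemma merge_ordered:
  fixes t :: int and v :: "nat \<Rightarrow> int" and ar :: arrays
  defines "L \<equiv> ar 5 0"
  assumes fr: "frame v ar" and con: "consistent (insert (v 16) (- (L ` {1..n}))) (v 4) ar"
    and mem: "members_ok n (- (L ` {1..n})) L (ar 7) (ar 8 0)"
    and lab: "\<forall>u\<in>{1..n}. L u \<in> {1..n}" and good: "\<forall>x\<in>L ` {1..n}. good (cluster n L x)"
    and a: "v 16 \<in> L ` {1..n}" and b: "v 6 \<in> L ` {1..n}" and ab: "v 16 \<noteq> v 6"
    and v12: "v 12 = ar 8 0 (v 16)" and le: "ar 8 0 (v 16) \<le> ar 8 0 (v 6)"
    and sp: "v 4 \<le> 4 * n + 4 * potential n L" and wt: "tau \<le> weight L (v 16) (v 6)"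
    and Q: "\<And>t' v' a' m. state_ok v' a' \<Longrightarrow> 1 \<le> m \<Longrightarrow> v' 4 \<le> v 4 + 4 * int m \<Longrightarrow>
      t' \<le> t + 280 * int m + 4 \<Longrightarrow> potential n L + m \<le> potential n (a' 5 0) \<Longrightarrow> Q (t', v', a')"
  shows "wp C (2 * n) move_all Q (t, v, ar)"
proof (rule move_all_correct[where D = "- (L ` {1..n})"])
  define a b where "a = v 16" and "b = v 6"
  define L' where "L' = relabel n a b L"
  note ab' = ab[folded a_def b_def]
  show "frame v ar" by fact
  show "consistent (insert (v 16) (- (L ` {1..n}))) (v 4) ar" by fact
  show "members_ok n (- (L ` {1..n})) (ar 5 0) (ar 7) (ar 8 0)" using mem by (simp add: L_def)
  show "v 16 \<notin> - (L ` {1..n})" "v 6 \<notin> - (L ` {1..n})" using a b by auto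
  show "v 16 \<in> {1..n}" "v 6 \<in> {1..n}" using a b lab by auto
  show "v 16 \<noteq> v 6" "v 12 = ar 8 0 (v 16)" by fact+
  show "v 4 + 4 * n \<le> C" using stack_bound[OF sp] by simp
  fix t' v' a'
  assume 1: "frame v' a'" "consistent (insert (v 16) (- (L ` {1..n}))) (v' 4) a'"
    "a' 5 0 = relabel n (v 16) (v 6) (ar 5 0)"
    "v' 4 \<le> v 4 + 4 * int (card (cluster n (ar 5 0) (v 16)))"
    "t' \<le> t + 280 * int (card (cluster n (ar 5 0) (v 16))) + 4"
  define m where "m = card (cluster n L a)"
  have L': "a' 5 0 = L'" using 1(3) by (simp add: L'_def L_def a_def b_def)
  have card: "card (cluster n L a) \<le> card (cluster n L b)"
    using mem le a b unfolding members_ok_def a_def b_def by auto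
  have pot: "potential n L + m \<le> potential n L'"
    unfolding m_def L'_def by (rule potential_relabel[OF ab' card])
  have m: "1 \<le> m"
  proof -
    obtain u where "u \<in> {1..n}" "a = L u" using a unfolding a_def by auto
    then show ?thesis using card_cluster_pos[of u n L] by (simp add: m_def)
  qed
  have range: "L' ` {1..n} = L ` {1..n} - {a}"
  proof -
    have L'v: "L' v = (if L v = a then b else L v)" if "v \<in> {1..n}" for v
      using that by (simp add: L'_def relabel_def cluster_def)
    have "b \<in> L ` {1..n} - {a}" using b ab' unfolding b_def by simp
    then have "L' ` {1..n} \<subseteq> L ` {1..n} - {a}" using L'v by auto
    moreover have "L v \<in> L' ` {1..n}" if "v \<in> {1..n}" "L v \<noteq> a" for v
      using L'v[OF that(1)] that by (metis imageI)
    ultimately show ?thesis by blast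
  qed
  have "good (cluster n L' x)" if "x \<in> L' ` {1..n}" for x
  proof (cases "x = b")
    case True
    have "good (cluster n L a \<union> cluster n L b)"
      using good a b wt ab' unfolding a_def b_def by (intro good_merge) auto
    with True show ?thesis unfolding L'_def cluster_relabel[OF ab'] by simp
  next
    case False
    have "x \<in> L ` {1..n}" "x \<noteq> a" using that unfolding range by auto
    with good have "good (cluster n L x)" by blast
    with False \<open>x \<noteq> a\<close> show ?thesis by (simp add: L'_def cluster_relabel[OF ab'])
  qed
  moreover have "consistent (- (L' ` {1..n})) (v' 4) a'"
  proof -
    have "- (L' ` {1..n}) = insert a (- (L ` {1..n}))"
      unfolding range using a unfolding a_def by auto
    with 1(2) show ?thesis by (simp add: a_def)
  qed
  moreover have "\<forall>u\<in>{1..n}. L' u \<in> {1..n}"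
  proof
    fix u assume "u \<in> {1..n}"
    then have "L' u \<in> L ` {1..n}" using range by blast
    then show "L' u \<in> {1..n}" using lab by auto
  qed
  moreover have "v' 4 \<le> v 4 + 4 * int m" using 1(4) by (simp add: m_def L_def a_def)
  moreover from this have "real_of_int (v' 4) \<le> v 4 + 4 * real m"
    by linarith
  then have "v' 4 \<le> 4 * n + 4 * potential n L'" using sp pot by simp
  ultimately show "Q (t', v', a')"
    using 1(1,5) pot m by (intro Q[where m = m]) (auto simp: state_ok_def L' m_def L_def a_def)
qed

text \<open>Consistency is assumed with either label exempted, since only the comparison of sizes at
  run time decides which cluster is dissolved.\<close>

lemma merge_correct:
  fixes t :: int and v :: "nat \<Rightarrow> int" and ar :: arrays
  defines "L \<equiv> ar 5 0"
  defines "D \<equiv> - (L ` {1..n})"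
  assumes fr: "frame v ar" and con: "consistent (insert (v 16) D) (v 4) ar" "consistent (insert (v 6) D) (v 4) ar"
    and mem: "members_ok n D L (ar 7) (ar 8 0)"
    and lab: "\<forall>u\<in>{1..n}. L u \<in> {1..n}" and good: "\<forall>x\<in>L ` {1..n}. good (cluster n L x)"
    and a: "v 16 \<in> L ` {1..n}" and b: "v 6 \<in> L ` {1..n}" and ab: "v 16 \<noteq> v 6"
    and sp: "v 4 \<le> 4 * n + 4 * potential n L" and wt: "tau \<le> weight L (v 16) (v 6)"
    and Q: "\<And>t' v' a' m. state_ok v' a' \<Longrightarrow> 1 \<le> m \<Longrightarrow> v' 4 \<le> v 4 + 4 * int m \<Longrightarrow>
      t' \<le> t + 280 * int m + 30 \<Longrightarrow> potential n L + m \<le> potential n (a' 5 0) \<Longrightarrow> Q (t', v', a')"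
  shows "wp C (2 * n) merge Q (t, v, ar)"
proof -
  let ?v = "v(12 := ar 8 0 (v 16), 13 := ar 8 0 (v 6), 14 := ar 8 0 (v 16) - ar 8 0 (v 6))"
  let ?v' = "?v(14 := v 16, 16 := v 6, 6 := v 16, 12 := ar 8 0 (v 6))"
  have "v 16 \<in> {1..n}" "v 6 \<in> {1..n}" using a b lab by auto
  then have bds: "in_bounds C (2 * n) 8 (v 0) (v 16)" "in_bounds C (2 * n) 8 (v 0) (v 6)"
    using C_bounds n fr unfolding in_bounds_def frame_def by auto
  have v0: "v 0 = 0" using fr by (simp add: frame_def)
  have 1: "wp C (2 * n) move_all Q (t + 16, ?v', ar)" if "ar 8 0 (v 6) < ar 8 0 (v 16)"
  proof (rule merge_ordered)
    show "frame ?v' ar" using fr by (simp add: frame_def)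
    show "tau \<le> weight (ar 5 0) (?v' 16) (?v' 6)"
      using wt weight_commute[of "ar 5 0"] by (simp add: L_def)
    fix t' v' a' and m :: nat
    assume "state_ok v' a'" "1 \<le> m" "v' 4 \<le> ?v' 4 + 4 * int m" "t' \<le> t + 16 + 280 * int m + 4"
      "potential n (ar 5 0) + m \<le> potential n (a' 5 0)"
    then show "Q (t', v', a')" by (intro Q[of _ _ m]) (auto simp: L_def)
  qed (use assms that in \<open>simp_all add: D_def\<close>)
  have 2: "wp C (2 * n) move_all (\<lambda>s. Q s) (t + 13, ?v, ar)" if "\<not> ar 8 0 (v 6) < ar 8 0 (v 16)"
  proof (rule merge_ordered)
    show "frame ?v ar" using fr by (simp add: frame_def)
    fix t' v' a' and m :: nat
    assume "state_ok v' a'" "1 \<le> m" "v' 4 \<le> ?v 4 + 4 * int m" "t' \<le> t + 13 + 280 * int m + 4"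
      "potential n (ar 5 0) + m \<le> potential n (a' 5 0)"
    then show "Q (t', v', a')" by (intro Q[of _ _ m]) (auto simp: L_def)
  qed (use assms that in \<open>simp_all add: D_def\<close>)
  show ?thesis
    unfolding merge_def using 1 2 bds v0 by (simp add: ac_simps)
qed

text \<open>The amortised clock: elapsed time plus 60 ticks for each entry still on the stack, paid
  by the growth of the potential.\<close>

definition pop_inv :: "real \<Rightarrow> state \<Rightarrow> bool" where
  "pop_inv T = (\<lambda>(t, v, a). state_ok v a \<and> t + 60 * v 4 \<le> T + 600 * potential n (a 5 0))"

lemma pop_step_correct:
  assumes inv: "pop_inv T (t, v, a)" and pos: "0 < v 4"
  shows "wp C (2 * n) pop_step (\<lambda>(t, v, a). pop_inv T (t + 1, v, a)) (t + 1, v, a)"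
proof -
  define i where "i = v 4 - 1"
  define L where "L = a 5 0"
  define D where "D = - (L ` {1..n})"
  define x where "x = L (a 9 0 i)"
  define y where "y = L (a 10 0 i)"
  note inv' = inv[unfolded pop_inv_def state_ok_def prod.case, folded L_def, folded D_def]
  have con: "consistent D (v 4) a" and fr: "frame v a" using inv' by auto
  note con' = con[unfolded consistent_def, folded L_def]
  have st: "stack_ok n tau D L (a 6) (a 9 0) (a 10 0) (v 4)" using con' by blast
  have i: "0 \<le> i" "i < v 4" using pos by (auto simp: i_def)
  have pq: "a 9 0 i \<in> {1..n}" "a 10 0 i \<in> {1..n}" using st i unfolding stack_ok_def by auto
  have xy: "x \<in> L ` {1..n}" "y \<in> L ` {1..n}" using pq unfolding x_def y_def by auto
  have xyn: "x \<in> {1..n}" "y \<in> {1..n}" using xy inv' by auto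
  have spC: "v 4 + 4 * n + 4 \<le> C" using inv' by (intro stack_bound[of _ L]) auto
  have vals: "v 0 = 0" "v (Suc 0) = 1" "v 3 = tau" using fr by (auto simp: frame_def)
  \<comment> \<open>\<open>D'\<close> is \<open>D\<close> for a discarded pair. For a merge it is
    \<open>insert x D\<close> or \<open>insert y D\<close>, which excuses the popped pair from being
    covered.\<close>
  have pop: "consistent D' i a" if "D \<subseteq> D'" "x = y \<or> a 6 x y < tau \<or> x \<in> D' \<or> y \<in> D'" for D'
    using con' that stack_ok_pop[OF st that(1) pos] members_ok_antimono[OF _ that(1)]
    unfolding consistent_def L_def[symmetric] x_def y_def i_def by blast
  let ?w = "v(4 := i, 9 := a 10 0 i, 16 := x, 6 := y, 12 := a 6 x y, 14 := a 6 x y - tau + 1)"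
  have keep: "pop_inv T (t', v', a)"
    if "x = y \<or> a 6 x y < tau" "frame v' a" "v' 4 = i" "t' \<le> t + 50" for t' v'
    using inv' pop[of D] that unfolding pop_inv_def state_ok_def prod.case L_def[symmetric] D_def[symmetric]
    by (auto simp: i_def)
  have merge: "wp C (2 * n) merge (\<lambda>(t, v, a). pop_inv T (2 + t, v, a)) (32 + t, ?w, a)"
    if "x \<noteq> y" "tau \<le> a 6 x y"
  proof (rule merge_correct)
    show "frame ?w a" using fr by (simp add: frame_def)
    show "consistent (insert (?w 16) (- (a 5 0 ` {1..n}))) (?w 4) a"
      "consistent (insert (?w 6) (- (a 5 0 ` {1..n}))) (?w 4) a"
      using pop[of "insert x D"] pop[of "insert y D"] by (auto simp: D_def L_def)
    have "a 6 x y = weight L x y" using con' xy that(1) unfolding D_def by auto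
    then show "tau \<le> weight (a 5 0) (?w 16) (?w 6)" using that(2) by (simp add: L_def)
    show "real_of_int (?w 4) \<le> 4 * n + 4 * potential n (a 5 0)" using inv' i by (simp add: L_def)
    fix t' v' a' and m :: nat
    assume 1: "state_ok v' a'" "1 \<le> m" "v' 4 \<le> ?w 4 + 4 * int m" "t' \<le> 32 + t + 280 * int m + 30"
      "potential n (a 5 0) + m \<le> potential n (a' 5 0)"
    \<comment> \<open>At most \<open>280 * m + 64\<close> ticks and \<open>240 * m\<close> for new
      entries, less 60 for the popped one: \<open>520 * m + 4\<close>, which is below
      \<open>600 * m\<close> as \<open>m\<close> is positive.\<close>
    have "t' + 2 + 60 * v' 4 \<le> t + 60 * v 4 + 600 * int m" using 1(2-4) by (simp add: i_def)
    then have "real_of_int (t' + 2 + 60 * v' 4) \<le> real_of_int (t + 60 * v 4 + 600 * int m)"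
      by (simp only: of_int_le_iff)
    then show "case (t', v', a') of (t, v, a) \<Rightarrow> pop_inv T (2 + t, v, a)"
      using inv' 1(1,5) unfolding pop_inv_def prod.case L_def by simp
  qed (use inv' con' xy that(1) in \<open>auto simp: D_def L_def\<close>)
  have bds: "in_bounds C (2 * n) 9 0 i" "in_bounds C (2 * n) 10 0 i" "in_bounds C (2 * n) 5 0 (a 9 0 i)"
    "in_bounds C (2 * n) 5 0 (a 10 0 i)" "in_bounds C (2 * n) 6 x y"
    using i spC pq xyn n C_bounds unfolding in_bounds_def by auto
  have "pop_inv T (25 + t, v(4 := i, 9 := a 10 0 i, 16 := y, 6 := y, 14 := 0), a)" if "x = y"
    using that fr by (intro keep) (auto simp: frame_def)
  moreover have "pop_inv T (35 + t, ?w, a)" if "\<not> tau \<le> a 6 x y"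
    using that fr by (intro keep) (auto simp: frame_def)
  ultimately show ?thesis
    unfolding pop_step_def using bds merge
    by (simp add: vals i_def[symmetric] L_def[symmetric] x_def[symmetric] y_def[symmetric])
qed

theorem merge_clusters_correct:
  fixes t :: int and v :: "nat \<Rightarrow> int" and a :: arrays
  assumes fr: "frame v a" and zero: "\<forall>u. a 5 0 u = 0" "\<forall>x y. a 6 x y = 0" "\<forall>x. a 8 0 x = 0"
    and Q: "\<And>t' v' a' L. t' \<le> t + 520 * n + 600 * (n * log 2 n) + 50 \<Longrightarrow>
      (\<forall>x\<in>L ` {1..n}. good (cluster n L x)) \<Longrightarrow>
      (\<forall>x\<in>L ` {1..n}. \<forall>y\<in>L ` {1..n}. x \<noteq> y \<longrightarrow> weight L x y < tau) \<Longrightarrow>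
      v' 19 = (if cluster n L (L 1) = {1..n} then 1 else 0) \<Longrightarrow> Q (t', v', a')"
  shows "wp C (2 * n) merge_clusters Q (t, v, a)"
proof -
  \<comment> \<open>The clock after initialisation is at most \<open>t + 280 * n + 5\<close>, and up
    to \<open>4 * n\<close> entries need 60 ticks each.\<close>
  define T where "T = t + 280 * n + 5 + 240 * n"
  \<comment> \<open>All vertices have the exempted label 0, so every other cluster is empty and
    zeroed memory describes it correctly.\<close>
  have con: "consistent {0} 0 a"
  proof -
    have "cluster n (a 5 0) x = {}" if "x \<noteq> 0" for x using zero(1) that by (auto simp: cluster_def)
    then show ?thesis
      using zero n tau unfolding consistent_def members_ok_def stack_ok_def label_weight_def by auto
  qed
  let ?Q = "wp C (2 * n) report Q"
  have loop: "wp C (2 * n) (WhileP 4 pop_step) ?Q (t', v', a')"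
    if 1: "frame v' a'" "consistent {0} (v' 4) a'" "\<forall>u\<in>{1..n}. a' 5 0 u = u"
      "v' 4 \<le> 4 * n" "t' \<le> t + 1 + 280 * n + 4" for t' v' a'
  \<comment> \<open>The deadline is real and the clock an integer, hence the floor.\<close>
  proof (rule wp_While[where I = "pop_inv T" and bd = "\<lfloor>T + 600 * (n * log 2 n)\<rfloor>"])
    define L where "L = a' 5 0"
    have img: "L ` {1..n} = {1..n}" using 1(3) unfolding L_def by (simp add: image_def)
    have cl: "cluster n L u = {u}" if "u \<in> {1..n}" for u
      using 1(3) that unfolding L_def cluster_def by auto
    have con': "consistent (- {1..n}) (v' 4) a'"
      using 1(2) members_ok_antimono[of n "{0}" _ _ _ "- {1..n}"] stack_ok_antimono[of n tau "{0}" _ _ _ _ _ "- {1..n}"]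
      unfolding consistent_def by auto
    have "potential n L = 0" unfolding potential_def using cl 1(3) by (simp add: L_def)
    then show "pop_inv T (t', v', a')"
      using 1 con' img cl good_single unfolding pop_inv_def state_ok_def prod.case L_def[symmetric] T_def
      by auto
  next
    fix t2 v2 a2
    assume "pop_inv T (t2, v2, a2)"
    then have "real_of_int t2 + 60 * v2 4 \<le> T + 600 * potential n (a2 5 0)" "0 \<le> v2 4"
      unfolding pop_inv_def state_ok_def consistent_def stack_ok_def by auto
    then have "real_of_int t2 \<le> T + 600 * (n * log 2 n)" using potential_le[OF n, of "a2 5 0"] by simp
    then show "t2 \<le> \<lfloor>T + 600 * (n * log 2 n)\<rfloor>" by (simp only: le_floor_iff)
  next
    fix t2 v2 a2
    assume "pop_inv T (t2, v2, a2)" "0 < v2 4"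
    then show "wp C (2 * n) pop_step (\<lambda>(t, v, a). pop_inv T (t + 1, v, a)) (t2 + 1, v2, a2)"
      by (rule pop_step_correct)
  next
    fix t2 v2 a2
    assume inv: "pop_inv T (t2, v2, a2)" and "v2 4 \<le> 0"
    define L where "L = a2 5 0"
    define D where "D = - (L ` {1..n})"
    note inv' = inv[unfolded pop_inv_def state_ok_def prod.case, folded L_def, folded D_def]
    note con' = inv'[THEN conjunct1, THEN conjunct2, THEN conjunct1, unfolded consistent_def, folded L_def]
    have sp: "v2 4 = 0" using con' \<open>v2 4 \<le> 0\<close> unfolding stack_ok_def by auto
    \<comment> \<open>With an empty stack, coverage says that no two clusters in use are joined by
      strength \<open>tau\<close>.\<close>
    have low: "weight L x y < tau" if "x \<in> L ` {1..n}" "y \<in> L ` {1..n}" "x \<noteq> y" for x y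
    proof -
      have "x \<notin> D" "y \<notin> D" using that unfolding D_def by auto
      moreover from this have "a2 6 x y = weight L x y" using con' that(3) by blast
      ultimately show ?thesis using con' that(3) sp unfolding stack_ok_def by fastforce
    qed
    have L1: "L 1 \<in> {1..n}" using inv' n by auto
    have Z: "a2 8 0 (L 1) = int (card (cluster n L (L 1)))"
      using con' n unfolding members_ok_def D_def by auto
    have full: "card (cluster n L (L 1)) = nat n \<longleftrightarrow> cluster n L (L 1) = {1..n}"
    proof
      assume "card (cluster n L (L 1)) = nat n"
      then show "cluster n L (L 1) = {1..n}" by (intro card_subset_eq cluster_subset) simp_all
    qed simp
    have eq: "n = a2 8 0 (L 1) \<longleftrightarrow> cluster n L (L 1) = {1..n}"
      unfolding Z full[symmetric] using n by auto
    have time: "t2 + 20 \<le> t + 520 * n + 600 * (n * log 2 n) + 50"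
      using inv' sp potential_le[OF n, of L] unfolding T_def by simp
    have "in_bounds C (2 * n) 5 0 1" "in_bounds C (2 * n) 8 0 (L 1)"
      using L1 n C_bounds unfolding in_bounds_def by auto
    moreover have "v2 0 = 0" "v2 2 = n" using inv' by (auto simp: frame_def)
    moreover have "Q (t3, w, a2)"
      if "t3 \<le> t2 + 20" "w 19 = (if cluster n L (L 1) = {1..n} then 1 else 0)" for t3 w
    proof (rule Q[of _ L])
      have "real_of_int t3 \<le> t2 + 20" using that(1) by linarith
      then show "real_of_int t3 \<le> t + 520 * n + 600 * (n * log 2 n) + 50" using time by linarith
    qed (use inv' low that(2) in blast)+
    ultimately show "wp C (2 * n) report Q (t2 + 2, v2, a2)"
      unfolding report_def using eq by (simp add: L_def[symmetric])
  qed
  have "wp C (2 * n) init_clusters (wp C (2 * n) (WhileP 4 pop_step) ?Q) (t + 1, v(4 := 0), a)"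
    by (rule init_clusters_correct) (use fr con zero(1) loop in \<open>auto simp: frame_def\<close>)
  moreover have "wp C (2 * n) (WhileP 4 pop_step ;; report) Q = wp C (2 * n) (WhileP 4 pop_step) ?Q"
    by (rule ext) simp
  ultimately show ?thesis unfolding merge_clusters_def by simp
qed

end

section \<open>Reading the assembly\<close>

text \<open>
  Variable \<open>20\<close> holds the address of the current tile in the input, \<open>21\<close> and \<open>22\<close> the origin that
  makes all coordinates lie strictly between \<open>0\<close> and \<open>2 * n\<close> (the assembly is connected), and \<open>24\<close>
  and \<open>25\<close> the coordinates relative to it. Array \<open>2\<close> maps these coordinates to vertices.
\<close>

fun glue_offset :: "direction \<Rightarrow> int" where
  "glue_offset North = 2"
| "glue_offset South = 4"
| "glue_offset East = 6"
| "glue_offset West = 8"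

fun slot :: "direction \<Rightarrow> int" where
  "slot North = 1"
| "slot South = 2"
| "slot East = 3"
| "slot West = 4"

fun shift :: "direction \<Rightarrow> com" where
  "shift North = Mov 27 24 ;; Ad 28 25 1"
| "shift South = Mov 27 24 ;; Sb 28 25 1"
| "shift East = Ad 27 24 1 ;; Mov 28 25"
| "shift West = Sb 27 24 1 ;; Mov 28 25"

text \<open>The tile of vertex \<open>u\<close> (variable \<open>29\<close>) has address \<open>10 * u - 8\<close>.\<close>

definition match_glues :: "direction \<Rightarrow> com" where
  "match_glues d =
     Ad 30 29 29 ;; Ad 31 30 30 ;; Ad 31 31 31 ;; Ad 30 30 31 ;;
     Cst 31 (glue_offset (opposite d) - 8) ;; Ad 30 30 31 ;; Rd 31 0 0 30 ;; Ad 30 30 1 ;; Rd 32 0 0 30 ;;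
     Cst 30 (glue_offset d) ;; Ad 30 30 20 ;; Rd 33 0 0 30 ;; Ad 30 30 1 ;; Rd 34 0 0 30 ;;
     Sb 31 31 33 ;; Sb 32 32 34 ;;
     IfZ 31 (IfZ 32 (Wr 3 5 26 29 ;; Wr 4 5 26 34) Skip) Skip"

text \<open>A slot without a bond becomes a loop of strength \<open>0\<close>.\<close>

definition arc :: "direction \<Rightarrow> com" where
  "arc d = shift d ;; Cst 26 (slot d) ;; Rd 29 2 27 28 ;; Wr 3 5 26 5 ;; Wr 4 5 26 0 ;;
     IfP 29 (match_glues d) Skip"

definition read_position :: com where
  "read_position = Ad 5 5 1 ;; Rd 24 0 0 20 ;; Sb 24 24 21 ;; Ad 25 20 1 ;; Rd 25 0 0 25 ;; Sb 25 25 22"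

definition read_header :: com where
  "read_header = Cst 1 1 ;; Rd 2 0 0 0 ;; Rd 3 0 0 1 ;; Cst 20 2 ;; Rd 21 0 0 20 ;; Sb 21 21 2 ;;
     Ad 22 20 1 ;; Rd 22 0 0 22 ;; Sb 22 22 2 ;; Cst 23 10"

definition tabulate_positions :: com where
  "tabulate_positions = Mov 15 2 ;; Cst 5 0 ;; Cst 20 2 ;;
     WhileP 15 (read_position ;; Wr 2 24 25 5 ;; Ad 20 20 23 ;; Sb 15 15 1)"

definition tabulate_arcs :: com where
  "tabulate_arcs = Mov 15 2 ;; Cst 5 0 ;; Cst 20 2 ;;
     WhileP 15 (read_position ;; arc North ;; arc South ;; arc East ;; arc West ;; Ad 20 20 23 ;; Sb 15 15 1)"

definition decide :: com where
  "decide = read_header ;; tabulate_positions ;; tabulate_arcs ;; merge_clusters"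

section \<open>Numbering of the tiles, and the arcs between them\<close>

lemma slot_bij: "bij_betw slot UNIV {1..4}"
proof -
  have "{1..4::int} = {1, 2, 3, 4}" by auto
  then show ?thesis unfolding bij_betw_def inj_on_def UNIV_direction by auto
qed

lemma slot_range: "1 \<le> slot d" "slot d \<le> 4"
  by (cases d; simp)+

lemma slot_inj: "slot d = slot d' \<longleftrightarrow> d = d'"
  by (cases d; cases d'; simp)

lemma glue_offset_range: "2 \<le> glue_offset d" "glue_offset d \<le> 8"
  by (cases d; simp)+

locale input =
  fixes xs :: "(position \<times> tile_type) list" and \<tau> :: nat
  assumes distinct: "distinct (map fst xs)" and nonempty: "xs \<noteq> []"
    and near: "k < length xs \<Longrightarrow> \<bar>fst (fst (xs ! k)) - fst (fst (xs ! 0))\<bar> < int (length xs)"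
      "k < length xs \<Longrightarrow> \<bar>snd (fst (xs ! k)) - snd (fst (xs ! 0))\<bar> < int (length xs)"
begin

abbreviation "N \<equiv> int (length xs)"
abbreviation "C \<equiv> 12 * N * N + 12"
abbreviation "pos k \<equiv> fst (xs ! k)"
abbreviation "tile k \<equiv> snd (xs ! k)"

definition ox where "ox = fst (pos 0) - N"
definition oy where "oy = snd (pos 0) - N"

text \<open>The value 0 for a free position agrees with what an untouched cell of array 2
  contains.\<close>

definition idx :: "position \<Rightarrow> int" where
  "idx q = (if \<exists>k < length xs. pos k = q then int (THE k. k < length xs \<and> pos k = q) + 1 else 0)"

text \<open>Equal glues of strength 0 match here without interacting; they give an arc of weight 0
  and so change no sum.\<close>

definition matches :: "nat \<Rightarrow> direction \<Rightarrow> bool" where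
  "matches k d \<longleftrightarrow> (let u = idx (neighbour (pos k) d) in
     0 < u \<and> glue_on (tile k) d = glue_on (tile (nat (u - 1))) (opposite d))"

definition target :: "nat \<Rightarrow> direction \<Rightarrow> int" where
  "target k d = (if matches k d then idx (neighbour (pos k) d) else int k + 1)"

definition bond :: "nat \<Rightarrow> direction \<Rightarrow> int" where
  "bond k d = (if matches k d then int (strength (glue_on (tile k) d)) else 0)"

lemma pos_inj: "k < length xs \<Longrightarrow> l < length xs \<Longrightarrow> pos k = pos l \<longleftrightarrow> k = l"
  using nth_eq_iff_index_eq[OF distinct] by simp

lemma idx_pos: "k < length xs \<Longrightarrow> idx (pos k) = int k + 1"
proof -
  assume k: "k < length xs"
  then have "(THE l. l < length xs \<and> pos l = pos k) = k" by (auto simp: pos_inj)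
  with k show ?thesis unfolding idx_def by auto
qed

lemma idx_cases: "idx q = 0 \<and> (\<forall>k < length xs. pos k \<noteq> q) \<or> (\<exists>k < length xs. pos k = q \<and> idx q = int k + 1)"
  using idx_pos by (metis idx_def)

lemma idx_range: "0 \<le> idx q" "idx q \<le> N"
  using idx_cases[of q] by auto

lemma C_bounds: "10 * N + 2 \<le> C" "2 * N < C" "4 < C" "1 \<le> N"
proof -
  have 1: "1 \<le> N" using nonempty by (cases xs) auto
  then have "N * 1 \<le> N * N" by (intro mult_left_mono) auto
  with 1 show "10 * N + 2 \<le> C" "2 * N < C" "4 < C" "1 \<le> N" unfolding mult.assoc by linarith+
qed

definition reads :: "arrays \<Rightarrow> bool" where
  "reads a \<longleftrightarrow> a 0 0 0 = N \<and> a 0 0 1 = int \<tau> \<and>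
     (\<forall>k < length xs. a 0 0 (2 + 10 * int k) = fst (pos k) \<and> a 0 0 (3 + 10 * int k) = snd (pos k) \<and>
       (\<forall>d. a 0 0 (2 + 10 * int k + glue_offset d) = int (label (glue_on (tile k) d)) \<and>
            a 0 0 (3 + 10 * int k + glue_offset d) = int (strength (glue_on (tile k) d))))"

definition constants :: "(nat \<Rightarrow> int) \<Rightarrow> bool" where
  "constants v \<longleftrightarrow> v 0 = 0 \<and> v 1 = 1 \<and> v 2 = N \<and> v 3 = int \<tau> \<and> v 21 = ox \<and> v 22 = oy \<and> v 23 = 10"

text \<open>The margin of 1 on both sides keeps the lookup of a neighbour within the rows
  \<open>0\<close> to \<open>2 * N\<close>.\<close>

lemma coord_range:
  assumes "k < length xs"
  shows "1 \<le> fst (pos k) - ox" "fst (pos k) - ox < 2 * N" "1 \<le> snd (pos k) - oy" "snd (pos k) - oy < 2 * N"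
  using near[OF assms] unfolding ox_def oy_def by linarith+

lemma read_position_wp:
  assumes "constants v" "reads a" "k < length xs" "v 20 = 2 + 10 * int k"
  shows "wp C (2 * N) read_position Q (t, v, a) =
    Q (t + 14, v(5 := v 5 + 1, 24 := fst (pos k) - ox, 25 := snd (pos k) - oy), a)"
proof -
  have "in_bounds C (2 * N) 0 0 (2 + 10 * int k)" "in_bounds C (2 * N) 0 0 (3 + 10 * int k)"
    using C_bounds assms(3) unfolding in_bounds_def by auto
  with assms show ?thesis
    unfolding read_position_def constants_def reads_def by (simp add: fun_upd_twist ac_simps)
qed

lemma shift_wp:
  assumes "v 1 = 1" "v 24 = fst p - ox" "v 25 = snd p - oy"
  shows "wp C (2 * N) (shift d) Q (t, v, a) =
    Q (t + 2, v(27 := fst (neighbour p d) - ox, 28 := snd (neighbour p d) - oy), a)"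
  using assms by (cases d; cases p) (simp_all add: add_diff_eq diff_diff_eq add.commute)

lemma neighbour_range:
  "fst p - 1 \<le> fst (neighbour p d)" "fst (neighbour p d) \<le> fst p + 1"
  "snd p - 1 \<le> snd (neighbour p d)" "snd (neighbour p d) \<le> snd p + 1"
  by (cases p; cases d; simp)+

lemma arc_correct:
  assumes con: "constants v" and rd: "reads a" and k: "k < length xs"
    and v: "v 5 = int k + 1" "v 20 = 2 + 10 * int k" "v 24 = fst (pos k) - ox" "v 25 = snd (pos k) - oy"
    and tab: "\<And>i j. a 2 i j = idx (i + ox, j + oy)"
    and Q: "\<And>t' v'. t' \<le> t + 90 \<Longrightarrow> (\<And>x. x \<notin> {26..34} \<Longrightarrow> v' x = v x) \<Longrightarrow>
      Q (t', v', a(3 := (a 3)(int k + 1 := (a 3 (int k + 1))(slot d := target k d)),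
                   4 := (a 4)(int k + 1 := (a 4 (int k + 1))(slot d := bond k d))))"
  shows "wp C (2 * N) (arc d) Q (t, v, a)"
proof -
  define q where "q = neighbour (pos k) d"
  define u where "u = idx q"
  define l where "l = nat (u - 1)"
  define gk where "gk = glue_on (tile k) d"
  define gl where "gl = glue_on (tile l) (opposite d)"
  let ?a = "\<lambda>x y. a(3 := (a 3)(int k + 1 := (a 3 (int k + 1))(slot d := x)),
                   4 := (a 4)(int k + 1 := (a 4 (int k + 1))(slot d := y)))"
  have vs: "v 0 = 0" "v (Suc 0) = 1" "v 1 = 1" using con by (auto simp: constants_def)
  have sl: "0 \<le> slot d" "slot d < C" using slot_range[of d] C_bounds by auto
  have bd: "in_bounds C (2 * N) 3 (int k + 1) (slot d)" "in_bounds C (2 * N) 4 (int k + 1) (slot d)"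
    using sl k unfolding in_bounds_def by auto
  have b2: "in_bounds C (2 * N) 2 (fst q - ox) (snd q - oy)"
    using coord_range[OF k] neighbour_range[of "pos k" d] C_bounds(2)
    unfolding in_bounds_def q_def[symmetric] by auto
  have u0: "0 \<le> u" using idx_range by (simp add: u_def)
  have tgt: "target k d = (if 0 < u \<and> gk = gl then u else int k + 1)"
    "bond k d = (if 0 < u \<and> gk = gl then int (strength gk) else 0)"
    unfolding target_def bond_def matches_def Let_def
    by (simp_all add: u_def q_def gk_def gl_def l_def)
  let ?v = "v(27 := fst q - ox, 28 := snd q - oy, 26 := slot d, 29 := u)"
  have none: "Q (20 + t, ?v, ?a (int k + 1) 0)" if "\<not> 0 < u"
  proof -
    have "Q (20 + t, ?v, ?a (target k d) (bond k d))" by (rule Q) auto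
    with tgt that show ?thesis by simp
  qed
  have glues: "wp C (2 * N) (match_glues d) Q (19 + t, ?v, ?a (int k + 1) 0)" if "0 < u"
  proof -
    have l: "u = int l + 1" "l < length xs"
      using that idx_range(2)[of q] by (auto simp: l_def u_def)
    have al: "a 0 0 (2 + 10 * int l + glue_offset (opposite d)) = int (label gl)"
      "a 0 0 (3 + 10 * int l + glue_offset (opposite d)) = int (strength gl)"
      using rd l(2) unfolding reads_def gl_def by blast+
    have ak: "a 0 0 (2 + 10 * int k + glue_offset d) = int (label gk)"
      "a 0 0 (3 + 10 * int k + glue_offset d) = int (strength gk)"
      using rd k unfolding reads_def gk_def by blast+
    have bds: "in_bounds C (2 * N) 0 0 (2 + 10 * int l + glue_offset (opposite d))"
      "in_bounds C (2 * N) 0 0 (3 + 10 * int l + glue_offset (opposite d))"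
      "in_bounds C (2 * N) 0 0 (2 + 10 * int k + glue_offset d)"
      "in_bounds C (2 * N) 0 0 (3 + 10 * int k + glue_offset d)"
      using glue_offset_range[of d] glue_offset_range[of "opposite d"] l k C_bounds unfolding in_bounds_def by auto
    \<comment> \<open>The left sides are the forms in which simplification leaves the addresses.
      \<open>match_glues\<close> obtains \<open>10 * u\<close> as \<open>2 * u + 8 * u\<close> by
      doubling.\<close>
    have addr: "10 * u + (glue_offset (opposite d) - 8) = 2 + 10 * int l + glue_offset (opposite d)"
      "10 * u + glue_offset (opposite d) - 7 = 3 + 10 * int l + glue_offset (opposite d)"
      "3 + (10 * int l + glue_offset (opposite d)) = 3 + 10 * int l + glue_offset (opposite d)"
      "glue_offset d + (2 + 10 * int k) = 2 + 10 * int k + glue_offset d"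
      "3 + (10 * int k + glue_offset d) = 3 + 10 * int k + glue_offset d"
      using l by simp_all
    have eq: "gk = gl \<longleftrightarrow> label gl = label gk \<and> strength gl = strength gk"
      by (cases gk; cases gl) auto
    let ?w = "\<lambda>x\<^sub>1 x\<^sub>2 x\<^sub>3 x\<^sub>4 x\<^sub>5. ?v(33 := x\<^sub>1, 30 := x\<^sub>2, 34 := x\<^sub>3, 31 := x\<^sub>4, 32 := x\<^sub>5)"
    have kept: "?w x\<^sub>1 x\<^sub>2 x\<^sub>3 x\<^sub>4 x\<^sub>5 x = v x" if "x \<notin> {26..34}" for x\<^sub>1 x\<^sub>2 x\<^sub>3 x\<^sub>4 x\<^sub>5 x
      using that by auto
    have bond: "Q (t', ?w x\<^sub>1 x\<^sub>2 x\<^sub>3 x\<^sub>4 x\<^sub>5, ?a u (int (strength gk)))"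
      if "label gl = label gk" "strength gl = strength gk" "t' \<le> t + 90" for t' x\<^sub>1 x\<^sub>2 x\<^sub>3 x\<^sub>4 x\<^sub>5
    proof -
      have "Q (t', ?w x\<^sub>1 x\<^sub>2 x\<^sub>3 x\<^sub>4 x\<^sub>5, ?a (target k d) (bond k d))"
        by (rule Q[OF that(3)]) (rule kept)
      moreover have "gk = gl" using that(1,2) eq by blast
      ultimately show ?thesis using tgt \<open>0 < u\<close> by simp
    qed
    have mismatch: "Q (t', ?w x\<^sub>1 x\<^sub>2 x\<^sub>3 x\<^sub>4 x\<^sub>5, ?a (int k + 1) 0)"
      if "label gl \<noteq> label gk \<or> strength gl \<noteq> strength gk" "t' \<le> t + 90" for t' x\<^sub>1 x\<^sub>2 x\<^sub>3 x\<^sub>4 x\<^sub>5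
    proof -
      have "Q (t', ?w x\<^sub>1 x\<^sub>2 x\<^sub>3 x\<^sub>4 x\<^sub>5, ?a (target k d) (bond k d))"
        by (rule Q[OF that(2)]) (rule kept)
      moreover have "gk \<noteq> gl" using that(1) eq by blast
      ultimately show ?thesis using tgt by simp
    qed
    show ?thesis
      unfolding match_glues_def
      using bds bd vs al ak v
      by (simp add: addr) (intro conjI impI; (rule bond | rule mismatch); simp)
  qed
  show ?thesis
    unfolding arc_def
    using bd b2 none glues u0 v vs tab
    by (simp add: shift_wp[of v "pos k"] q_def[symmetric] u_def[symmetric])
qed

definition pos_inv :: "arrays \<Rightarrow> int \<Rightarrow> state \<Rightarrow> bool" where
  "pos_inv a\<^sub>0 T = (\<lambda>(t, v, a). constants v \<and> (\<forall>k. k \<noteq> 2 \<longrightarrow> a k = a\<^sub>0 k) \<and> v 5 = N - v 15 \<and> 0 \<le> v 15 \<and>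
     v 15 \<le> N \<and> v 20 = 2 + 10 * v 5 \<and>
     (\<forall>i j. a 2 i j = (if idx (i + ox, j + oy) \<le> v 5 then idx (i + ox, j + oy) else 0)) \<and> t + 30 * v 15 \<le> T)"

lemma tabulate_positions_correct:
  assumes con: "constants v" and rd: "reads a" and zero: "\<And>i j. a 2 i j = 0"
    and Q: "\<And>t' v' a'. constants v' \<Longrightarrow> (\<And>k. k \<noteq> 2 \<Longrightarrow> a' k = a k) \<Longrightarrow> (\<And>i j. a' 2 i j = idx (i + ox, j + oy)) \<Longrightarrow>
      t' \<le> t + 30 * N + 5 \<Longrightarrow> Q (t', v', a')"
  shows "wp C (2 * N) tabulate_positions Q (t, v, a)"
proof -
  let ?I = "pos_inv a (t + 30 * N + 3)"
  let ?body = "read_position ;; Wr 2 24 25 5 ;; Ad 20 20 23 ;; Sb 15 15 1"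
  have "wp C (2 * N) (WhileP 15 ?body) Q (t + 3, v(15 := N, 5 := 0, 20 := 2), a)"
  proof (rule wp_While[where I = ?I and bd = "t + 30 * N + 3"])
    have "(if idx q \<le> 0 then idx q else 0) = 0" for q using idx_range[of q] by auto
    then show "?I (t + 3, v(15 := N, 5 := 0, 20 := 2), a)"
      using con zero unfolding pos_inv_def constants_def by simp
  next
    fix t' v' a'
    assume "?I (t', v', a')"
    then show "t' \<le> t + 30 * N + 3" unfolding pos_inv_def by auto
  next
    fix t' v' a'
    assume inv: "?I (t', v', a')" and pos: "0 < v' 15"
    note inv' = inv[unfolded pos_inv_def prod.case]
    define k where "k = nat (v' 5)"
    have k: "v' 5 = int k" "k < length xs" using inv' pos unfolding k_def by auto
    let ?i = "fst (pos k) - ox" and ?j = "snd (pos k) - oy"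
    have rd': "reads a'" using rd inv' unfolding reads_def by simp
    have v: "v' (Suc 0) = 1" "v' 23 = 10" "v' 20 = 2 + 10 * int k" "constants v'"
      using inv' k by (auto simp: constants_def)
    have b: "in_bounds C (2 * N) 2 ?i ?j"
      using coord_range[OF k(2)] C_bounds(2) unfolding in_bounds_def by auto
    have tab: "((a' 2)(?i := (a' 2 ?i)(?j := int k + 1))) i j =
        (if idx (i + ox, j + oy) \<le> int k + 1 then idx (i + ox, j + oy) else 0)" for i j
    proof (cases "i = ?i \<and> j = ?j")
      case True
      then have "(i + ox, j + oy) = pos k" by (simp add: prod_eq_iff)
      then show ?thesis using idx_pos[OF k(2)] True by simp
    next
      case False
      then have "(i + ox, j + oy) \<noteq> pos k" by (auto simp: prod_eq_iff)
      then have "idx (i + ox, j + oy) \<noteq> int k + 1"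
        using idx_cases[of "(i + ox, j + oy)"] by (metis add_right_cancel of_nat_0_le_iff of_nat_eq_iff add_nonneg_pos zero_less_one less_irrefl)
      then have "idx (i + ox, j + oy) \<le> int k + 1 \<longleftrightarrow> idx (i + ox, j + oy) \<le> int k" by linarith
      then show ?thesis using False inv' k by auto
    qed
    show "wp C (2 * N) ?body (\<lambda>(t', v', a'). ?I (t' + 1, v', a')) (t' + 1, v', a')"
      using b v k pos inv' tab
      by (simp add: read_position_wp[OF v(4) rd' k(2) v(3)] pos_inv_def constants_def)
  next
    fix t' v' a'
    assume inv: "?I (t', v', a')" and "v' 15 \<le> 0"
    note inv' = inv[unfolded pos_inv_def prod.case]
    have "v' 15 = 0" "v' 5 = N" using inv' \<open>v' 15 \<le> 0\<close> by auto
    then show "Q (t' + 2, v', a')"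
      using inv' idx_range by (intro Q) auto
  qed
  then show ?thesis
    unfolding tabulate_positions_def using con by (simp add: constants_def ac_simps)
qed

definition arcs_inv :: "arrays \<Rightarrow> int \<Rightarrow> state \<Rightarrow> bool" where
  "arcs_inv a\<^sub>0 T = (\<lambda>(t, v, a). constants v \<and> (\<forall>k. k \<notin> {3, 4} \<longrightarrow> a k = a\<^sub>0 k) \<and> v 5 = N - v 15 \<and> 0 \<le> v 15 \<and>
     v 15 \<le> N \<and> v 20 = 2 + 10 * v 5 \<and>
     (\<forall>k d. int k < v 5 \<longrightarrow> a 3 (int k + 1) (slot d) = target k d \<and> a 4 (int k + 1) (slot d) = bond k d) \<and>
     t + 400 * v 15 \<le> T)"

lemma arcs_correct:
  assumes con: "constants v" and rd: "reads a" and k: "k < length xs"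
    and v: "v 5 = int k + 1" "v 20 = 2 + 10 * int k" "v 24 = fst (pos k) - ox" "v 25 = snd (pos k) - oy"
    and tab: "\<And>i j. a 2 i j = idx (i + ox, j + oy)"
    and Q: "\<And>t' v' a'. t' \<le> t + 360 \<Longrightarrow> (\<And>x. x \<notin> {26..34} \<Longrightarrow> v' x = v x) \<Longrightarrow>
      (\<And>k. k \<notin> {3, 4} \<Longrightarrow> a' k = a k) \<Longrightarrow>
      (\<And>i j. i \<noteq> int k + 1 \<Longrightarrow> a' 3 i j = a 3 i j \<and> a' 4 i j = a 4 i j) \<Longrightarrow>
      (\<And>d. a' 3 (int k + 1) (slot d) = target k d \<and> a' 4 (int k + 1) (slot d) = bond k d) \<Longrightarrow>
      wp C (2 * N) c Q (t', v', a')"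
  shows "wp C (2 * N) (arc North ;; arc South ;; arc East ;; arc West ;; c) Q (t, v, a)"
proof -
  \<comment> \<open>\<open>ds\<close> collects the finished directions, so that one lemma
    \<open>step\<close> serves all four arcs, at 90 ticks each.\<close>
  define P :: "direction set \<Rightarrow> int \<Rightarrow> state \<Rightarrow> bool" where "P ds t\<^sub>1 = (\<lambda>(t', v', a'). t' \<le> t\<^sub>1 \<and> (\<forall>x. x \<notin> {26..34} \<longrightarrow> v' x = v x) \<and>
      (\<forall>k. k \<notin> {3, 4} \<longrightarrow> a' k = a k) \<and>
      (\<forall>i j. i \<noteq> int k + 1 \<longrightarrow> a' 3 i j = a 3 i j \<and> a' 4 i j = a 4 i j) \<and>
      (\<forall>d\<in>ds. a' 3 (int k + 1) (slot d) = target k d \<and> a' 4 (int k + 1) (slot d) = bond k d))"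
    for ds t\<^sub>1
  have step: "wp C (2 * N) (arc d) Q' (t', v', a')"
    if p: "P ds t\<^sub>1 (t', v', a')" and Q': "\<And>t' v' a'. P (insert d ds) (t\<^sub>1 + 90) (t', v', a') \<Longrightarrow> Q' (t', v', a')"
    for ds t\<^sub>1 d Q' t' v' a'
  proof (rule arc_correct[OF _ _ k])
    note p' = p[unfolded P_def prod.case]
    show "constants v'" using con p' unfolding constants_def by auto
    show "reads a'" using rd p' unfolding reads_def by auto
    show "v' 5 = int k + 1" "v' 20 = 2 + 10 * int k" "v' 24 = fst (pos k) - ox" "v' 25 = snd (pos k) - oy"
      using v p' by auto
    show "a' 2 i j = idx (i + ox, j + oy)" for i j using tab p' by auto
    fix t2 v2
    assume "t2 \<le> t' + 90" "\<And>x. x \<notin> {26..34} \<Longrightarrow> v2 x = v' x"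
    then show "Q' (t2, v2, a'(3 := (a' 3)(int k + 1 := (a' 3 (int k + 1))(slot d := target k d)),
        4 := (a' 4)(int k + 1 := (a' 4 (int k + 1))(slot d := bond k d))))"
      using p' by (intro Q') (auto simp: P_def slot_inj)
  qed
  have all: "wp C (2 * N) c Q (t', v', a')" if "P {West, East, South, North} (t + 360) (t', v', a')" for t' v' a'
  proof -
    have "{West, East, South, North} = UNIV" using UNIV_direction by auto
    with that show ?thesis unfolding P_def by (intro Q) auto
  qed
  have west: "wp C (2 * N) (arc West) (wp C (2 * N) c Q) (t', v', a')"
    if "P {East, South, North} (t + 270) (t', v', a')" for t' v' a'
    by (rule step[OF that]) (rule all, simp add: add.commute)
  have east: "wp C (2 * N) (arc East) (wp C (2 * N) (arc West) (wp C (2 * N) c Q)) (t', v', a')"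
    if "P {South, North} (t + 180) (t', v', a')" for t' v' a'
    by (rule step[OF that]) (rule west, simp add: add.commute)
  have south: "wp C (2 * N) (arc South) (wp C (2 * N) (arc East) (wp C (2 * N) (arc West) (wp C (2 * N) c Q)))
      (t', v', a')"
    if "P {North} (t + 90) (t', v', a')" for t' v' a'
    by (rule step[OF that]) (rule east, simp add: add.commute)
  have "P {} t (t, v, a)" by (simp add: P_def)
  then have "wp C (2 * N) (arc North) (wp C (2 * N) (arc South) (wp C (2 * N) (arc East)
      (wp C (2 * N) (arc West) (wp C (2 * N) c Q)))) (t, v, a)"
    by (rule step) (rule south)
  moreover have "wp C (2 * N) (c1 ;; c2) Q = wp C (2 * N) c1 (wp C (2 * N) c2 Q)" for c1 c2 Q
    by (rule ext) simp
  ultimately show ?thesis by simp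
qed

lemma tabulate_arcs_correct:
  assumes con: "constants v" and rd: "reads a" and tab: "\<And>i j. a 2 i j = idx (i + ox, j + oy)"
    and Q: "\<And>t' v' a'. constants v' \<Longrightarrow> (\<And>k. k \<notin> {3, 4} \<Longrightarrow> a' k = a k) \<Longrightarrow>
      (\<And>k d. k < length xs \<Longrightarrow> a' 3 (int k + 1) (slot d) = target k d \<and> a' 4 (int k + 1) (slot d) = bond k d) \<Longrightarrow>
      t' \<le> t + 400 * N + 5 \<Longrightarrow> Q (t', v', a')"
  shows "wp C (2 * N) tabulate_arcs Q (t, v, a)"
proof -
  let ?I = "arcs_inv a (t + 400 * N + 3)"
  let ?rest = "Ad 20 20 23 ;; Sb 15 15 1"
  let ?body = "read_position ;; arc North ;; arc South ;; arc East ;; arc West ;; ?rest"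
  have "wp C (2 * N) (WhileP 15 ?body) Q (t + 3, v(15 := N, 5 := 0, 20 := 2), a)"
  proof (rule wp_While[where I = ?I and bd = "t + 400 * N + 3"])
    show "?I (t + 3, v(15 := N, 5 := 0, 20 := 2), a)"
      using con unfolding arcs_inv_def constants_def by simp
  next
    fix t' v' a'
    assume "?I (t', v', a')"
    then show "t' \<le> t + 400 * N + 3" unfolding arcs_inv_def by auto
  next
    fix t' v' a'
    assume inv: "?I (t', v', a')" and pos: "0 < v' 15"
    note inv' = inv[unfolded arcs_inv_def prod.case]
    define k where "k = nat (v' 5)"
    have k: "v' 5 = int k" "k < length xs" using inv' pos unfolding k_def by auto
    have rd': "reads a'" using rd inv' unfolding reads_def by simp
    have v: "v' 20 = 2 + 10 * int k" "constants v'" using inv' k by auto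
    let ?v = "v'(5 := v' 5 + 1, 24 := fst (pos k) - ox, 25 := snd (pos k) - oy)"
    have "wp C (2 * N) (arc North ;; arc South ;; arc East ;; arc West ;; ?rest)
        (\<lambda>(t', v', a'). ?I (t' + 1, v', a')) (t' + 15, ?v, a')"
    proof (rule arcs_correct[OF _ rd' k(2)])
      show "constants ?v" using v(2) by (simp add: constants_def)
      show "a' 2 i j = idx (i + ox, j + oy)" for i j using inv' tab by simp
      fix t2 v2 a2
      assume 2: "t2 \<le> t' + 15 + 360" "\<And>x. x \<notin> {26..34} \<Longrightarrow> v2 x = ?v x"
        "\<And>k. k \<notin> {3, 4} \<Longrightarrow> a2 k = a' k"
        "\<And>i j. i \<noteq> int k + 1 \<Longrightarrow> a2 3 i j = a' 3 i j \<and> a2 4 i j = a' 4 i j"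
        "\<And>d. a2 3 (int k + 1) (slot d) = target k d \<and> a2 4 (int k + 1) (slot d) = bond k d"
      have v2: "v2 5 = int k + 1" "v2 15 = v' 15" "v2 20 = v' 20" "v2 23 = 10" "v2 (Suc 0) = 1" "constants v2"
        using 2(2) v(2) k(1) by (auto simp: constants_def)
      have "a2 3 (int l + 1) (slot d) = target l d \<and> a2 4 (int l + 1) (slot d) = bond l d"
        if "int l < int k + 1" for l d
        using 2(4)[of "int l + 1" "slot d"] 2(5)[of d] inv' k that by (cases "l = k") auto
      moreover have "\<forall>k. k \<notin> {3, 4} \<longrightarrow> a2 k = a k" using 2(3) inv' by auto
      ultimately show "wp C (2 * N) ?rest (\<lambda>(t', v', a'). ?I (t' + 1, v', a')) (t2, v2, a2)"
        using v2 2(1) inv' pos k by (simp add: arcs_inv_def constants_def)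
    qed (use v k in simp_all)
    then show "wp C (2 * N) ?body (\<lambda>(t', v', a'). ?I (t' + 1, v', a')) (t' + 1, v', a')"
      by (subst wp_simps(8)) (simp only: read_position_wp[OF v(2) rd' k(2) v(1)] add.assoc, simp)
  next
    fix t' v' a'
    assume inv: "?I (t', v', a')" and "v' 15 \<le> 0"
    note inv' = inv[unfolded arcs_inv_def prod.case]
    have "v' 15 = 0" "v' 5 = N" using inv' \<open>v' 15 \<le> 0\<close> by auto
    then show "Q (t' + 2, v', a')"
      using inv' by (intro Q) auto
  qed
  then show ?thesis
    unfolding tabulate_arcs_def using con by (simp add: constants_def ac_simps)
qed

end

section \<open>The decision procedure\<close>

text \<open>A discrete intermediate value theorem: along a path \<open>f\<close> changes by at most
  1 per step and cannot skip a value.\<close>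

lemma grid_path_interval:
  fixes f :: "position \<Rightarrow> int"
  assumes "(p, q) \<in> (grid_edges S)\<^sup>*" "p \<in> S"
    and f: "\<And>p d. \<bar>f (neighbour p d) - f p\<bar> \<le> 1"
  shows "{min (f p) (f q)..max (f p) (f q)} \<subseteq> f ` S"
  using assms(1)
proof (induction rule: rtrancl_induct)
  case base
  then show ?case using assms(2) by auto
next
  case (step q r)
  then obtain d where "r \<in> S" "r = neighbour q d" by (auto simp: grid_edges_def)
  with f[of q d] have "r \<in> S" "\<bar>f r - f q\<bar> \<le> 1" by simp_all
  then have "{min (f p) (f r)..max (f p) (f r)} \<subseteq> insert (f r) {min (f p) (f q)..max (f p) (f q)}"
    by auto
  then show ?case using step.IH \<open>r \<in> S\<close> by auto
qed

text \<open>The interval between the two values has one element more than their distance, and each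
  element is attained on the domain; hence the strict inequality.\<close>

lemma assembly_diameter:
  fixes f :: "position \<Rightarrow> int"
  assumes "is_assembly \<alpha>" "p \<in> dom \<alpha>" "q \<in> dom \<alpha>" and f: "\<And>p d. \<bar>f (neighbour p d) - f p\<bar> \<le> 1"
  shows "\<bar>f q - f p\<bar> < int (card (dom \<alpha>))"
proof -
  have fin: "finite (dom \<alpha>)" and "(p, q) \<in> (grid_edges (dom \<alpha>))\<^sup>*"
    using assms unfolding is_assembly_def by auto
  with grid_path_interval[OF _ assms(2) f] have "card {min (f p) (f q)..max (f p) (f q)} \<le> card (f ` dom \<alpha>)"
    by (intro card_mono) auto
  also have "\<dots> \<le> card (dom \<alpha>)" using fin by (rule card_image_le)
  finally show ?thesis by auto
qed

lemma nth_concat_blocks: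
  assumes "\<And>x. length (f x) = m" "k < length xs" "i < m"
  shows "concat (map f xs) ! (m * k + i) = f (xs ! k) ! i"
  using assms(2,3)
proof (induction xs arbitrary: k)
  case (Cons x xs)
  then show ?case using assms(1) by (cases k) (auto simp: nth_append)
qed simp

lemma length_encode_tile: "length (encode_tile x) = 10"
  by (cases x rule: encode_tile.cases) (simp add: encode_glue_def)

lemma length_encode: "length (encode \<tau> xs) = 2 + 10 * length xs"
  by (induction xs) (auto simp: encode_def length_encode_tile)

lemma nth_encode:
  assumes "k < length xs" "i < 10"
  shows "encode \<tau> xs ! (2 + 10 * k + i) = encode_tile (xs ! k) ! i"
  using nth_concat_blocks[of encode_tile 10 k xs i] assms
  by (simp add: encode_def length_encode_tile)

context input
begin

definition memory :: arrays where
  "memory = (\<lambda>k i j. if k = 0 \<and> i = 0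
     then (if nat j < length (encode \<tau> xs) then encode \<tau> xs ! nat j else 0) else 0)"

lemma memory_field:
  assumes "k < length xs" "i < 10"
  shows "memory 0 0 (2 + 10 * int k + int i) = encode_tile (xs ! k) ! i"
proof -
  have "nat (2 + 10 * int k + int i) = 2 + 10 * k + i" by simp
  moreover have "2 + 10 * k + i < length (encode \<tau> xs)" using assms by (simp add: length_encode)
  ultimately show ?thesis using nth_encode[OF assms] by (simp add: memory_def)
qed

lemma reads_memory: "reads memory"
  unfolding reads_def
proof (intro conjI allI impI)
  show "memory 0 0 0 = N" "memory 0 0 1 = int \<tau>"
    by (simp_all add: memory_def encode_def)
  fix k assume k: "k < length xs"
  obtain x y tl where xk: "xs ! k = ((x, y), tl)" by (metis prod.collapse)
  show "memory 0 0 (2 + 10 * int k) = fst (pos k)" "memory 0 0 (3 + 10 * int k) = snd (pos k)"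
    using memory_field[OF k, of 0] memory_field[OF k, of 1] by (simp_all add: xk add.commute)
  show "memory 0 0 (2 + 10 * int k + glue_offset d) = int (label (glue_on (tile k) d))" for d
    using memory_field[OF k, of "nat (glue_offset d)"]
    by (cases d) (simp_all add: xk encode_glue_def)
  show "memory 0 0 (3 + 10 * int k + glue_offset d) = int (strength (glue_on (tile k) d))" for d
    using memory_field[OF k, of "nat (glue_offset d + 1)"]
    by (cases d) (simp_all add: xk encode_glue_def add.commute)
qed

lemma read_header_correct:
  assumes Q: "\<And>t' v'. constants v' \<Longrightarrow> t' \<le> t + 40 \<Longrightarrow> Q (t', v', memory)"
  shows "wp C (2 * N) read_header Q (t, \<lambda>_. 0, memory)"
proof -
  have "0 < length xs" using nonempty by simp
  with reads_memory have m: "memory 0 0 0 = N" "memory 0 0 (Suc 0) = int \<tau>" "memory 0 0 1 = int \<tau>"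
    "memory 0 0 2 = fst (pos 0)" "memory 0 0 3 = snd (pos 0)"
    unfolding reads_def by force+
  show ?thesis
    unfolding read_header_def using C_bounds
    by (simp add: m in_bounds_def) (auto intro!: Q simp: constants_def ox_def oy_def)
qed

end

section \<open>Correspondence between vertices and positions\<close>

locale assembly_input = input +
  fixes \<alpha> :: assembly
  assumes assembly: "is_assembly \<alpha>" and \<tau>: "0 < \<tau>" and map_of: "map_of xs = \<alpha>"
begin

lemma \<alpha>_pos: "k < length xs \<Longrightarrow> \<alpha> (pos k) = Some (tile k)"
  using distinct map_of by (metis map_of_eq_Some_iff nth_mem prod.collapse)

definition place :: "int \<Rightarrow> position" where
  "place v = pos (nat (v - 1))"

lemma place_idx: "p \<in> dom \<alpha> \<Longrightarrow> place (idx p) = p \<and> idx p \<in> {1..N}"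
proof -
  assume "p \<in> dom \<alpha>"
  then have "p \<in> set (map fst xs)" using map_of by (metis dom_map_of_conv_image_fst list.set_map)
  then obtain k where "k < length xs" "pos k = p" by (auto simp: in_set_conv_nth)
  then show ?thesis using idx_pos[of k] by (auto simp: place_def)
qed

lemma idx_place: "v \<in> {1..N} \<Longrightarrow> idx (place v) = v \<and> place v \<in> dom \<alpha>"
  using idx_pos[of "nat (v - 1)"] \<alpha>_pos[of "nat (v - 1)"] by (auto simp: place_def)

lemma inj_place: "inj_on place {1..N}"
  using idx_place by (metis inj_onI)

lemma bond_eq:
  assumes k: "k < length xs" and l: "l < length xs"
  shows "(if target k d = int l + 1 then bond k d else 0) =
    (if neighbour (pos k) d = pos l \<and> interacts \<alpha> (pos k) d
     then int (strength (glue_on (the (\<alpha> (pos k))) d)) else 0)"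
proof -
  let ?q = "neighbour (pos k) d"
  have int: "interacts \<alpha> (pos k) d \<longleftrightarrow>
      glue_on (tile k) d = glue_on (tile l) (opposite d) \<and> 0 < strength (glue_on (tile k) d)"
    if "?q = pos l"
    using \<alpha>_pos[OF k] \<alpha>_pos[OF l] that unfolding interacts_def by auto
  show ?thesis
  proof (cases "?q = pos l")
    case True
    then have m: "matches k d \<longleftrightarrow> glue_on (tile k) d = glue_on (tile l) (opposite d)"
      using idx_pos[OF l] by (simp add: matches_def)
    then show ?thesis
      using True int idx_pos[OF l] \<alpha>_pos[OF k] by (auto simp: target_def bond_def)
  next
    case False
    \<comment> \<open>Without a match, \<open>target\<close> can still be \<open>int l + 1\<close>,
      namely the default loop for \<open>l = k\<close>, but then \<open>bond\<close> is 0.\<close>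
    have "matches k d \<longrightarrow> idx ?q \<noteq> int l + 1"
      using False idx_cases[of ?q] by (metis add_right_cancel of_nat_eq_iff of_nat_0_le_iff add_nonneg_pos zero_less_one less_irrefl)
    then show ?thesis using False by (auto simp: target_def bond_def)
  qed
qed

lemma arc_weight_eq:
  assumes tab: "\<And>k d. k < length xs \<Longrightarrow> nb (int k + 1) (slot d) = target k d \<and> wt (int k + 1) (slot d) = bond k d"
    and v: "v \<in> {1..N}" and u: "u \<in> {1..N}"
  shows "arc_weight nb wt v u = int (edge_weight \<alpha> (place v) (place u))"
proof -
  define k l where "k = nat (v - 1)" and "l = nat (u - 1)"
  have k: "k < length xs" "v = int k + 1" and l: "l < length xs" "u = int l + 1"
    using v u by (auto simp: k_def l_def)
  have "arc_weight nb wt v u = (\<Sum>d\<in>UNIV. if nb v (slot d) = u then wt v (slot d) else 0)"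
    unfolding arc_weight_def by (rule sum.reindex_bij_betw[OF slot_bij, symmetric])
  also have "\<dots> = (\<Sum>d\<in>UNIV. if target k d = int l + 1 then bond k d else 0)"
    using tab[OF k(1)] unfolding k(2) l(2) by (intro sum.cong) auto
  also have "\<dots> = int (edge_weight \<alpha> (pos k) (pos l))"
    unfolding edge_weight_def of_nat_sum bond_eq[OF k(1) l(1)] by (intro sum.cong) auto
  finally show ?thesis by (simp add: place_def k_def l_def)
qed

lemma label_weight_eq:
  assumes "\<And>v u. v \<in> {1..N} \<Longrightarrow> u \<in> {1..N} \<Longrightarrow> w v u = int (edge_weight \<alpha> (place v) (place u))"
  shows "label_weight N w L x y =
    int (cross_weight \<alpha> (place ` cluster N L x) (place ` cluster N L y))"
proof -
  have inj: "inj_on place (cluster N L z)" for z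
    using inj_place cluster_subset by (rule inj_on_subset)
  show ?thesis
    unfolding label_weight_def cross_weight_def sum.reindex[OF inj] o_def of_nat_sum
    using cluster_subset by (intro sum.cong refl assms) blast+
qed

definition good :: "int set \<Rightarrow> bool" where
  "good S \<longleftrightarrow> producible (ran \<alpha>) \<tau> (\<alpha> |` (place ` S))"

lemma merging:
  assumes tab: "\<And>k d. k < length xs \<Longrightarrow> nb (int k + 1) (slot d) = target k d \<and> wt (int k + 1) (slot d) = bond k d"
  shows "merging N (int \<tau>) C nb wt good"
proof -
  have tab': "\<exists>k d. k < length xs \<and> nb v s = target k d \<and> wt v s = bond k d"
    if v: "v \<in> {1..N}" and s: "s \<in> {1..4}" for v s
  proof -
    have "s \<in> range slot" using s slot_bij by (simp add: bij_betw_def)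
    then obtain d where "s = slot d" by blast
    moreover have "v = int (nat (v - 1)) + 1" "nat (v - 1) < length xs" using v by auto
    ultimately show ?thesis using tab by metis
  qed
  have weight: "label_weight N (arc_weight nb wt) L x y =
      int (cross_weight \<alpha> (place ` cluster N L x) (place ` cluster N L y))" for L x y
    by (rule label_weight_eq) (rule arc_weight_eq[OF tab])
  have target: "target k d \<in> {1..N}" if "k < length xs" for k d
  proof (cases "matches k d")
    case True
    then have "0 < idx (neighbour (pos k) d)" by (simp add: matches_def Let_def)
    with True show ?thesis using idx_range[of "neighbour (pos k) d"] by (simp add: target_def)
  qed (use that in \<open>simp add: target_def\<close>)
  show ?thesis
  proof
    show "1 \<le> N" "C \<le> C" "0 < int \<tau>" using C_bounds \<tau> by auto
    show "nb v s \<in> {1..N}" if "v \<in> {1..N}" "s \<in> {1..4}" for v s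
      using tab'[OF that] target by metis
    show "arc_weight nb wt v u = arc_weight nb wt u v" if "v \<in> {1..N}" "u \<in> {1..N}" for v u
      using that by (simp add: arc_weight_eq[OF tab] edge_weight_commute)
    show "good {v}" if v: "v \<in> {1..N}" for v
    proof -
      obtain tl where "\<alpha> (place v) = Some tl" using idx_place[OF v] by auto
      moreover from this have "\<alpha> |` {place v} = [place v \<mapsto> tl]" by (auto simp: restrict_map_def fun_eq_iff)
      ultimately show ?thesis
        unfolding good_def by (auto intro: producible.single ranI)
    qed
    show "good (cluster N L x \<union> cluster N L y)"
      if "x \<noteq> y" "good (cluster N L x)" "good (cluster N L y)"
        "int \<tau> \<le> label_weight N (arc_weight nb wt) L x y" for x y L
      unfolding good_def image_Un
    proof (rule producible_Un)
      show "place ` cluster N L x \<union> place ` cluster N L y \<subseteq> dom \<alpha>"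
        using idx_place cluster_subset by blast
      show "place ` cluster N L x \<inter> place ` cluster N L y = {}"
        using that(1) inj_onD[OF inj_place] cluster_subset unfolding cluster_def by fastforce
      show "\<tau> \<le> cross_weight \<alpha> (place ` cluster N L x) (place ` cluster N L y)"
        using that(4) unfolding weight by simp
    qed (use that \<tau> in \<open>simp_all add: good_def\<close>)
  qed
qed

text \<open>One direction is \<open>good\<close> for the single cluster. For the other,
  \<open>producible_labelling\<close> is applied to the final labels; \<open>stuck\<close> rules out
  its second alternative.\<close>

lemma producible_iff:
  assumes tab: "\<And>k d. k < length xs \<Longrightarrow> nb (int k + 1) (slot d) = target k d \<and> wt (int k + 1) (slot d) = bond k d"
    and good: "\<forall>x\<in>L ` {1..N}. good (cluster N L x)"
    and stuck: "\<forall>x\<in>L ` {1..N}. \<forall>y\<in>L ` {1..N}. x \<noteq> y \<longrightarrow> label_weight N (arc_weight nb wt) L x y < int \<tau>"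
  shows "producible (ran \<alpha>) \<tau> \<alpha> \<longleftrightarrow> cluster N L (L 1) = {1..N}"
proof
  have one: "1 \<in> {1..N}" using C_bounds by simp
  have dom: "place ` {1..N} = dom \<alpha>"
  proof
    show "place ` {1..N} \<subseteq> dom \<alpha>" using idx_place by blast
    show "dom \<alpha> \<subseteq> place ` {1..N}" using place_idx by (metis image_eqI subsetI)
  qed
  {
    assume "cluster N L (L 1) = {1..N}"
    with good one have "producible (ran \<alpha>) \<tau> (\<alpha> |` dom \<alpha>)"
      unfolding good_def dom[symmetric] by (metis imageI)
    moreover have "\<alpha> |` dom \<alpha> = \<alpha>" by (auto simp: restrict_map_def fun_eq_iff domIff)
    ultimately show "producible (ran \<alpha>) \<tau> \<alpha>" by simp
  }
  assume prod: "producible (ran \<alpha>) \<tau> \<alpha>"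
  let ?f = "\<lambda>p. L (idx p)"
  have cl: "{p \<in> dom \<alpha>. ?f p = x} = place ` cluster N L x" for x
  proof
    show "{p \<in> dom \<alpha>. ?f p = x} \<subseteq> place ` cluster N L x"
      using place_idx by (force simp: cluster_def image_iff)
    show "place ` cluster N L x \<subseteq> {p \<in> dom \<alpha>. ?f p = x}"
    proof
      fix p assume "p \<in> place ` cluster N L x"
      then obtain v where "v \<in> {1..N}" "L v = x" "p = place v" by (auto simp: cluster_def)
      with idx_place[of v] show "p \<in> {p \<in> dom \<alpha>. ?f p = x}" by simp
    qed
  qed
  have weight: "label_weight N (arc_weight nb wt) L x y =
      int (cross_weight \<alpha> (place ` cluster N L x) (place ` cluster N L y))" for x y
    by (rule label_weight_eq) (rule arc_weight_eq[OF tab])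
  have "finite (dom \<alpha>)" using assembly by (simp add: is_assembly_def)
  from producible_labelling[OF prod map_le_refl this, of ?f]
  consider x where "\<forall>p\<in>dom \<alpha>. ?f p = x"
    | x y where "x \<noteq> y" "\<tau> \<le> cross_weight \<alpha> (place ` cluster N L x) (place ` cluster N L y)"
    unfolding cl by blast
  then show "cluster N L (L 1) = {1..N}"
  proof cases
    case 1
    then have "L v = x" if "v \<in> {1..N}" for v using idx_place[OF that] by force
    then have "L v = L 1" if "v \<in> {1..N}" for v using that one by metis
    then show ?thesis unfolding cluster_def by blast
  next
    case 2
    \<comment> \<open>The labels come from \<open>producible_labelling\<close> without being known
      to occur; positive cross weight shows that both do, as \<open>stuck\<close> requires.\<close>
    then have "cluster N L x \<noteq> {}" "cluster N L y \<noteq> {}"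
      using \<tau> by (auto simp: cross_weight_def)
    then have "x \<in> L ` {1..N}" "y \<in> L ` {1..N}" by (auto simp: cluster_def)
    then have "label_weight N (arc_weight nb wt) L x y < int \<tau>" using stuck 2(1) by blast
    then show ?thesis using 2(2) unfolding weight by simp
  qed
qed

text \<open>Reading takes at most \<open>430 * n + 50\<close> and merging
  \<open>520 * n + 50\<close> ticks besides the term with the logarithm; 1000 rounds up 950.\<close>

definition bound :: nat where
  "bound = nat \<lceil>600 * (real (length xs) * log 2 (real (length xs))) + 1000 * real (length xs) + 100\<rceil>"

lemma decide_correct:
  "wp C (2 * N) decide (\<lambda>(t, v, a). t \<le> int bound \<and> v 19 = (if producible (ran \<alpha>) \<tau> \<alpha> then 1 else 0))
     (0, \<lambda>_. 0, memory)"
proof -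
  let ?Q = "\<lambda>(t, v, a). t \<le> int bound \<and> v 19 = (if producible (ran \<alpha>) \<tau> \<alpha> then 1 else 0)"
  have merge: "wp C (2 * N) merge_clusters ?Q (t, v, a)"
    if con: "constants v" and rest: "\<And>k. k \<notin> {2, 3, 4} \<Longrightarrow> a k = memory k"
      and tab: "\<And>k d. k < length xs \<Longrightarrow> a 3 (int k + 1) (slot d) = target k d \<and> a 4 (int k + 1) (slot d) = bond k d"
      and t: "t \<le> 50 + 430 * N" for t v a
  proof -
    \<comment> \<open>The graph is known only at this point, when arrays 3 and 4 have been
      filled.\<close>
    interpret merging N "int \<tau>" C "a 3" "a 4" good by (rule merging[OF tab])
    show ?thesis
    proof (rule merge_clusters_correct)
      show "frame v a" using con by (simp add: frame_def constants_def)
      show "\<forall>u. a 5 0 u = 0" "\<forall>x y. a 6 x y = 0" "\<forall>x. a 8 0 x = 0"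
        using rest[of 5] rest[of 6] rest[of 8] by (simp_all add: memory_def)
      fix t' v' a' L
      assume 1: "real_of_int t' \<le> t + 520 * N + 600 * (N * log 2 N) + 50"
        "\<forall>x\<in>L ` {1..N}. good (cluster N L x)"
        "\<forall>x\<in>L ` {1..N}. \<forall>y\<in>L ` {1..N}. x \<noteq> y \<longrightarrow> weight L x y < int \<tau>"
        "v' (19::nat) = (if cluster N L (L 1) = {1..N} then 1 else 0 :: int)"
      have "real_of_int t \<le> 50 + 430 * real (length xs)" using t by linarith
      then have "real_of_int t' \<le> 600 * (real (length xs) * log 2 (real (length xs))) + 1000 * real (length xs) + 100"
        using 1(1) by simp
      then have "t' \<le> int bound" unfolding bound_def by linarith
      then show "?Q (t', v', a')"
        using 1(4) producible_iff[OF tab 1(2,3)] by simp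
    qed
  qed
  have arcs: "wp C (2 * N) tabulate_arcs (wp C (2 * N) merge_clusters ?Q) (t, v, a)"
    if con: "constants v" and rest: "\<And>k. k \<noteq> 2 \<Longrightarrow> a k = memory k"
      and tab: "\<And>i j. a 2 i j = idx (i + ox, j + oy)" and t: "t \<le> 45 + 30 * N" for t v a
  proof (rule tabulate_arcs_correct)
    show "constants v" by (rule con)
    show "a 2 i j = idx (i + ox, j + oy)" for i j by (rule tab)
    show "reads a" using reads_memory rest unfolding reads_def by simp
    fix t' v' a'
    assume 1: "constants v'" "\<And>k. k \<notin> {3, 4} \<Longrightarrow> a' k = a k"
      "\<And>k d. k < length xs \<Longrightarrow> a' 3 (int k + 1) (slot d) = target k d \<and> a' 4 (int k + 1) (slot d) = bond k d"
      "t' \<le> t + 400 * N + 5"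
    show "wp C (2 * N) merge_clusters ?Q (t', v', a')"
    proof (rule merge[OF 1(1) _ 1(3)])
      show "a' k = memory k" if "k \<notin> {2, 3, 4}" for k using 1(2)[of k] rest[of k] that by simp
    qed (use 1(4) t in auto)
  qed
  have positions: "wp C (2 * N) tabulate_positions (wp C (2 * N) tabulate_arcs (wp C (2 * N) merge_clusters ?Q)) (t, v, memory)"
    if con: "constants v" and t: "t \<le> 40" for t v
  proof (rule tabulate_positions_correct[OF con reads_memory])
    show "memory 2 i j = 0" for i j by (simp add: memory_def)
    fix t' v' a'
    assume "constants v'" "\<And>k. k \<noteq> 2 \<Longrightarrow> a' k = memory k" "\<And>i j. a' 2 i j = idx (i + ox, j + oy)"
      "t' \<le> t + 30 * N + 5"
    then show "wp C (2 * N) tabulate_arcs (wp C (2 * N) merge_clusters ?Q) (t', v', a')"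
      using t by (intro arcs) auto
  qed
  have seq: "wp C (2 * N) (c1 ;; c2) Q = wp C (2 * N) c1 (wp C (2 * N) c2 Q)" for c1 c2 Q
    by (rule ext) simp
  show ?thesis
    unfolding decide_def seq by (rule read_header_correct) (rule positions, simp_all)
qed

lemma decide_outputs:
  "outputs_within (program_of decide 19) (encode \<tau> xs) (bound + 13 * length xs + 31)
     (if producible (ran \<alpha>) \<tau> \<alpha> then 1 else 0)"
proof (rule program_of_correct)
  show "0 < length xs" using nonempty by simp
  show "encode \<tau> xs \<noteq> []" "encode \<tau> xs ! 0 = N" by (simp_all add: encode_def)
  show "int (length (encode \<tau> xs)) \<le> C" using C_bounds(1) by (simp add: length_encode)
qed (use decide_correct in \<open>simp add: memory_def\<close>)

end

section \<open>Asymptotic running time\<close>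

definition time_bound :: "nat \<Rightarrow> nat" where
  "time_bound n = nat \<lceil>600 * (real n * log 2 (real n)) + 1000 * real n + 100\<rceil> + 13 * n + 31"

text \<open>From \<open>n = 2\<close> on the logarithm is at least 1, so n and n log n are at most n
  log^2 n. As 132 is at most \<open>66 * n\<close>, the constants add up to 600 + 1013 + 66, below
  1800.\<close>

lemma time_bound_bigo: "(\<lambda>n. real (time_bound n)) \<in> O(\<lambda>n. real n * (log 2 (real n))\<^sup>2)"
proof (rule bigoI[where c = 1800])
  show "\<forall>\<^sub>F n in sequentially. norm (real (time_bound n)) \<le> 1800 * norm (real n * (log 2 (real n))\<^sup>2)"
    using eventually_ge_at_top[of 2]
  proof eventually_elim
    case (elim n)
    define l where "l = log 2 (real n)"
    have l: "1 \<le> l" using elim by (simp add: l_def le_log_iff)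
    then have l2: "l \<le> l\<^sup>2" "1 \<le> l\<^sup>2"
      using power_increasing[of 1 2 l] one_le_power[of l 2] by simp_all
    have "real n * l \<le> real n * l\<^sup>2" "real n * 1 \<le> real n * l\<^sup>2"
      using l2 by (intro mult_left_mono; simp)+
    moreover have "real (time_bound n) \<le> 600 * (real n * l) + 1013 * real n + 132"
    proof -
      have "0 \<le> real n * l" using l by simp
      then have "real (nat \<lceil>600 * (real n * l) + 1000 * real n + 100\<rceil>) \<le> 600 * (real n * l) + 1000 * real n + 101"
        by linarith
      then show ?thesis unfolding time_bound_def l_def by simp
    qed
    moreover have "132 \<le> 66 * real n" using elim by simp
    ultimately have "real (time_bound n) \<le> 1800 * (real n * l\<^sup>2)" by linarith
    then show ?case by (simp add: l_def)
  qed
qed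

theorem theorem3p2:
  shows "\<exists>(P :: program) (time :: nat \<Rightarrow> nat).
    (\<lambda>n. real (time n)) \<in> O(\<lambda>n. real n * (log 2 (real n))\<^sup>2) \<and>
    (\<forall>(\<alpha> :: assembly) (\<tau> :: nat) (xs :: (position \<times> tile_type) list).
       is_assembly \<alpha> \<and> \<tau> > 0 \<and> lists_assembly xs \<alpha> \<longrightarrow>
       outputs_within P (encode \<tau> xs) (time (card (dom \<alpha>)))
         (if producible (ran \<alpha>) \<tau> \<alpha> then 1 else 0))"
proof (intro exI conjI allI impI)
  show "(\<lambda>n. real (time_bound n)) \<in> O(\<lambda>n. real n * (log 2 (real n))\<^sup>2)"
    by (rule time_bound_bigo)
  fix \<alpha> :: assembly and \<tau> :: nat and xs :: "(position \<times> tile_type) list"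
  assume "is_assembly \<alpha> \<and> \<tau> > 0 \<and> lists_assembly xs \<alpha>"
  then have as: "is_assembly \<alpha>" "\<tau> > 0" "distinct (map fst xs)" "map_of xs = \<alpha>"
    by (auto simp: lists_assembly_def)
  have dom: "dom \<alpha> = set (map fst xs)" using as(4) dom_map_of_conv_image_fst by force
  then have card: "card (dom \<alpha>) = length xs" using distinct_card[OF as(3)] by simp
  have ne: "xs \<noteq> []" using as(1) dom by (auto simp: is_assembly_def)
  have near: "\<bar>f (fst (xs ! k)) - f (fst (xs ! 0))\<bar> < int (length xs)"
    if "k < length xs" and f: "\<And>p d. \<bar>f (neighbour p d) - f p\<bar> \<le> 1" for k and f :: "position \<Rightarrow> int"
  proof -
    have "fst (xs ! k) \<in> dom \<alpha>" "fst (xs ! 0) \<in> dom \<alpha>" using that(1) ne unfolding dom by auto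
    then show ?thesis using assembly_diameter[OF as(1) _ _ f] card by metis
  qed
  have coords: "\<bar>fst (neighbour p d) - fst p\<bar> \<le> 1" "\<bar>snd (neighbour p d) - snd p\<bar> \<le> 1" for p d
    by (cases p; cases d; simp)+
  interpret assembly_input xs \<tau> \<alpha>
    using as ne near[of _ fst] near[of _ snd] coords by unfold_locales auto
  show "outputs_within (program_of decide 19) (encode \<tau> xs) (time_bound (card (dom \<alpha>)))
      (if producible (ran \<alpha>) \<tau> \<alpha> then 1 else 0)"
    using decide_outputs by (simp add: card time_bound_def bound_def)
qed

end
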